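(* Let $\mathfrak h=\langle H;\ddot o,b_j;d_j\rangle$ be an elementary indefinite Hamiltonian of kind (A), $\Delta:=\Delta(H)$, and let $F=(f,\xi,\alpha)$, $G=(g,\eta,\beta)$ be elements of $\mathring{\mathfrak P}(\mathfrak h)$, where $\xi=(\xi_i)_{i=0}^{\Delta-1}$, $\eta=(\eta_i)_{i=0}^{\Delta-1}$, $\alpha=(\alpha_k)_{k=1}^{\ddot o}$, $\beta=(\beta_k)_{k=1}^{\ddot o}$. Set $$B_k:=\begin{cases}\omega_k^-f(s_-)_1 & \text{if }(\sigma,s_+)\text{ is indivisible},\\ -\omega_k^+f(s_+)_1 & \text{if }(s_-,\sigma)\text{ is indivisible},\\ \omega_k^-f(s_-)_1-\omega_k^+f(s_+)_1 & \text{otherwise},\end{cases}\qquad k=1,\dots,\Delta .$$ Then $(F;G)\in\mathring T(\mathfrak h)$ if and only if the following relations (i)–(v) hold. (i) $f=f_0+\sum_{i=0}^{\Delta}\lambda_i\mathfrak w_i$ with $f_0\in\operatorname{dom}T_{\max}(H)$, $\lambda_0,\dots,\lambda_\Delta\in\mathbb C$, and $\bigl(f_0;\,g-\sum_{i=0}^{\Delta-1}\lambda_{i+1}\mathfrak w_i\bigr)\in T_{\max}(H)$. (ii) If $\ddot o=0$, then $$\xi_{\Delta-1}=\int_{s_-}^{s_+}\mathfrak w_\Delta^*H\Bigl(g-\sum_{i=0}^{\Delta-1}\lambda_{i+1}\mathfrak w_i\Bigr)+\frac12\sum_{i=0}^{\Delta-1}d_{\Delta-1+i}\lambda_i+d_{2\Delta-1}\lambda_\Delta-B_\Delta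 .$$ If $\ddot o>0$, then $\alpha_{\ddot o}=b_1\lambda_\Delta$. (iii) If neither $(s_-,\sigma)$ nor $(\sigma,s_+)$ is indivisible, then $\eta_0=f(s_-)_1-f(s_+)_1-\frac12\sum_{i=0}^{\Delta-1}d_i\lambda_{i+1}$. (iv) For $k\in\{1,\dots,\Delta-1\}$: $\eta_k=\xi_{k-1}-\frac12d_{k-1}\lambda_0-\frac12d_{k+\Delta-1}\lambda_\Delta+B_k$. (v) If $\ddot o>0$, then $$\beta_1=\int_{s_-}^{s_+}\mathfrak w_\Delta^*H\Bigl(g-\sum_{i=0}^{\Delta-1}\lambda_{i+1}\mathfrak w_i\Bigr)+\frac12\sum_{i=0}^{\Delta-1}d_{\Delta-1+i}\lambda_i+d_{2\Delta-1}\lambda_\Delta-\xi_{\Delta-1}-B_\Delta$$ and $\beta_j=\alpha_{j-1}-b_{\ddot o+2-j}\lambda_\Delta$ for $j=2,\dots,\ddot o$. Moreover, if $(F;G)\in\mathring T(\mathfrak h)$, then $$\mathring\Gamma(\mathfrak h)(F;G)(s_-)=\begin{cases}\begin{pmatrix}f(s_+)_1+\eta_0+\frac12\sum_{i=0}^{\Delta-1}d_i\lambda_{i+1}\\ \lambda_0\end{pmatrix}&\text{if }(s_-,\sigma)\text{ is indivisible},\\ f(s_-)&\text{otherwise},\end{cases}$$ $$\mathring\Gamma(\mathfrak h)(F;G)(s_+)=\begin{cases}\begin{pmatrix}f(s_-)_1-\eta_0-\frac12\sum_{i=0}^{\Delta-1}d_i\lambda_{i+1}\\ \lambda_0\end{pmatrix}&\text{if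 }(\sigma,s_+)\text{ is indivisible},\\ f(s_+)&\text{otherwise}.\end{cases}$$
   Context: **Hamiltonians.** $J=\begin{pmatrix}0&-1\\1&0\end{pmatrix}$. A Hamiltonian on an interval $(a,b)$ is a measurable, locally integrable function $H:(a,b)\to\mathbb R^{2\times2}$ with $H(t)\ge0$ a.e. and $\{t:H(t)=0\}$ of measure $0$; entries: $H=\begin{pmatrix}h_1&h_3\\ h_3&h_2\end{pmatrix}$. $H$ is in limit circle case at an endpoint if it is integrable near that endpoint, and in limit point case otherwise. An interval $(c,d)$ is $H$-indivisible of type $\phi$ if $\operatorname{ran}H(t)=\operatorname{span}\{\xi_\phi\}$ for a.a. $t\in(c,d)$, where $\xi_\phi=(\cos\phi,\sin\phi)^T$. Functions $f_1,f_2$ are identified ($f_1=_Hf_2$) if $Hf_1=Hf_2$ a.e. $L^2(H)$ is the space of classes modulo $=_H$ of measurable $f:(a,b)\to\mathbb C^2$ with $\int f^*Hf<\infty$ and such that $\xi_\phi^*f$ is a.e. constant on each $H$-indivisible interval of type $\phi$. $T_{\max}(H)$ is the set of $(f;g)\in L^2(H)\times L^2(H)$ for which $f$ has a locally absolutely continuous representative $\hat f$ with $\hat f'=JHg$ a.e. **The functions $\mathfrak w_n$.** Let $H_-$ be a Hamiltonian on $(s_-,\sigma)$, limit circle at $s_-$, limit point at $\sigma$, satisfying conditions (I) and (HS), i.e. $\int_{s_-}^{\sigma}h_1<\infty$ and $\int_{s_-}^{\sigma}\bigl(\int_{s_-}^th_2\bigr)h_1(t)\,dt<\infty$. Put $(\mathcal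 If)(t)=\int_{s_-}^tJH_-(s)f(s)\,ds$. $\Delta(H_-)$ is the infimum of all $n\in\mathbb N_0$ such that $\mathcal I^n\binom01+\sum_{k=0}^{n-1}\mathcal I^kv_{n-k}\in L^2(H_-)$ for some $v_1,\dots,v_n\in\mathbb C^2$ ($\inf\emptyset=\infty$). If $\Delta(H_-)<\infty$, there is a unique sequence $(\omega_n^-)_{n\ge0}$ with $\omega_0^-=1$ and $\sum_{k=0}^n\mathcal I^k\binom0{\omega^-_{n-k}}\in L^2(H_-)$ for all $n\ge\Delta(H_-)$; set $\mathfrak w_n:=\sum_{k=0}^n\mathcal I^k\binom0{\omega^-_{n-k}}$ on $[s_-,\sigma)$ for all $n\ge0$. For a Hamiltonian $H_+$ on $(\sigma,s_+)$, limit point at $\sigma$, limit circle at $s_+$, everything is analogous with $\int_t^{s_+}h_2$ instead of $\int_{s_-}^th_2$ in (HS) and with $(\tilde{\mathcal I}f)(t)=-\int_t^{s_+}JH_+(s)f(s)\,ds$, giving $\Delta(H_+)$, $(\omega_n^+)$ and $\mathfrak w_n$ on $(\sigma,s_+]$. **Elementary indefinite Hamiltonian of kind (A)**, $\mathfrak h=\langle H;\ddot o,b_j;d_j\rangle$: (1) finite non-empty intervals $(s_-,\sigma)$, $(\sigma,s_+)$ and Hamiltonians $H_-$ on $(s_-,\sigma)$ (limit circle at $s_-$, limit point at $\sigma$) and $H_+$ on $(\sigma,s_+)$ (limit point at $\sigma$, limit circle at $s_+$), both satisfying (I) and (HS), with $\Delta(H_\pm)<\infty$, and such that either no interval $(s,\sigma)$,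 $s\in[s_-,\sigma)$, is $H_-$-indivisible, or no interval $(\sigma,s)$, $s\in(\sigma,s_+)$, is $H_+$-indivisible; $H:=(H_-,H_+)$ and $\Delta:=\Delta(H):=\max\{\Delta(H_-),\Delta(H_+)\}$; (2) numbers $d_0,\dots,d_{2\Delta-1}\in\mathbb R$; (3) $\ddot o\in\mathbb N_0$ and, if $\ddot o>0$, $b_1,\dots,b_{\ddot o}\in\mathbb R$ with $b_1\ne0$. "$(s_-,\sigma)$ (resp. $(\sigma,s_+)$) is indivisible" means $H_-$- (resp. $H_+$-) indivisible. $L^2(H):=L^2(H_+)\oplus L^2(H_-)$, $T_{\max}(H):=T_{\max}(H_+)\oplus T_{\max}(H_-)$; $\mathfrak w_n$ is regarded as a function on $[s_-,\sigma)\cup(\sigma,s_+]$. The functions $\mathfrak w_0,\dots,\mathfrak w_{\Delta-1}$ are linearly independent modulo $L^2(H)$ and $\mathfrak w_0,\dots,\mathfrak w_\Delta$ are linearly independent modulo $\operatorname{dom}T_{\max}(H)$. **Model space.** $L^2_\Delta(H):=L^2(H)\dot+\operatorname{span}\{\mathfrak w_0,\dots,\mathfrak w_{\Delta-1}\}$, $\mathring{\mathfrak P}(\mathfrak h):=L^2_\Delta(H)\times\mathbb C^\Delta\times\mathbb C^{\ddot o}$. The values $f(s_-)$ (used only if $(s_-,\sigma)$ is not indivisible) and $f(s_+)$ (used only if $(\sigma,s_+)$ is not indivisible) are those of the unique locally absolutely continuous representative of $f$ satisfying $\hat f'=JHg$ a.e., extended to the endpoint. A subscript $1$ or $2$ denotes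 the respective component. **Model relation and boundary mapping.** Let $(\varepsilon_i)_{i=0}^{\Delta-1}$ and $(\varepsilon'_k)_{k=1}^{\ddot o}$ be the standard bases of $\mathbb C^\Delta$ and $\mathbb C^{\ddot o}$, and $\chi_\pm$ the indicator functions of $(\sigma,s_+)$ (for $+$) and $(s_-,\sigma)$ (for $-$). In $\mathring{\mathfrak P}(\mathfrak h)$ put $p_k:=(\mathfrak w_k,(\tfrac12d_{k+i})_{i=0}^{\Delta-1},0)$ for $0\le k\le\Delta-1$; $q:=(\mathfrak w_\Delta,(d_{\Delta+i})_{i=0}^{\Delta-1},(b_{\ddot o+1-k})_{k=1}^{\ddot o})$; $\delta_k:=(0,-\varepsilon_k,0)$ for $0\le k\le\Delta-1$ and $\delta_{\Delta-1+k}:=(0,0,\varepsilon'_k)$ for $1\le k\le\ddot o$; $e_\pm:=(\chi_\pm\binom10,(\pm\omega^\pm_{i+1})_{i=0}^{\Delta-1},0)$. The linear relation $\mathring T(\mathfrak h)\subseteq\mathring{\mathfrak P}(\mathfrak h)\times\mathring{\mathfrak P}(\mathfrak h)$ is the linear span of the following pairs, and $\mathring\Gamma(\mathfrak h)$ is the linear map assigning to each element of $\mathring T(\mathfrak h)$ a pair of vectors in $\mathbb C^2$ (its values at $s_-$ and $s_+$), determined by the indicated values: (a) $((f,\xi,0);(g,\eta,0))$ with $(f;g)\in T_{\max}(H)$ such that $f$ has a locally absolutely continuous representative $\hat f$ with $\hat f'=JHg$ and $\hat f(s_-)_1=\hat f(s_+)_1=0$, and $\eta_0=0$, $\eta_k=\xi_{k-1}$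 ($1\le k\le\Delta-1$), $\xi_{\Delta-1}=\int_{s_-}^{s_+}\mathfrak w_\Delta^*Hg$; values $\hat f(s_-)$, $\hat f(s_+)$; (b) $(e_+;\delta_0)$ with values $0$ at $s_-$, $\binom10$ at $s_+$; and $(e_-;-\delta_0)$ with values $\binom10$ at $s_-$, $0$ at $s_+$; (c) $(p_0;0)$, with values $\binom01$ at $s_-$ and $s_+$; $(p_k;p_{k-1}+d_{k-1}\delta_0)$ for $1\le k\le\Delta-1$, with values $\binom0{\omega_k^-}$ at $s_-$, $\binom0{\omega_k^+}$ at $s_+$; $(q;p_{\Delta-1}+d_{\Delta-1}\delta_0)$, with values $\binom0{\omega_\Delta^-}$ at $s_-$, $\binom0{\omega_\Delta^+}$ at $s_+$; (d) $(\delta_{k-1};\delta_k)$ for $\Delta\le k\le\Delta+\ddot o-1$, with values $0$ at $s_-$ and $s_+$. *)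

theory Defs
  imports
    "HOL-Analysis.Analysis"
    "HOL-Library.Extended_Nat"
    "HOL-Library.Function_Algebras"
begin

section \<open>Hamiltonians\<close>

definition J :: "real^2^2" where
  "J = vector [vector [0, -1], vector [1, 0]]"

definition complex_matrix :: "real^2^2 \<Rightarrow> complex^2^2" where
  "complex_matrix M = (\<chi> i j. complex_of_real (M $ i $ j))"

definition xi_dir :: "real \<Rightarrow> real^2" where
  "xi_dir \<phi> = vector [cos \<phi>, sin \<phi>]"

definition positive_semidefinite :: "real^2^2 \<Rightarrow> bool" where
  "positive_semidefinite M \<longleftrightarrow> transpose M = M \<and> (\<forall>x. 0 \<le> x \<bullet> (M *v x))"

text \<open>
  Functions on an interval are total functions on the reals of which only the values on the
  interval matter: every notion below depends on \<open>H\<close> only through its values on the open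
  interval in question.
\<close>

definition hamiltonian :: "real \<Rightarrow> real \<Rightarrow> (real \<Rightarrow> real^2^2) \<Rightarrow> bool" where
  "hamiltonian a b H \<longleftrightarrow>
     H \<in> borel_measurable (lebesgue_on {a<..<b}) \<and>
     (\<forall>c d. a < c \<and> c \<le> d \<and> d < b \<longrightarrow> integrable (lebesgue_on {c..d}) H) \<and>
     (AE t in lebesgue_on {a<..<b}. positive_semidefinite (H t)) \<and>
     (AE t in lebesgue_on {a<..<b}. H t \<noteq> 0)"

definition limit_circle_left :: "real \<Rightarrow> real \<Rightarrow> (real \<Rightarrow> real^2^2) \<Rightarrow> bool" where
  "limit_circle_left a b H \<longleftrightarrow> (\<exists>c. a < c \<and> c < b \<and> integrable (lebesgue_on {a<..<c}) H)"

definition limit_circle_right :: "real \<Rightarrow> real \<Rightarrow> (real \<Rightarrow> real^2^2) \<Rightarrow> bool" where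
  "limit_circle_right a b H \<longleftrightarrow> (\<exists>c. a < c \<and> c < b \<and> integrable (lebesgue_on {c<..<b}) H)"

definition indivisible_of_type :: "(real \<Rightarrow> real^2^2) \<Rightarrow> real \<Rightarrow> real \<Rightarrow> real \<Rightarrow> bool" where
  "indivisible_of_type H \<phi> c d \<longleftrightarrow>
     c < d \<and> (AE t in lebesgue_on {c<..<d}. range (\<lambda>x. H t *v x) = span {xi_dir \<phi>})"

definition indivisible :: "(real \<Rightarrow> real^2^2) \<Rightarrow> real \<Rightarrow> real \<Rightarrow> bool" where
  "indivisible H c d \<longleftrightarrow> (\<exists>\<phi>. indivisible_of_type H \<phi> c d)"


section \<open>The space $L^2(H)$ and the maximal relation on one interval\<close>

definition ham_app :: "(real \<Rightarrow> real^2^2) \<Rightarrow> (real \<Rightarrow> complex^2) \<Rightarrow> real \<Rightarrow> complex^2" where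
  "ham_app H f t = complex_matrix (H t) *v f t"

definition J_ham_app :: "(real \<Rightarrow> real^2^2) \<Rightarrow> (real \<Rightarrow> complex^2) \<Rightarrow> real \<Rightarrow> complex^2" where
  "J_ham_app H f t = complex_matrix J *v ham_app H f t"

text \<open>The integrand $f^*Hg$.\<close>

definition ham_form ::
  "(real \<Rightarrow> real^2^2) \<Rightarrow> (real \<Rightarrow> complex^2) \<Rightarrow> (real \<Rightarrow> complex^2) \<Rightarrow> real \<Rightarrow> complex" where
  "ham_form H f g t = (\<Sum>i\<in>UNIV. cnj (f t $ i) * ham_app H g t $ i)"

definition ham_eq ::
  "real \<Rightarrow> real \<Rightarrow> (real \<Rightarrow> real^2^2) \<Rightarrow> (real \<Rightarrow> complex^2) \<Rightarrow> (real \<Rightarrow> complex^2) \<Rightarrow> bool" where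
  "ham_eq a b H f g \<longleftrightarrow> (AE t in lebesgue_on {a<..<b}. ham_app H f t = ham_app H g t)"

text \<open>
  Elements of $L^2(H)$ are classes modulo \<open>ham_eq\<close>. We work with representatives:
  the sets \<open>L2\<close> and \<open>Tmax\<close> consist of all (measurable) representatives of the
  elements of $L^2(H)$ and $T_{\max}(H)$.
\<close>

definition L2 :: "real \<Rightarrow> real \<Rightarrow> (real \<Rightarrow> real^2^2) \<Rightarrow> (real \<Rightarrow> complex^2) set" where
  "L2 a b H = {f.
     f \<in> borel_measurable (lebesgue_on {a<..<b}) \<and>
     integrable (lebesgue_on {a<..<b}) (ham_form H f f) \<and>
     (\<forall>c d \<phi>. a \<le> c \<and> d \<le> b \<and> indivisible_of_type H \<phi> c d \<longrightarrow>
        (\<exists>z. AE t in lebesgue_on {c<..<d}.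
           (\<Sum>i\<in>UNIV. complex_of_real (xi_dir \<phi> $ i) * f t $ i) = z))}"

definition absolutely_continuous_on :: "real \<Rightarrow> real \<Rightarrow> (real \<Rightarrow> complex^2) \<Rightarrow> bool" where
  "absolutely_continuous_on c d f \<longleftrightarrow>
     (\<forall>\<epsilon>>0. \<exists>\<delta>>0. \<forall>\<D> T. \<D> division_of T \<and> T \<subseteq> {c..d} \<and> (\<Sum>K\<in>\<D>. Sup K - Inf K) < \<delta> \<longrightarrow>
        (\<Sum>K\<in>\<D>. norm (f (Sup K) - f (Inf K))) < \<epsilon>)"

definition locally_absolutely_continuous :: "real \<Rightarrow> real \<Rightarrow> (real \<Rightarrow> complex^2) \<Rightarrow> bool" where
  "locally_absolutely_continuous a b f \<longleftrightarrow>
     (\<forall>c d. a < c \<and> c \<le> d \<and> d < b \<longrightarrow> absolutely_continuous_on c d f)"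

text \<open>
  \<open>fh\<close> is a locally absolutely continuous representative of \<open>f\<close> with
  \<open>fh' = J H g\<close> a.e.
\<close>

definition ac_rep ::
  "real \<Rightarrow> real \<Rightarrow> (real \<Rightarrow> real^2^2) \<Rightarrow> (real \<Rightarrow> complex^2) \<Rightarrow> (real \<Rightarrow> complex^2) \<Rightarrow>
   (real \<Rightarrow> complex^2) \<Rightarrow> bool" where
  "ac_rep a b H f g fh \<longleftrightarrow>
     locally_absolutely_continuous a b fh \<and>
     ham_eq a b H fh f \<and>
     (AE t in lebesgue_on {a<..<b}. (fh has_vector_derivative J_ham_app H g t) (at t))"

definition Tmax ::
  "real \<Rightarrow> real \<Rightarrow> (real \<Rightarrow> real^2^2) \<Rightarrow> ((real \<Rightarrow> complex^2) \<times> (real \<Rightarrow> complex^2)) set" where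
  "Tmax a b H = {(f, g). f \<in> L2 a b H \<and> g \<in> L2 a b H \<and> (\<exists>fh. ac_rep a b H f g fh)}"


section \<open>The conditions (I), (HS), the order $\Delta$ and the functions $w_n$\<close>

definition cond_I :: "real \<Rightarrow> real \<Rightarrow> (real \<Rightarrow> real^2^2) \<Rightarrow> bool" where
  "cond_I a b H \<longleftrightarrow> integrable (lebesgue_on {a<..<b}) (\<lambda>t. H t $ 1 $ 1)"

definition cond_HS_left :: "real \<Rightarrow> real \<Rightarrow> (real \<Rightarrow> real^2^2) \<Rightarrow> bool" where
  "cond_HS_left a b H \<longleftrightarrow>
     integrable (lebesgue_on {a<..<b})
       (\<lambda>t. integral\<^sup>L (lebesgue_on {a<..<t}) (\<lambda>s. H s $ 2 $ 2) * H t $ 1 $ 1)"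

definition cond_HS_right :: "real \<Rightarrow> real \<Rightarrow> (real \<Rightarrow> real^2^2) \<Rightarrow> bool" where
  "cond_HS_right a b H \<longleftrightarrow>
     integrable (lebesgue_on {a<..<b})
       (\<lambda>t. integral\<^sup>L (lebesgue_on {t<..<b}) (\<lambda>s. H s $ 2 $ 2) * H t $ 1 $ 1)"

definition int_op_left ::
  "real \<Rightarrow> (real \<Rightarrow> real^2^2) \<Rightarrow> (real \<Rightarrow> complex^2) \<Rightarrow> real \<Rightarrow> complex^2" where
  "int_op_left a H f t = integral\<^sup>L (lebesgue_on {a<..<t}) (J_ham_app H f)"

definition int_op_right ::
  "real \<Rightarrow> (real \<Rightarrow> real^2^2) \<Rightarrow> (real \<Rightarrow> complex^2) \<Rightarrow> real \<Rightarrow> complex^2" where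
  "int_op_right b H f t = - integral\<^sup>L (lebesgue_on {t<..<b}) (J_ham_app H f)"

text \<open>
  The next three notions are the same for the left and for the right interval, up to the choice
  of the integral operator \<open>I\<close> and of the space \<open>L\<close>.
\<close>

definition ham_order ::
  "((real \<Rightarrow> complex^2) \<Rightarrow> real \<Rightarrow> complex^2) \<Rightarrow> (real \<Rightarrow> complex^2) set \<Rightarrow> enat" where
  "ham_order I L = Inf {enat n | n. \<exists>v :: nat \<Rightarrow> complex^2.
     (\<lambda>t. (I ^^ n) (\<lambda>_. vector [0, 1]) t + (\<Sum>k<n. (I ^^ k) (\<lambda>_. v (n - k)) t)) \<in> L}"

definition w_gen ::
  "((real \<Rightarrow> complex^2) \<Rightarrow> real \<Rightarrow> complex^2) \<Rightarrow> (nat \<Rightarrow> complex) \<Rightarrow> nat \<Rightarrow> real \<Rightarrow> complex^2" where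
  "w_gen I \<omega> n t = (\<Sum>k\<le>n. (I ^^ k) (\<lambda>_. vector [0, \<omega> (n - k)]) t)"

definition omega_seq ::
  "((real \<Rightarrow> complex^2) \<Rightarrow> real \<Rightarrow> complex^2) \<Rightarrow> (real \<Rightarrow> complex^2) set \<Rightarrow> nat \<Rightarrow> complex" where
  "omega_seq I L = (THE \<omega>. \<omega> 0 = 1 \<and> (\<forall>n. ham_order I L \<le> enat n \<longrightarrow> w_gen I \<omega> n \<in> L))"


section \<open>Elementary indefinite Hamiltonians of kind (A)\<close>

text \<open>
  The Hamiltonians $H_-$ and $H_+$ are the restrictions of \<open>Ham\<close> to the intervals
  $(s_-,\sigma)$ and $(\sigma,s_+)$; \<open>o2\<close> is the number denoted by an o with two dots.
  Only the values \<open>bpar j\<close> with \<open>1 \<le> j \<le> o2\<close> and \<open>dpar j\<close> with \<open>j < 2 * Delta\<close>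
  (see below) are relevant.
\<close>

record indef_ham =
  sm :: real
  sig :: real
  sp :: real
  Ham :: "real \<Rightarrow> real^2^2"
  o2 :: nat
  bpar :: "nat \<Rightarrow> real"
  dpar :: "nat \<Rightarrow> real"

definition order_minus :: "indef_ham \<Rightarrow> enat" where
  "order_minus h = ham_order (int_op_left (sm h) (Ham h)) (L2 (sm h) (sig h) (Ham h))"

definition order_plus :: "indef_ham \<Rightarrow> enat" where
  "order_plus h = ham_order (int_op_right (sp h) (Ham h)) (L2 (sig h) (sp h) (Ham h))"

definition Delta :: "indef_ham \<Rightarrow> nat" where
  "Delta h = the_enat (max (order_minus h) (order_plus h))"

definition kind_A :: "indef_ham \<Rightarrow> bool" where
  "kind_A h \<longleftrightarrow>
     sm h < sig h \<and> sig h < sp h \<and>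
     hamiltonian (sm h) (sig h) (Ham h) \<and>
     limit_circle_left (sm h) (sig h) (Ham h) \<and>
     \<not> limit_circle_right (sm h) (sig h) (Ham h) \<and>
     hamiltonian (sig h) (sp h) (Ham h) \<and>
     \<not> limit_circle_left (sig h) (sp h) (Ham h) \<and>
     limit_circle_right (sig h) (sp h) (Ham h) \<and>
     cond_I (sm h) (sig h) (Ham h) \<and> cond_HS_left (sm h) (sig h) (Ham h) \<and>
     cond_I (sig h) (sp h) (Ham h) \<and> cond_HS_right (sig h) (sp h) (Ham h) \<and>
     order_minus h < \<infinity> \<and> order_plus h < \<infinity> \<and>
     ((\<forall>s\<in>{sm h..<sig h}. \<not> indivisible (Ham h) s (sig h)) \<or>
      (\<forall>s\<in>{sig h<..<sp h}. \<not> indivisible (Ham h) (sig h) s)) \<and>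
     (o2 h > 0 \<longrightarrow> bpar h 1 \<noteq> 0)"

abbreviation left_indivisible :: "indef_ham \<Rightarrow> bool" where
  "left_indivisible h \<equiv> indivisible (Ham h) (sm h) (sig h)"

abbreviation right_indivisible :: "indef_ham \<Rightarrow> bool" where
  "right_indivisible h \<equiv> indivisible (Ham h) (sig h) (sp h)"

definition omega_minus :: "indef_ham \<Rightarrow> nat \<Rightarrow> complex" where
  "omega_minus h = omega_seq (int_op_left (sm h) (Ham h)) (L2 (sm h) (sig h) (Ham h))"

definition omega_plus :: "indef_ham \<Rightarrow> nat \<Rightarrow> complex" where
  "omega_plus h = omega_seq (int_op_right (sp h) (Ham h)) (L2 (sig h) (sp h) (Ham h))"

definition w :: "indef_ham \<Rightarrow> nat \<Rightarrow> real \<Rightarrow> complex^2" where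
  "w h n t = (if t < sig h then w_gen (int_op_left (sm h) (Ham h)) (omega_minus h) n t
              else w_gen (int_op_right (sp h) (Ham h)) (omega_plus h) n t)"

text \<open>
  The orthogonal sums over the two intervals: a function on $(s_-,\sigma)\cup(\sigma,s_+)$ is
  identified with the pair of its restrictions.
\<close>

definition L2_ham :: "indef_ham \<Rightarrow> (real \<Rightarrow> complex^2) set" where
  "L2_ham h = L2 (sm h) (sig h) (Ham h) \<inter> L2 (sig h) (sp h) (Ham h)"

definition Tmax_ham :: "indef_ham \<Rightarrow> ((real \<Rightarrow> complex^2) \<times> (real \<Rightarrow> complex^2)) set" where
  "Tmax_ham h = Tmax (sm h) (sig h) (Ham h) \<inter> Tmax (sig h) (sp h) (Ham h)"

definition ham_equal :: "indef_ham \<Rightarrow> (real \<Rightarrow> complex^2) \<Rightarrow> (real \<Rightarrow> complex^2) \<Rightarrow> bool" where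
  "ham_equal h f g \<longleftrightarrow>
     ham_eq (sm h) (sig h) (Ham h) f g \<and> ham_eq (sig h) (sp h) (Ham h) f g"

definition w_Delta_integral :: "indef_ham \<Rightarrow> (real \<Rightarrow> complex^2) \<Rightarrow> complex" where
  "w_Delta_integral h g =
     integral\<^sup>L (lebesgue_on ({sm h<..<sig h} \<union> {sig h<..<sp h})) (ham_form (Ham h) (w h (Delta h)) g)"

text \<open>
  The values $f(s_-)$ and $f(s_+)$ depend on \<open>g\<close>, too. The representative is
  unique, and the value well-defined, when the corresponding interval is not indivisible.
\<close>

definition value_minus :: "indef_ham \<Rightarrow> (real \<Rightarrow> complex^2) \<Rightarrow> (real \<Rightarrow> complex^2) \<Rightarrow> complex^2" where
  "value_minus h f g =
     (THE v. \<exists>fh. ac_rep (sm h) (sig h) (Ham h) f g fh \<and> (fh \<longlongrightarrow> v) (at_right (sm h)))"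

definition value_plus :: "indef_ham \<Rightarrow> (real \<Rightarrow> complex^2) \<Rightarrow> (real \<Rightarrow> complex^2) \<Rightarrow> complex^2" where
  "value_plus h f g =
     (THE v. \<exists>fh. ac_rep (sig h) (sp h) (Ham h) f g fh \<and> (fh \<longlongrightarrow> v) (at_left (sp h)))"


section \<open>The model space\<close>

text \<open>
  Vectors in $C^\Delta$ and $C^{o2}$ are functions on \<open>nat\<close> vanishing off the
  index sets \<open>{..<Delta h}\<close> and \<open>{1..o2 h}\<close>.
\<close>

type_synonym model_vec = "(real \<Rightarrow> complex^2) \<times> (nat \<Rightarrow> complex) \<times> (nat \<Rightarrow> complex)"

type_synonym boundary_val = "(complex^2) \<times> (complex^2)"

definition coord_vecs :: "nat set \<Rightarrow> (nat \<Rightarrow> complex) set" where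
  "coord_vecs K = {x. \<forall>i. i \<notin> K \<longrightarrow> x i = 0}"

definition L2_Delta :: "indef_ham \<Rightarrow> (real \<Rightarrow> complex^2) set" where
  "L2_Delta h = {f. \<exists>f0\<in>L2_ham h. \<exists>c. f = (\<lambda>t. f0 t + (\<Sum>i<Delta h. c i *s w h i t))}"

definition model_space :: "indef_ham \<Rightarrow> model_vec set" where
  "model_space h = L2_Delta h \<times> coord_vecs {..<Delta h} \<times> coord_vecs {1..o2 h}"

text \<open>Two triples representing the same element of the model space.\<close>

definition model_eq :: "indef_ham \<Rightarrow> model_vec \<Rightarrow> model_vec \<Rightarrow> bool" where
  "model_eq h F G \<longleftrightarrow> ham_equal h (fst F) (fst G) \<and> snd F = snd G"

definition scale_model :: "complex \<Rightarrow> model_vec \<Rightarrow> model_vec" where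
  "scale_model c = (\<lambda>(f, \<xi>, \<alpha>). (\<lambda>t. c *s f t, \<lambda>i. c * \<xi> i, \<lambda>k. c * \<alpha> k))"

definition scale_pair :: "complex \<Rightarrow> model_vec \<times> model_vec \<Rightarrow> model_vec \<times> model_vec" where
  "scale_pair c = (\<lambda>(F, G). (scale_model c F, scale_model c G))"

definition scale_graph ::
  "complex \<Rightarrow> (model_vec \<times> model_vec) \<times> boundary_val \<Rightarrow> (model_vec \<times> model_vec) \<times> boundary_val" where
  "scale_graph c = (\<lambda>(FG, (u, v)). (scale_pair c FG, (c *s u, c *s v)))"

lemma vector_space_scale_model: "vector_space scale_model"
  by standard
    (simp_all add: scale_model_def case_prod_beta prod_eq_iff fun_eq_iff algebra_simps vec_eq_iff)

lemma vector_space_scale_pair: "vector_space scale_pair"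
proof -
  interpret vector_space scale_model by (rule vector_space_scale_model)
  show ?thesis
    by standard
      (simp_all add: scale_pair_def case_prod_beta prod_eq_iff
        scale_right_distrib scale_left_distrib del: split_paired_All)
qed

lemma vector_space_scale_graph: "vector_space scale_graph"
proof -
  interpret vector_space scale_pair by (rule vector_space_scale_pair)
  have *: "scale_graph c x = (scale_pair c (fst x), (c *s fst (snd x), c *s snd (snd x)))" for c x
    by (simp add: scale_graph_def case_prod_beta)
  show ?thesis
    by (standard; rule prod_eqI)
      (simp_all only: * fst_add snd_add fst_conv snd_conv scale_right_distrib scale_left_distrib
        scale_scale scale_one, simp_all add: prod_eq_iff algebra_simps vec_eq_iff)
qed


section \<open>The model relation and the boundary mapping\<close>

definition p_vec :: "indef_ham \<Rightarrow> nat \<Rightarrow> model_vec" where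
  "p_vec h k =
     (w h k, \<lambda>i. if i < Delta h then complex_of_real (dpar h (k + i)) / 2 else 0, 0)"

definition q_vec :: "indef_ham \<Rightarrow> model_vec" where
  "q_vec h =
     (w h (Delta h),
      \<lambda>i. if i < Delta h then complex_of_real (dpar h (Delta h + i)) else 0,
      \<lambda>k. if 1 \<le> k \<and> k \<le> o2 h then complex_of_real (bpar h (o2 h + 1 - k)) else 0)"

definition delta_vec :: "indef_ham \<Rightarrow> nat \<Rightarrow> model_vec" where
  "delta_vec h j =
     (if j < Delta h then (0, \<lambda>i. if i = j then - 1 else 0, 0)
      else (0, 0, \<lambda>k. if Delta h + k = j + 1 then 1 else 0))"

definition e_plus :: "indef_ham \<Rightarrow> model_vec" where
  "e_plus h =
     (\<lambda>t. if sig h < t \<and> t < sp h then vector [1, 0] else 0,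
      \<lambda>i. if i < Delta h then omega_plus h (i + 1) else 0, 0)"

definition e_minus :: "indef_ham \<Rightarrow> model_vec" where
  "e_minus h =
     (\<lambda>t. if sm h < t \<and> t < sig h then vector [1, 0] else 0,
      \<lambda>i. if i < Delta h then - omega_minus h (i + 1) else 0, 0)"

text \<open>
  The pairs \<open>(F, G)\<close> spanning the model relation, together with their boundary values at
  $s_-$ and $s_+$.
\<close>

inductive_set generators :: "indef_ham \<Rightarrow> ((model_vec \<times> model_vec) \<times> boundary_val) set"
  for h :: indef_ham where
  gen_a:
    "\<lbrakk> (f, g) \<in> Tmax_ham h;
       ac_rep (sm h) (sig h) (Ham h) f g fh; ac_rep (sig h) (sp h) (Ham h) f g fh;
       (fh \<longlongrightarrow> vm) (at_right (sm h)); (fh \<longlongrightarrow> vp) (at_left (sp h));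
       vm $ 1 = 0; vp $ 1 = 0;
       \<xi> \<in> coord_vecs {..<Delta h}; \<eta> \<in> coord_vecs {..<Delta h};
       \<eta> 0 = 0; \<forall>k. 1 \<le> k \<and> k < Delta h \<longrightarrow> \<eta> k = \<xi> (k - 1);
       \<xi> (Delta h - 1) = w_Delta_integral h g \<rbrakk>
     \<Longrightarrow> (((f, \<xi>, 0), (g, \<eta>, 0)), (vm, vp)) \<in> generators h"
| gen_b_plus:
    "((e_plus h, delta_vec h 0), (0, vector [1, 0])) \<in> generators h"
| gen_b_minus:
    "((e_minus h, scale_model (- 1) (delta_vec h 0)), (vector [1, 0], 0)) \<in> generators h"
| gen_c_0:
    "((p_vec h 0, 0), (vector [0, 1], vector [0, 1])) \<in> generators h"
| gen_c:
    "1 \<le> k \<Longrightarrow> k < Delta h \<Longrightarrow>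
     ((p_vec h k, p_vec h (k - 1) + scale_model (of_real (dpar h (k - 1))) (delta_vec h 0)),
      (vector [0, omega_minus h k], vector [0, omega_plus h k])) \<in> generators h"
| gen_c_Delta:
    "((q_vec h, p_vec h (Delta h - 1)
         + scale_model (of_real (dpar h (Delta h - 1))) (delta_vec h 0)),
      (vector [0, omega_minus h (Delta h)], vector [0, omega_plus h (Delta h)])) \<in> generators h"
| gen_d:
    "Delta h \<le> k \<Longrightarrow> k < Delta h + o2 h \<Longrightarrow>
     ((delta_vec h (k - 1), delta_vec h k), (0, 0)) \<in> generators h"

text \<open>
  A pair of triples belongs to \<open>T_ring h\<close> if it represents, modulo \<open>model_eq\<close>, an
  element of the linear span; \<open>Gamma_graph\<close> is the graph of the boundary mapping on the
  level of representatives.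
\<close>

definition T_ring :: "indef_ham \<Rightarrow> (model_vec \<times> model_vec) set" where
  "T_ring h = {(F, G). F \<in> model_space h \<and> G \<in> model_space h \<and>
     (\<exists>F' G'. (F', G') \<in> module.span scale_pair (fst ` generators h) \<and>
        model_eq h F F' \<and> model_eq h G G')}"

definition Gamma_graph :: "indef_ham \<Rightarrow> ((model_vec \<times> model_vec) \<times> boundary_val) set" where
  "Gamma_graph h = {((F, G), v). F \<in> model_space h \<and> G \<in> model_space h \<and>
     (\<exists>F' G'. ((F', G'), v) \<in> module.span scale_graph (generators h) \<and>
        model_eq h F F' \<and> model_eq h G G')}"

definition Gamma_ring :: "indef_ham \<Rightarrow> model_vec \<times> model_vec \<Rightarrow> boundary_val" where
  "Gamma_ring h FG = (THE v. (FG, v) \<in> Gamma_graph h)"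


section \<open>The quantities occurring in the characterisation\<close>

definition B_term ::
  "indef_ham \<Rightarrow> (real \<Rightarrow> complex^2) \<Rightarrow> (real \<Rightarrow> complex^2) \<Rightarrow> nat \<Rightarrow> complex" where
  "B_term h f g k =
     (if right_indivisible h then omega_minus h k * value_minus h f g $ 1
      else if left_indivisible h then - (omega_plus h k * value_plus h f g $ 1)
      else omega_minus h k * value_minus h f g $ 1 - omega_plus h k * value_plus h f g $ 1)"

definition g_reduced ::
  "indef_ham \<Rightarrow> (real \<Rightarrow> complex^2) \<Rightarrow> (nat \<Rightarrow> complex) \<Rightarrow> real \<Rightarrow> complex^2" where
  "g_reduced h g c t = g t - (\<Sum>i<Delta h. c (i + 1) *s w h i t)"

text \<open>
  The equality of \<open>f\<close> with \<open>f0 + \<Sum>i\<le>Delta h. c i *s w h i\<close> is an equality of classes. The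
  coefficients are determined by it, since the functions \<open>w h i\<close> with \<open>i \<le> Delta h\<close>
  are linearly independent modulo the domain of \<open>Tmax_ham h\<close>.
\<close>

definition decomposition ::
  "indef_ham \<Rightarrow> (real \<Rightarrow> complex^2) \<Rightarrow> (real \<Rightarrow> complex^2) \<Rightarrow> (real \<Rightarrow> complex^2) \<Rightarrow>
   (nat \<Rightarrow> complex) \<Rightarrow> bool" where
  "decomposition h f g f0 c \<longleftrightarrow>
     ham_equal h f (\<lambda>t. f0 t + (\<Sum>i\<le>Delta h. c i *s w h i t)) \<and>
     f0 \<in> Domain (Tmax_ham h) \<and>
     (f0, g_reduced h g c) \<in> Tmax_ham h"

end

theory Submission
  imports Defs
begin

text \<open>
  The model relation is spanned by the pairs \<open>gen_a\<close>, which already form a linear space, and by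
  finitely many further pairs. So, up to equality of classes, an element of it is one pair
  \<open>gen_a\<close> plus a combination of the others, with coefficients \<open>am\<close>, \<open>ap\<close> (of the two pairs built
  from the indicator functions), \<open>c k\<close> (of the pairs whose first function is \<open>w h k\<close>) and \<open>\<tau> k\<close> (of
  the pairs \<open>gen_d\<close>); this is \<open>span_generators\<close>. Comparing functions gives
  $f = f_0 + \sum_{k\le\Delta} c_k w_k$ and $g = g_a + \sum_{k<\Delta} c_{k+1} w_k$, where $f_0$ has
  the derivative $JHg_a$, and \<open>am\<close>, \<open>ap\<close> are the first components of the boundary values of $f$.
  Comparing the coordinates gives linear equations in which the coordinates of the pair \<open>gen_a\<close>
  and the \<open>\<tau> k\<close> are auxiliary; eliminating them (\<open>coordinates_iff\<close>) leaves exactly the relations of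
  the theorem. Conversely these relations allow one to solve for the auxiliary unknowns.

  Three facts about a single half-interval make this comparison meaningful.

  First, a locally absolutely continuous representative of $f$ with derivative $JHg$ is the same
  thing as a function $v + \mathcal I g$ with a constant $v$, which is then its boundary value
  (\<open>ac_rep_iff\<close>). This rests on Lebesgue's differentiation theorem and on the fundamental theorem
  of calculus for absolutely continuous functions. If the half-interval is not indivisible, no
  nonzero constant is annihilated by $H$, and therefore $v$ is unique (\<open>value_eq\<close>).

  Secondly, the condition that $h_1$ be integrable and the condition (HS) imply that for every
  $f\in L^2(H)$ some function $\mathcal If + (0,c)^T$ belongs to $L^2(H)$ again (\<open>regularize\<close>). As
  $(0,1)^T$ is not in $L^2(H)$, the constant is unique. This produces the sequence $\omega$
  (\<open>omega_exists\<close>, \<open>omega_unique\<close>), and it puts $w_\Delta$ into $L^2(H)$, so that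
  $g \mapsto \int w_\Delta^*Hg$ is linear on $L^2(H)$.

  Thirdly, by minimality of the order no nontrivial combination of $w_0,\dots,w_{\Delta-1}$ is in
  $L^2(H)$ (\<open>independent_w\<close>). Hence the coefficients $c_k$ are determined by $f$ and $g$
  (\<open>decomposition_unique\<close>), which makes the boundary mapping single-valued.

  On an indivisible half-interval $H$ has only the entry $h_2$. Then the constant $(1,0)^T$ is zero
  in $L^2(H)$ and $\omega_n = 0$ for $n\ge1$, so that \<open>am\<close> or \<open>ap\<close> cannot be read off from $f$. It
  is determined by $\eta_0$ instead, and this is the origin of the case distinctions.

  Left and right half-intervals are handled at once by the locale \<open>half_ham\<close>.
\<close>

section \<open>Absolutely continuous functions and indefinite integrals\<close>

text \<open>
  Around a point where the derivative fails by a factor $e$ there are arbitrarily short intervals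
  $[x,y]$ on which the increment of $F$ differs from $(y-x)f(x)$ by more than $e\,|y-x|$. By Vitali's
  covering lemma disjoint ones among them, enlarged five times, cover the exceptional set, while
  Henstock's lemma bounds the total error over disjoint intervals, hence their total length.
\<close>

lemma lebesgue_differentiation:
  fixes F f :: "real \<Rightarrow> 'a::euclidean_space"
  assumes F: "\<And>s t. c \<le> s \<Longrightarrow> s \<le> t \<Longrightarrow> t \<le> d \<Longrightarrow> (f has_integral F t - F s) {s..t}"
  shows "negligible {x\<in>{c<..<d}. \<not> (F has_vector_derivative f x) (at x)}"
proof (cases "c < d")
  case False
  then show ?thesis by simp
next
  case cd: True
  define E where "E e = {x\<in>{c<..<d}. \<forall>\<delta>>0. \<exists>y\<in>{c<..<d}. y \<noteq> x \<and> \<bar>y - x\<bar> < \<delta> \<and>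
      norm (F y - F x - (y - x) *\<^sub>R f x) > e * \<bar>y - x\<bar>}" for e
  have "negligible (E e)" if e: "e > 0" for e
    unfolding negligible_outer_le
  proof (intro allI impI)
    fix \<eta> :: real assume \<eta>: "\<eta> > 0"
    have "f integrable_on cbox c d"
      using F[of c d] cd by auto
    then obtain \<gamma> where \<gamma>: "gauge \<gamma>"
      and hen: "\<And>p. \<lbrakk>p tagged_partial_division_of (cbox c d); \<gamma> fine p\<rbrakk> \<Longrightarrow>
             sum (\<lambda>(x,k). norm (measure lborel k *\<^sub>R f x - integral k f)) p < e * \<eta> / 5"
    proof (rule Henstock_lemma[of f c d "e * \<eta> / 5"])
      show "0 < e * \<eta> / 5" using e \<eta> by simp
    qed (rule that)
    \<comment> \<open>The intervals with endpoints \<open>x\<close> and \<open>y\<close> that witness the failure at \<open>x\<close> and are allowed by the gauge.\<close>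
    define K where "K = {(x, y). x \<in> E e \<and> y \<in> {c<..<d} \<and> y \<noteq> x \<and> {min x y..max x y} \<subseteq> \<gamma> x \<and>
      norm (F y - F x - (y - x) *\<^sub>R f x) > e * \<bar>y - x\<bar>}"
    define m where "m i = (fst i + snd i) / 2" for i :: "real \<times> real"
    define r where "r i = \<bar>snd i - fst i\<bar> / 2" for i :: "real \<times> real"
    have cb: "cball (m i) (r i) = {min (fst i) (snd i)..max (fst i) (snd i)}" for i
      by (auto simp: m_def r_def cball_eq_atLeastAtMost min_def max_def abs_if field_simps)
    have cov: "\<exists>y. (x, y) \<in> K" if x: "x \<in> E e" for x
    proof -
      obtain \<delta> where \<delta>: "\<delta> > 0" "ball x \<delta> \<subseteq> \<gamma> x"
        using \<gamma> unfolding gauge_def by (metis openE)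
      then obtain y where y: "y\<in>{c<..<d}" "y \<noteq> x" "\<bar>y - x\<bar> < \<delta>"
          "norm (F y - F x - (y - x) *\<^sub>R f x) > e * \<bar>y - x\<bar>"
        using x unfolding E_def by blast
      have "{min x y..max x y} \<subseteq> ball x \<delta>"
        using y \<delta> by (auto simp: dist_real_def)
      then show ?thesis using x y \<delta> unfolding K_def by blast
    qed
    obtain C where C: "countable C" "C \<subseteq> K"
        "pairwise (\<lambda>i j. disjnt (cball (m i) (r i)) (cball (m j) (r j))) C"
        "E e \<subseteq> (\<Union>i\<in>C. cball (m i) (5 * r i))"
    proof (rule Vitali_covering_lemma_cballs[where S="E e" and K=K and a=m and r=r and B="d - c"])
      show "E e \<subseteq> (\<Union>i\<in>K. cball (m i) (r i))"
      proof
        fix x assume "x \<in> E e"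
        from cov[OF this] obtain y where "(x, y) \<in> K" ..
        moreover have "x \<in> cball (m (x,y)) (r (x,y))" unfolding cb by auto
        ultimately show "x \<in> (\<Union>i\<in>K. cball (m i) (r i))" by blast
      qed
      show "\<And>i. i \<in> K \<Longrightarrow> 0 < r i \<and> r i \<le> d - c"
        by (auto simp: K_def r_def E_def abs_if field_simps)
    qed auto
    have fin: "(\<Sum>i\<in>C'. 10 * r i) \<le> \<eta>" if C': "C' \<subseteq> C" "finite C'" for C'
    proof -
      define p where "p = (\<lambda>i. (fst i, cball (m i) (r i))) ` C'"
      have pw: "disjnt (cball (m i) (r i)) (cball (m j) (r j))" if "i \<in> C'" "j \<in> C'" "i \<noteq> j" for i j
        using C(3) C' that unfolding pairwise_def by blast
      have nonempty: "fst i \<in> cball (m i) (r i)" for i unfolding cb by auto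
      have inj: "inj_on (\<lambda>i. (fst i, cball (m i) (r i))) C'"
      proof (rule inj_onI)
        fix i j assume "i \<in> C'" "j \<in> C'" "(fst i, cball (m i) (r i)) = (fst j, cball (m j) (r j))"
        then have "cball (m i) (r i) \<inter> cball (m j) (r j) \<noteq> {}" using nonempty[of i] by (metis disjoint_iff prod.inject)
        then show "i = j" using pw[of i j] \<open>i \<in> C'\<close> \<open>j \<in> C'\<close> unfolding disjnt_def by blast
      qed
      have C'K: "i \<in> K" if "i \<in> C'" for i using C' C that by auto
      have "p tagged_partial_division_of (cbox c d)"
        unfolding tagged_partial_division_of_def
      proof (intro conjI allI impI)
        show "finite p" using C' by (simp add: p_def)
      next
        fix x k assume xk: "(x, k) \<in> p"
        then obtain i where i: "i \<in> C'" "x = fst i" "k = cball (m i) (r i)" by (auto simp: p_def)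
        show "x \<in> k" using nonempty i by auto
        show "k \<subseteq> cbox c d" using C'K[OF i(1)] unfolding i cb by (auto simp: K_def E_def)
        show "\<exists>u v. k = cbox u v" unfolding i cb box_real[symmetric] by blast
      next
        fix x k x' k' assume "(x, k) \<in> p \<and> (x', k') \<in> p \<and> (x, k) \<noteq> (x', k')"
        then have xk: "(x, k) \<in> p" and x'k: "(x', k') \<in> p" "(x, k) \<noteq> (x', k')" by auto
        from xk obtain i where i: "i \<in> C'" "x = fst i" "k = cball (m i) (r i)" by (auto simp: p_def)
        from x'k obtain j where j: "j \<in> C'" "x' = fst j" "k' = cball (m j) (r j)" by (auto simp: p_def)
        then have "i \<noteq> j" using x'k i by auto
        from pw[OF i(1) j(1) this] have "k \<inter> k' = {}" by (simp add: i j disjnt_def)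
        then show "interior k \<inter> interior k' = {}" by (meson disjoint_iff interior_subset subsetD)
      qed
      moreover have "\<gamma> fine p"
      proof (rule fineI)
        fix x k assume "(x, k) \<in> p"
        then obtain i where i: "i \<in> C'" "x = fst i" "k = cball (m i) (r i)" by (auto simp: p_def)
        show "k \<subseteq> \<gamma> x" using C'K[OF i(1)] unfolding i cb by (auto simp: K_def)
      qed
      ultimately have "sum (\<lambda>(x,k). norm (measure lborel k *\<^sub>R f x - integral k f)) p < e * \<eta> / 5"
        by (rule hen)
      then have less: "(\<Sum>i\<in>C'. norm (measure lborel (cball (m i) (r i)) *\<^sub>R f (fst i) - integral (cball (m i) (r i)) f)) < e * \<eta> / 5"
        unfolding p_def by (subst (asm) sum.reindex[OF inj]) simp
      have "(\<Sum>i\<in>C'. e * (2 * r i)) \<le> (\<Sum>i\<in>C'. norm (measure lborel (cball (m i) (r i)) *\<^sub>R f (fst i) - integral (cball (m i) (r i)) f))"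
      proof (rule sum_mono)
        fix i assume "i \<in> C'"
        from C'K[OF this] obtain x y where i: "i = (x, y)" and x: "x \<in> {c<..<d}" and y: "y \<in> {c<..<d}" "y \<noteq> x"
          and gt: "norm (F y - F x - (y - x) *\<^sub>R f x) > e * \<bar>y - x\<bar>"
          by (auto simp: K_def E_def)
        show "e * (2 * r i) \<le> norm (measure lborel (cball (m i) (r i)) *\<^sub>R f (fst i) - integral (cball (m i) (r i)) f)"
        proof (cases "x \<le> y")
          case True
          have "integral {x..y} f = F y - F x" using F[of x y] x y True by (intro integral_unique) auto
          then have "norm (measure lborel {x..y} *\<^sub>R f x - integral {x..y} f) = norm (F y - F x - (y - x) *\<^sub>R f x)"
            using True by (simp add: norm_minus_commute)
          moreover have "e * (2 * r i) = e * \<bar>y - x\<bar>" by (simp only: r_def i fst_conv snd_conv)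
          ultimately show ?thesis using gt True unfolding cb
            by (simp only: i fst_conv snd_conv min_def max_def if_True if_False)
        next
          case False
          have "integral {y..x} f = F x - F y" using F[of y x] x y False by (intro integral_unique) auto
          then have "measure lborel {y..x} *\<^sub>R f x - integral {y..x} f = F y - F x - (y - x) *\<^sub>R f x"
            using False by (simp add: algebra_simps)
          moreover have "e * (2 * r i) = e * \<bar>y - x\<bar>" by (simp only: r_def i fst_conv snd_conv)
          ultimately show ?thesis using gt False unfolding cb
            by (simp only: i fst_conv snd_conv min_def max_def if_True if_False)
        qed
      qed
      also note less
      finally have "(\<Sum>i\<in>C'. e * (2 * r i)) \<le> e * \<eta> / 5" by simp
      moreover have "e * (\<Sum>i\<in>C'. 10 * r i) = 5 * (\<Sum>i\<in>C'. e * (2 * r i))"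
        unfolding sum_distrib_left by (intro sum.cong refl) simp
      ultimately have "e * (\<Sum>i\<in>C'. 10 * r i) \<le> e * \<eta>" by linarith
      then show ?thesis using e by simp
    qed
    have rpos: "r i > 0" if "i \<in> C" for i
      using C that by (auto simp: K_def r_def)
    have bound: "measure lebesgue (\<Union>i\<in>C'. cball (m i) (5 * r i)) \<le> \<eta>" if C': "C' \<subseteq> C" "finite C'" for C'
    proof -
      have "measure lebesgue (\<Union>i\<in>C'. cball (m i) (5 * r i)) \<le> (\<Sum>i\<in>C'. measure lebesgue (cball (m i) (5 * r i)))"
        by (rule measure_UNION_le) (use C' in auto)
      also have "\<dots> = (\<Sum>i\<in>C'. 10 * r i)"
      proof (rule sum.cong[OF refl])
        fix i assume "i \<in> C'"
        then have "r i > 0" using rpos C' by blast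
        then show "measure lebesgue (cball (m i) (5 * r i)) = 10 * r i" by (simp add: cball_eq_atLeastAtMost)
      qed
      finally show ?thesis using fin[OF C'] by simp
    qed
    show "\<exists>T. E e \<subseteq> T \<and> T \<in> lmeasurable \<and> measure lebesgue T \<le> \<eta>"
    proof (intro exI conjI)
      show "E e \<subseteq> (\<Union>i\<in>C. cball (m i) (5 * r i))" by (rule C(4))
      show "(\<Union>i\<in>C. cball (m i) (5 * r i)) \<in> lmeasurable"
        by (rule fmeasurable_UN_bound[OF C(1)]) (use bound in auto)
      show "measure lebesgue (\<Union>i\<in>C. cball (m i) (5 * r i)) \<le> \<eta>"
        by (rule measure_UN_bound[OF C(1)]) (use bound in auto)
    qed
  qed
  then have "negligible (\<Union>n. E (1 / real (Suc n)))"
    by (intro negligible_countable_Union) auto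
  moreover have "{x\<in>{c<..<d}. \<not> (F has_vector_derivative f x) (at x)} \<subseteq> (\<Union>n. E (1 / real (Suc n)))"
  proof (safe, rule ccontr)
    fix x assume x: "x \<in> {c<..<d}" and nd: "\<not> (F has_vector_derivative f x) (at x)"
      and notE: "x \<notin> (\<Union>n. E (1 / real (Suc n)))"
    have "\<exists>\<delta>>0. \<forall>y. norm (y - x) < \<delta> \<longrightarrow> norm (F y - F x - (y - x) *\<^sub>R f x) \<le> e * norm (y - x)"
      if e: "e > 0" for e
    proof -
      obtain n where n: "1 / real (Suc n) < e" using nat_approx_posE[OF e] by auto
      have "x \<notin> E (1 / real (Suc n))" using notE by blast
      with x have "\<exists>\<delta>>0. \<forall>y\<in>{c<..<d}. y \<noteq> x \<longrightarrow> \<bar>y - x\<bar> < \<delta> \<longrightarrow>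
        norm (F y - F x - (y - x) *\<^sub>R f x) \<le> (1 / real (Suc n)) * \<bar>y - x\<bar>"
        unfolding E_def mem_Collect_eq by (meson linorder_not_less)
      then obtain \<delta> where \<delta>: "\<delta> > 0" "\<And>y. y\<in>{c<..<d} \<Longrightarrow> y \<noteq> x \<Longrightarrow> \<bar>y - x\<bar> < \<delta> \<Longrightarrow>
        norm (F y - F x - (y - x) *\<^sub>R f x) \<le> (1 / real (Suc n)) * \<bar>y - x\<bar>"
        by blast
      obtain \<delta>' where \<delta>': "\<delta>' > 0" "ball x \<delta>' \<subseteq> {c<..<d}"
        using x openE[OF open_greaterThanLessThan] by metis
      show ?thesis
      proof (intro exI[of _ "min \<delta> \<delta>'"] conjI allI impI)
        show "min \<delta> \<delta>' > 0" using \<delta> \<delta>' by simp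
        fix y assume y: "norm (y - x) < min \<delta> \<delta>'"
        then have "y \<in> {c<..<d}" using \<delta>' by (auto simp: dist_real_def subset_iff)
        show "norm (F y - F x - (y - x) *\<^sub>R f x) \<le> e * norm (y - x)"
        proof (cases "y = x")
          case False
          have "norm (F y - F x - (y - x) *\<^sub>R f x) \<le> (1 / real (Suc n)) * \<bar>y - x\<bar>"
            using \<delta>(2)[OF \<open>y \<in> {c<..<d}\<close> False] y by auto
          also have "\<dots> \<le> e * \<bar>y - x\<bar>" using n by (intro mult_right_mono) auto
          finally show ?thesis by simp
        qed simp
      qed
    qed
    then have "(F has_vector_derivative f x) (at x)"
      unfolding has_vector_derivative_def has_derivative_at_alt
      by (auto intro: bounded_linear_scaleR_left)
    then show False using nd by simp
  qed
  ultimately show ?thesis by (rule negligible_subset)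
qed

text \<open>
  In a sufficiently fine tagged division the intervals tagged outside the null set \<open>N\<close> contribute a
  small error because $f$ is the derivative at the tag. Those tagged in \<open>N\<close> lie in an open set of
  small measure, so absolute continuity makes the increments of $F$ over them small.
\<close>

lemma absolutely_continuous_imp_has_integral:
  assumes cd: "c \<le> d" and ac: "absolutely_continuous_on c d F"
    and der: "negligible {x\<in>{c..d}. \<not> (F has_vector_derivative f x) (at x)}"
  shows "(f has_integral F d - F c) {c..d}"
proof -
  define N where "N = {x\<in>{c..d}. \<not> (F has_vector_derivative f x) (at x)}"
  define f0 where "f0 x = (if x \<in> N then 0 else f x)" for x
  have "(f0 has_integral F d - F c) {c..d}"
    unfolding has_integral_real
  proof (intro allI impI)
    fix e :: real assume e: "e > 0"
    \<comment> \<open>The summand $1$ keeps the denominator positive when $c = d$.\<close>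
    define e' where "e' = e / (2 * (d - c + 1))"
    have e': "e' > 0" "e' * (d - c) < e / 2" using e cd by (auto simp: e'_def field_simps)
    obtain \<delta> where \<delta>: "\<delta> > 0" and small: "\<And>\<D> T. \<D> division_of T \<Longrightarrow> T \<subseteq> {c..d} \<Longrightarrow>
        (\<Sum>K\<in>\<D>. Sup K - Inf K) < \<delta> \<Longrightarrow> (\<Sum>K\<in>\<D>. norm (F (Sup K) - F (Inf K))) < e / 2"
      using ac[unfolded absolutely_continuous_on_def, THEN spec, THEN mp, OF half_gt_zero[OF e]] by blast
    have N: "N \<in> sets lebesgue" "emeasure lebesgue N = 0"
      using der unfolding N_def[symmetric] by (auto simp: negligible_iff_null_sets)
    obtain U where U: "open U" "N \<subseteq> U" "U \<in> lmeasurable" "measure lebesgue U < \<delta>"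
    proof (rule sets_lebesgue_outer_open[OF N(1) \<delta>])
      fix T assume T: "open T" "N \<subseteq> T" "T - N \<in> lmeasurable" "emeasure lebesgue (T - N) < ennreal \<delta>"
      have "T \<in> sets lebesgue" using T(1) by (metis borel_open sets_completionI_sets sets_lborel)
      moreover have "emeasure lebesgue T = emeasure lebesgue (T - N)"
        using N \<open>T \<in> sets lebesgue\<close> by (simp add: emeasure_Diff_null_set null_sets_def)
      ultimately have "emeasure lebesgue T < ennreal \<delta>" "T \<in> sets lebesgue" using T by auto
      moreover from this have "T \<in> lmeasurable"
        by (intro fmeasurableI) (auto intro: order_less_trans[OF _ ennreal_less_top])
      ultimately show thesis using that[of T] T \<delta>
        by (simp add: emeasure_eq_measure2 ennreal_less_iff)
    qed
    have "\<exists>r>0. \<forall>y. norm (y - x) < r \<longrightarrow> norm (F y - F x - (y - x) *\<^sub>R f x) \<le> e' * norm (y - x)"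
      if "x \<in> {c..d} - N" for x
      using that e' unfolding N_def by (auto simp: has_vector_derivative_def has_derivative_at_alt)
    then obtain r where r: "\<And>x. x \<in> {c..d} - N \<Longrightarrow> r x > 0"
      "\<And>x y. x \<in> {c..d} - N \<Longrightarrow> norm (y - x) < r x \<Longrightarrow> norm (F y - F x - (y - x) *\<^sub>R f x) \<le> e' * norm (y - x)"
      by metis
    define \<gamma> where "\<gamma> x = (if x \<in> N then U else if x \<in> {c..d} then ball x (r x) else ball x 1)" for x
    have gauge: "gauge \<gamma>" using U r(1) by (auto simp: gauge_def \<gamma>_def)
    have close: "norm (sum (\<lambda>(x,k). measure lborel k *\<^sub>R f0 x) p - (F d - F c)) < e"
      if p: "p tagged_division_of {c..d}" "\<gamma> fine p" for p
    proof -
      have finp: "finite p" using p(1) by blast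
      have form: "\<exists>u v. K = {u..v} \<and> u \<le> v \<and> x \<in> {u..v} \<and> K \<subseteq> {c..d} \<and> K \<subseteq> \<gamma> x" if xK: "(x, K) \<in> p" for x K
      proof -
        obtain u v where "K = cbox u v" using tagged_division_ofD(4)[OF p(1) xK] by blast
        moreover have "x \<in> K" "K \<subseteq> {c..d}" using tagged_division_ofD(2,3)[OF p(1) xK] by auto
        moreover have "K \<subseteq> \<gamma> x" using p(2) xK by (auto simp: fine_def)
        ultimately show ?thesis by (intro exI[of _ u] exI[of _ v]) auto
      qed
      define q where "q = {(x, K) \<in> p. x \<in> N}"
      have qp: "q \<subseteq> p" by (auto simp: q_def)
      \<comment> \<open>The supremum and infimum of the empty set are unspecified; \<open>inc\<close> vanishes there.\<close>
      define inc where "inc K = (if K = {} then 0 else F (Sup K) - F (Inf K))" for K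
      have tele: "(\<Sum>(x,K)\<in>p. F (Sup K) - F (Inf K)) = F d - F c"
        using additive_tagged_division_1[OF cd p(1)] by simp
      have tel1: "(\<Sum>(x,K)\<in>p. Sup K - Inf K) = d - c"
        using additive_tagged_division_1[OF cd p(1), of "\<lambda>x. x"] by simp
      have q: "q tagged_partial_division_of {c..d}"
        using p(1) qp by (meson tagged_division_of_def tagged_partial_division_subset)
      then have qdiv: "q tagged_division_of \<Union>(snd ` q)" by (rule tagged_partial_division_of_Union_self)
      have div: "snd ` q division_of \<Union>(snd ` q)" by (rule division_of_tagged_division[OF qdiv])
      have bad: "norm (\<Sum>(x,K)\<in>q. F (Sup K) - F (Inf K)) < e / 2"
      proof -
        have ne: "K \<noteq> {}" if "K \<in> snd ` q" for K using that by (auto dest!: tagged_partial_division_ofD(2)[OF q])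
        have "(\<Sum>(x,K)\<in>q. F (Sup K) - F (Inf K)) = (\<Sum>(x,K)\<in>q. inc K)"
        proof (rule sum.cong[OF refl], clarify)
          fix x K assume "(x, K) \<in> q"
          then have "K \<noteq> {}" using ne by force
          then show "F (Sup K) - F (Inf K) = inc K" by (simp add: inc_def)
        qed
        also have "\<dots> = (\<Sum>K\<in>snd ` q. inc K)"
        proof (rule sum.over_tagged_division_lemma[OF qdiv])
          fix u v :: real assume "box u v = {}"
          then have "cbox u v = {} \<or> u = v" by (auto simp: box_real)
          then show "inc (cbox u v) = 0" by (auto simp: inc_def)
        qed
        also have "norm \<dots> \<le> (\<Sum>K\<in>snd ` q. norm (inc K))" by (rule norm_sum)
        also have "\<dots> = (\<Sum>K\<in>snd ` q. norm (F (Sup K) - F (Inf K)))"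
          using ne by (intro sum.cong refl) (simp add: inc_def)
        also have "\<dots> < e / 2"
        proof (rule small[OF div])
          show "\<Union>(snd ` q) \<subseteq> {c..d}" 
          proof (rule Union_least)
            fix K assume "K \<in> snd ` q"
            then obtain x where "(x, K) \<in> q" by auto
            then show "K \<subseteq> {c..d}" by (rule tagged_partial_division_ofD(3)[OF q])
          qed
          have "(\<Sum>K\<in>snd ` q. Sup K - Inf K) = (\<Sum>K\<in>snd ` q. measure lebesgue K)"
          proof (rule sum.cong[OF refl])
            fix K assume "K \<in> snd ` q"
            then obtain x where "(x, K) \<in> p" using qp by auto
            from form[OF this] obtain u v where "K = {u..v}" "u \<le> v" by blast
            then show "Sup K - Inf K = measure lebesgue K" by simp
          qed
          also have "\<dots> = measure lebesgue (\<Union>(snd ` q))"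
            by (rule content_division[OF div])
          also have "\<dots> \<le> measure lebesgue U"
          proof (rule measure_mono_fmeasurable)
            show "\<Union>(snd ` q) \<subseteq> U"
            proof
              fix y assume "y \<in> \<Union>(snd ` q)"
              then obtain x K where "(x, K) \<in> q" "y \<in> K" by auto
              then show "y \<in> U" using form[of x K] by (auto simp: q_def \<gamma>_def)
            qed
            show "\<Union>(snd ` q) \<in> sets lebesgue"
              using lmeasurable_division[OF div] by auto
          qed (use U in auto)
          finally show "(\<Sum>K\<in>snd ` q. Sup K - Inf K) < \<delta>" using U by linarith
        qed
        finally show ?thesis .
      qed
      have good: "norm (\<Sum>(x,K)\<in>p - q. measure lborel K *\<^sub>R f0 x - (F (Sup K) - F (Inf K))) < e / 2"
      proof -
        have "norm (\<Sum>(x,K)\<in>p - q. measure lborel K *\<^sub>R f0 x - (F (Sup K) - F (Inf K))) \<le> (\<Sum>(x,K)\<in>p - q. e' * (Sup K - Inf K))"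
          unfolding case_prod_unfold
        proof (rule sum_norm_le)
          fix i assume i: "i \<in> p - q"
          then have ip: "(fst i, snd i) \<in> p" "fst i \<notin> N" by (auto simp: q_def)
          from form[OF ip(1)] obtain u v where uv: "snd i = {u..v}" "u \<le> v" "fst i \<in> {u..v}" "{u..v} \<subseteq> {c..d}"
            "{u..v} \<subseteq> \<gamma> (fst i)" by metis
          let ?x = "fst i"
          have x: "?x \<in> {c..d} - N" using uv ip by auto
          then have "{u..v} \<subseteq> ball ?x (r ?x)" using uv by (auto simp: \<gamma>_def)
          then have "norm (u - ?x) < r ?x" "norm (v - ?x) < r ?x"
            using uv(2) by (auto simp: dist_real_def subset_iff abs_minus_commute)
          from this[THEN r(2)[OF x]]
          have "norm (F u - F ?x - (u - ?x) *\<^sub>R f ?x) \<le> e' * (?x - u)"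
            "norm (F v - F ?x - (v - ?x) *\<^sub>R f ?x) \<le> e' * (v - ?x)" using uv(3) by auto
          then have "norm ((F u - F ?x - (u - ?x) *\<^sub>R f ?x) - (F v - F ?x - (v - ?x) *\<^sub>R f ?x)) \<le> e' * (?x - u) + e' * (v - ?x)"
            by (meson norm_triangle_le_diff add_mono)
          also have "(F u - F ?x - (u - ?x) *\<^sub>R f ?x) - (F v - F ?x - (v - ?x) *\<^sub>R f ?x)
             = (v - u) *\<^sub>R f ?x - (F v - F u)" by (simp add: algebra_simps)
          finally show "norm (measure lborel (snd i) *\<^sub>R f0 ?x - (F (Sup (snd i)) - F (Inf (snd i)))) \<le> e' * (Sup (snd i) - Inf (snd i))"
            using uv ip(2) by (simp add: f0_def algebra_simps)
        qed
        also have "\<dots> \<le> (\<Sum>(x,K)\<in>p. e' * (Sup K - Inf K))"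
        proof (rule sum_mono2[OF finp])
          fix i assume "i \<in> p - (p - q)"
          then have "(fst i, snd i) \<in> p" by auto
          from form[OF this] show "0 \<le> (case i of (x, K) \<Rightarrow> e' * (Sup K - Inf K))"
            using e' by (auto simp: case_prod_unfold)
        qed auto
        also have "\<dots> = e' * (d - c)"
          unfolding tel1[symmetric] by (simp add: sum_distrib_left case_prod_unfold)
        finally show ?thesis using e' by linarith
      qed
      have "sum (\<lambda>(x,k). measure lborel k *\<^sub>R f0 x) p - (F d - F c) =
          (\<Sum>(x,K)\<in>p. measure lborel K *\<^sub>R f0 x - (F (Sup K) - F (Inf K)))"
        unfolding tele[symmetric] by (simp add: case_prod_unfold sum_subtractf)
      also have "\<dots> = (\<Sum>(x,K)\<in>p - q. measure lborel K *\<^sub>R f0 x - (F (Sup K) - F (Inf K)))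
         + (\<Sum>(x,K)\<in>q. measure lborel K *\<^sub>R f0 x - (F (Sup K) - F (Inf K)))"
        by (rule sum.subset_diff[OF qp finp])
      also have "(\<Sum>(x,K)\<in>q. measure lborel K *\<^sub>R f0 x - (F (Sup K) - F (Inf K))) =
          (\<Sum>(x,K)\<in>q. - (F (Sup K) - F (Inf K)))"
        by (intro sum.cong refl) (auto simp: q_def f0_def)
      also have "\<dots> = - (\<Sum>(x,K)\<in>q. F (Sup K) - F (Inf K))"
        by (simp only: case_prod_unfold sum_negf)
      finally show ?thesis
        using norm_triangle_lt[of "\<Sum>(x,K)\<in>p - q. measure lborel K *\<^sub>R f0 x - (F (Sup K) - F (Inf K))"
            "- (\<Sum>(x,K)\<in>q. F (Sup K) - F (Inf K))" e] good bad by simp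
    qed
    show "\<exists>\<gamma>. gauge \<gamma> \<and> (\<forall>\<D>. \<D> tagged_division_of {c..d} \<and> \<gamma> fine \<D> \<longrightarrow>
        norm (sum (\<lambda>(x,k). measure lborel k *\<^sub>R f0 x) \<D> - (F d - F c)) < e)"
      using gauge close by (intro exI[of _ \<gamma>] conjI allI impI) (assumption, elim conjE)
  qed
  then show ?thesis
    by (rule has_integral_spike[rotated 2]) (use der in \<open>auto simp: f0_def N_def\<close>)
qed

text \<open>
  Cut \<open>g\<close> off at a height $n$ such that the integral of what exceeds $n$ is below $\epsilon/2$; over a
  set of measure less than \<open>\<delta>\<close> the truncated function contributes at most $n\delta$.
\<close>

lemma integrable_small_on_small_sets:
  fixes g :: "'a \<Rightarrow> real"
  assumes int: "integrable M g" and nonneg: "\<And>x. g x \<ge> 0" and \<epsilon>: "\<epsilon> > 0"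
  obtains \<delta> where "\<delta> > 0"
    "\<And>A. A \<in> sets M \<Longrightarrow> emeasure M A < ennreal \<delta> \<Longrightarrow> (LINT x|M. indicator A x * g x) < \<epsilon>"
proof -
  have [measurable]: "g \<in> borel_measurable M" using int by simp
  have "(\<lambda>n. LINT x|M. g x - min (g x) (real n)) \<longlonglongrightarrow> (LINT x|M. 0)"
  proof (rule integral_dominated_convergence[where w = g])
    show "\<And>n. AE x in M. norm (g x - min (g x) (real n)) \<le> g x"
      using nonneg by (intro AE_I2) (simp add: min_def)
    show "AE x in M. (\<lambda>n. g x - min (g x) (real n)) \<longlonglongrightarrow> 0"
    proof (intro AE_I2)
      fix x
      obtain k :: nat where k: "g x \<le> real k" using real_arch_simple by blast
      have "\<forall>\<^sub>F n in sequentially. g x - min (g x) (real n) = 0"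
        using eventually_ge_at_top[of k] by eventually_elim (use k in \<open>auto simp: min_def\<close>)
      then show "(\<lambda>n. g x - min (g x) (real n)) \<longlonglongrightarrow> 0" by (rule tendsto_eventually)
    qed
  qed (use int in simp_all)
  then have "\<forall>\<^sub>F n in sequentially. (LINT x|M. g x - min (g x) (real n)) < \<epsilon> / 2"
    by (rule order_tendstoD) (use \<epsilon> in simp)
  then obtain n where n: "(LINT x|M. g x - min (g x) (real n)) < \<epsilon> / 2"
    using eventually_happens'[OF sequentially_bot] by blast
  have intn: "integrable M (\<lambda>x. min (g x) (real n))"
    by (rule Bochner_Integration.integrable_bound[OF int]) (use nonneg in auto)
  define \<delta> where "\<delta> = \<epsilon> / (2 * (real n + 1))"
  show ?thesis
  proof
    show "\<delta> > 0" using \<epsilon> by (simp add: \<delta>_def)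
    fix A assume A[measurable]: "A \<in> sets M" and Ad: "emeasure M A < ennreal \<delta>"
    then have fin: "emeasure M A < \<infinity>" using order.strict_trans ennreal_less_top by (metis infinity_ennreal_def)
    have mA: "measure M A \<le> \<delta>" using Ad \<open>\<delta> > 0\<close>
      by (simp add: measure_def enn2real_leI)
    have "(LINT x|M. indicator A x * g x) \<le> (LINT x|M. (g x - min (g x) (real n)) + real n * indicator A x)"
    proof (rule integral_mono)
      show "integrable M (\<lambda>x. indicator A x * g x)"
        by (rule Bochner_Integration.integrable_bound[OF int]) (auto simp: indicator_def)
      show "integrable M (\<lambda>x. (g x - min (g x) (real n)) + real n * indicator A x)"
        using int intn fin by (intro Bochner_Integration.integrable_add Bochner_Integration.integrable_diff
          integrable_mult_right integrable_real_indicator) auto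
    qed (use nonneg in \<open>auto simp: indicator_def min_def\<close>)
    also have "\<dots> = (LINT x|M. g x - min (g x) (real n)) + real n * measure M A"
      using int intn fin by (subst Bochner_Integration.integral_add) (auto intro!: integrable_mult_right)
    also have "\<dots> < \<epsilon> / 2 + real n * \<delta>" using n mult_left_mono[OF mA, of "real n"] by auto
    also have "\<dots> \<le> \<epsilon>" using \<epsilon> by (auto simp: \<delta>_def field_simps)
    finally show "(LINT x|M. indicator A x * g x) < \<epsilon>" .
  qed
qed

lemma integrable_lebesgue_on_subset:
  fixes f :: "real \<Rightarrow> 'b::{banach, second_countable_topology}"
  assumes "integrable (lebesgue_on T) f" "S \<subseteq> T" "S \<in> sets lebesgue" "T \<in> sets lebesgue"
  shows "integrable (lebesgue_on S) f"
proof -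
  have "set_integrable lebesgue T f"
    using assms by (simp add: integrable_restrict_space set_integrable_def)
  then have "set_integrable lebesgue S f" by (rule set_integrable_subset) (use assms in auto)
  then show ?thesis using assms by (simp add: integrable_restrict_space set_integrable_def)
qed

lemma AE_lebesgue_on_subset:
  assumes "AE x in lebesgue_on T. P x" "S \<subseteq> T" "S \<in> sets lebesgue" "T \<in> sets lebesgue"
  shows "AE x in lebesgue_on S. P x"
  using assms(1) unfolding AE_restrict_space_iff[of S lebesgue, simplified, OF assms(3)]
    AE_restrict_space_iff[of T lebesgue, simplified, OF assms(4)]
  by eventually_elim (use assms in auto)

lemma indefinite_integral_absolutely_continuous:
  assumes int: "integrable (lebesgue_on {c..d}) \<phi>"
    and F: "\<And>s t. c \<le> s \<Longrightarrow> s \<le> t \<Longrightarrow> t \<le> d \<Longrightarrow> F t - F s = (LINT x|lebesgue_on {s..t}. \<phi> x)"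
  shows "absolutely_continuous_on c d F"
  unfolding absolutely_continuous_on_def
proof (intro allI impI)
  fix \<epsilon> :: real assume \<epsilon>: "\<epsilon> > 0"
  let ?g = "\<lambda>x. norm (\<phi> x)"
  have intn: "integrable (lebesgue_on {c..d}) ?g" using int by simp
  obtain \<delta> where \<delta>: "\<delta> > 0" and small: "\<And>A. A \<in> sets (lebesgue_on {c..d}) \<Longrightarrow>
      emeasure (lebesgue_on {c..d}) A < ennreal \<delta> \<Longrightarrow> (LINT x|lebesgue_on {c..d}. indicator A x * ?g x) < \<epsilon>"
    by (rule integrable_small_on_small_sets[OF intn norm_ge_zero \<epsilon>]) blast
  have "(\<Sum>K\<in>\<D>. norm (F (Sup K) - F (Inf K))) < \<epsilon>"
    if \<D>: "\<D> division_of T" and T: "T \<subseteq> {c..d}" and len: "(\<Sum>K\<in>\<D>. Sup K - Inf K) < \<delta>" for \<D> T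
  proof -
    have Tm: "T \<in> lmeasurable" by (rule lmeasurable_division[OF \<D>])
    then have Ts: "T \<in> sets lebesgue" by (rule fmeasurableD)
    have form: "\<exists>u v. K = {u..v} \<and> u \<le> v \<and> {u..v} \<subseteq> {c..d}" if "K \<in> \<D>" for K
    proof -
      from division_ofD(4)[OF \<D> that] obtain u v where "K = {u..v}" by auto
      moreover from this have "u \<le> v" using division_ofD(3)[OF \<D> that] by simp
      moreover have "{u..v} \<subseteq> {c..d}" using division_ofD(2)[OF \<D> that] T \<open>K = {u..v}\<close> by (rule_tac subset_trans) simp_all
      ultimately show ?thesis by blast
    qed
    have intT: "integrable (lebesgue_on T) ?g"
      by (rule integrable_lebesgue_on_subset[OF intn T Ts]) simp
    have "(\<Sum>K\<in>\<D>. norm (F (Sup K) - F (Inf K))) \<le> (\<Sum>K\<in>\<D>. integral K ?g)"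
    proof (rule sum_mono)
      fix K assume "K \<in> \<D>"
      from form[OF this] obtain u v where K: "K = {u..v}" "u \<le> v" "{u..v} \<subseteq> {c..d}" by blast
      have iK: "integrable (lebesgue_on {u..v}) \<phi>" by (rule integrable_lebesgue_on_subset[OF int K(3)]) auto
      have "norm (F v - F u) = norm (LINT x|lebesgue_on {u..v}. \<phi> x)" using F[of u v] K by auto
      also have "\<dots> \<le> (LINT x|lebesgue_on {u..v}. ?g x)" by (rule integral_norm_bound)
      also have "\<dots> = integral {u..v} ?g" using iK by (intro lebesgue_integral_eq_integral) auto
      finally show "norm (F (Sup K) - F (Inf K)) \<le> integral K ?g" using K by simp
    qed
    also have "\<dots> = integral T ?g"
      using integral_combine_division_topdown[OF integrable_on_lebesgue_on[OF intT Ts] \<D>] by simp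
    also have "\<dots> = (LINT x|lebesgue_on T. ?g x)"
      using intT Ts by (simp add: lebesgue_integral_eq_integral)
    also have "\<dots> = (LINT x|lebesgue_on {c..d}. indicator T x * ?g x)"
      using T Ts by (simp add: integral_restrict_space) (intro Bochner_Integration.integral_cong refl, auto simp: indicator_def)
    also have "\<dots> < \<epsilon>"
    proof (rule small)
      show "T \<in> sets (lebesgue_on {c..d})" using T Ts by (simp add: sets_restrict_space_iff)
      have "(\<Sum>K\<in>\<D>. Sup K - Inf K) = (\<Sum>K\<in>\<D>. measure lebesgue K)"
        using form by (intro sum.cong refl) fastforce
      then have "measure lebesgue T < \<delta>" using len content_division[OF \<D>] by simp
      then show "emeasure (lebesgue_on {c..d}) T < ennreal \<delta>"
        using T Ts Tm \<delta> by (simp add: emeasure_restrict_space emeasure_eq_measure2 ennreal_less_iff)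
    qed
    finally show ?thesis .
  qed
  then show "\<exists>\<delta>>0. \<forall>\<D> T. \<D> division_of T \<and> T \<subseteq> {c..d} \<and> (\<Sum>K\<in>\<D>. Sup K - Inf K) < \<delta> \<longrightarrow>
      (\<Sum>K\<in>\<D>. norm (F (Sup K) - F (Inf K))) < \<epsilon>"
    using \<delta> by blast
qed

text \<open>
  The two sides of this equivalence come from the fundamental theorem of calculus and from
  Lebesgue's differentiation theorem, respectively. It replaces all later arguments with absolutely
  continuous functions by identities for integrals.
\<close>

lemma locally_absolutely_continuous_derivative_iff:
  fixes F \<phi> :: "real \<Rightarrow> complex^2"
  assumes int: "\<And>s t. a < s \<Longrightarrow> s \<le> t \<Longrightarrow> t < b \<Longrightarrow> integrable (lebesgue_on {s..t}) \<phi>"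
  shows "locally_absolutely_continuous a b F \<and>
      (AE t in lebesgue_on {a<..<b}. (F has_vector_derivative \<phi> t) (at t)) \<longleftrightarrow>
    (\<forall>s t. a < s \<and> s \<le> t \<and> t < b \<longrightarrow> F t - F s = (LINT x|lebesgue_on {s..t}. \<phi> x))"
proof (intro iffI conjI allI impI; (elim conjE)?)
  fix s t assume ac: "locally_absolutely_continuous a b F"
    and der: "AE t in lebesgue_on {a<..<b}. (F has_vector_derivative \<phi> t) (at t)"
    and st: "a < s" "s \<le> t" "t < b"
  have "AE x in lebesgue_on {s..t}. (F has_vector_derivative \<phi> x) (at x)"
    by (rule AE_lebesgue_on_subset[OF der]) (use st in auto)
  then have "AE x in lebesgue. x \<in> {s..t} \<longrightarrow> (F has_vector_derivative \<phi> x) (at x)"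
    by (simp add: AE_restrict_space_iff)
  then have "negligible {x \<in> {s..t}. \<not> (F has_vector_derivative \<phi> x) (at x)}"
    by (simp add: negligible_iff_null_sets eventually_ae_filter_negligible)
      (metis (mono_tags, lifting) Collect_mono_iff negligible_iff_null_sets negligible_subset)
  then have "(\<phi> has_integral F t - F s) {s..t}"
    using ac st by (intro absolutely_continuous_imp_has_integral) (auto simp: locally_absolutely_continuous_def)
  then show "F t - F s = (LINT x|lebesgue_on {s..t}. \<phi> x)"
    using int[OF st] by (simp add: lebesgue_integral_eq_integral integral_unique)
next
  assume F: "\<forall>s t. a < s \<and> s \<le> t \<and> t < b \<longrightarrow> F t - F s = (LINT x|lebesgue_on {s..t}. \<phi> x)"
  show "locally_absolutely_continuous a b F"
    unfolding locally_absolutely_continuous_def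
  proof (intro allI impI)
    fix c d assume cd: "a < c \<and> c \<le> d \<and> d < b"
    show "absolutely_continuous_on c d F"
      by (rule indefinite_integral_absolutely_continuous[OF int]) (use cd F in auto)
  qed
  \<comment> \<open>Near the endpoints \<open>\<phi>\<close> need not be integrable, so the interval is exhausted from inside.\<close>
  define N where "N n = {x\<in>{a + 1 / real (Suc n)<..<b - 1 / real (Suc n)}. \<not> (F has_vector_derivative \<phi> x) (at x)}" for n
  have "negligible (N n)" for n
    unfolding N_def
  proof (rule lebesgue_differentiation)
    fix s t assume st: "a + 1 / real (Suc n) \<le> s" "s \<le> t" "t \<le> b - 1 / real (Suc n)"
    have "1 / real (Suc n) > 0" by simp
    then have st': "a < s" "t < b" using st by linarith+
    show "(\<phi> has_integral F t - F s) {s..t}"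
      using F st st' has_integral_integral_lebesgue_on[OF int[of s t]] by auto
  qed
  then have "negligible (\<Union>n. N n)" by (intro negligible_countable_Union) auto
  moreover have "{x\<in>{a<..<b}. \<not> (F has_vector_derivative \<phi> x) (at x)} \<subseteq> (\<Union>n. N n)"
  proof
    fix x assume x: "x \<in> {x\<in>{a<..<b}. \<not> (F has_vector_derivative \<phi> x) (at x)}"
    then have "0 < min (x - a) (b - x)" by auto
    then obtain n where "1 / real (Suc n) < min (x - a) (b - x)" using nat_approx_posE by metis
    then have "x \<in> N n" using x by (auto simp: N_def)
    then show "x \<in> (\<Union>n. N n)" by blast
  qed
  ultimately have "negligible {x\<in>{a<..<b}. \<not> (F has_vector_derivative \<phi> x) (at x)}"
    by (rule negligible_subset)
  then have "AE x in lebesgue. x \<in> {a<..<b} \<longrightarrow> (F has_vector_derivative \<phi> x) (at x)"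
    by (intro AE_I'[where N="{x\<in>{a<..<b}. \<not> (F has_vector_derivative \<phi> x) (at x)}"])
      (auto simp: negligible_iff_null_sets)
  then show "AE t in lebesgue_on {a<..<b}. (F has_vector_derivative \<phi> t) (at t)"
    by (simp add: AE_restrict_space_iff)
qed

section \<open>Pointwise algebra of positive semidefinite matrices\<close>

lemma vec2_eq_iff: "(x :: 'a^2) = y \<longleftrightarrow> x $ 1 = y $ 1 \<and> x $ 2 = y $ 2"
  by (simp add: vec_eq_iff forall_2)

lemma norm_vec2_le: "norm (x :: complex^2) \<le> norm (x $ 1) + norm (x $ 2)"
proof -
  have "norm x \<le> (\<Sum>i\<in>UNIV. norm (x $ i))" unfolding norm_vec_def by (rule L2_set_le_sum) simp
  then show ?thesis by (simp add: sum_2)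
qed

lemma borel_measurable_vec2_iff:
  fixes f :: "'a \<Rightarrow> complex^2"
  shows "f \<in> borel_measurable M \<longleftrightarrow>
    (\<lambda>x. f x $ 1) \<in> borel_measurable M \<and> (\<lambda>x. f x $ 2) \<in> borel_measurable M"
proof
  assume f: "f \<in> borel_measurable M"
  have "(\<lambda>x. f x $ i) \<in> borel_measurable M" for i
    by (rule borel_measurable_continuous_on[OF _ f]) (intro continuous_intros)
  then show "(\<lambda>x. f x $ 1) \<in> borel_measurable M \<and> (\<lambda>x. f x $ 2) \<in> borel_measurable M" by blast
next
  assume f: "(\<lambda>x. f x $ 1) \<in> borel_measurable M \<and> (\<lambda>x. f x $ 2) \<in> borel_measurable M"
  have c: "continuous_on UNIV (\<lambda>z::complex. (\<chi> j. if j = i then z else 0) :: complex^2)" for i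
  proof (rule continuous_on_vec_lambda)
    show "continuous_on UNIV (\<lambda>z::complex. if j = i then z else 0)" for j by (cases "j = i") auto
  qed
  have "f = (\<lambda>x. (\<chi> j. if j = 1 then f x $ 1 else 0) + (\<chi> j. if j = 2 then f x $ 2 else 0))"
    by (simp add: fun_eq_iff vec2_eq_iff)
  also have "\<dots> \<in> borel_measurable M"
    using f by (intro borel_measurable_add borel_measurable_continuous_on[OF c]) auto
  finally show "f \<in> borel_measurable M" .
qed

lemma borel_measurable_matrix_nth:
  fixes H :: "'a \<Rightarrow> real^2^2"
  assumes "H \<in> borel_measurable M"
  shows "(\<lambda>x. H x $ i $ j) \<in> borel_measurable M"
  by (rule borel_measurable_continuous_on[OF _ assms]) (intro continuous_intros)

lemma ham_app_nth:
  "ham_app H f t $ 1 = of_real (H t $ 1 $ 1) * f t $ 1 + of_real (H t $ 1 $ 2) * f t $ 2"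
  "ham_app H f t $ 2 = of_real (H t $ 2 $ 1) * f t $ 1 + of_real (H t $ 2 $ 2) * f t $ 2"
  by (simp_all add: ham_app_def matrix_vector_mult_def complex_matrix_def sum_2)

lemma J_ham_app_nth:
  "J_ham_app H f t $ 1 = - ham_app H f t $ 2"
  "J_ham_app H f t $ 2 = ham_app H f t $ 1"
  by (simp_all add: J_ham_app_def matrix_vector_mult_def complex_matrix_def sum_2 J_def)

lemma J_ham_app_eq_iff: "J_ham_app H f t = J_ham_app H g t \<longleftrightarrow> ham_app H f t = ham_app H g t"
  by (auto simp: vec2_eq_iff J_ham_app_nth)

lemma ham_app_linear:
  "ham_app H (\<lambda>t. f t + g t) t = ham_app H f t + ham_app H g t"
  "ham_app H (\<lambda>t. f t - g t) t = ham_app H f t - ham_app H g t"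
  "ham_app H (\<lambda>t. c *s f t) t = c *s ham_app H f t"
  by (simp_all add: vec2_eq_iff ham_app_nth algebra_simps)

lemma J_ham_app_linear:
  "J_ham_app H (\<lambda>t. f t + g t) t = J_ham_app H f t + J_ham_app H g t"
  "J_ham_app H (\<lambda>t. c *s f t) t = c *s J_ham_app H f t"
  by (simp_all add: vec2_eq_iff J_ham_app_nth ham_app_linear)

lemma ham_form_expand:
  "ham_form H f g t = cnj (f t $ 1) * ham_app H g t $ 1 + cnj (f t $ 2) * ham_app H g t $ 2"
  by (simp add: ham_form_def sum_2)

lemma ham_form_linear_right:
  "ham_form H f (\<lambda>t. g t + g' t) t = ham_form H f g t + ham_form H f g' t"
  "ham_form H f (\<lambda>t. c *s g t) t = c * ham_form H f g t"
  by (simp_all add: ham_form_expand ham_app_linear algebra_simps)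

definition energy :: "(real \<Rightarrow> real^2^2) \<Rightarrow> (real \<Rightarrow> complex^2) \<Rightarrow> real \<Rightarrow> real" where
  "energy H f t = Re (ham_form H f f t)"

lemma psd_entries:
  assumes "positive_semidefinite M"
  shows "M $ 2 $ 1 = M $ 1 $ 2" "0 \<le> M $ 1 $ 1" "0 \<le> M $ 2 $ 2" "(M $ 1 $ 2)\<^sup>2 \<le> M $ 1 $ 1 * M $ 2 $ 2"
proof -
  have "transpose M $ 2 $ 1 = M $ 1 $ 2" by (simp add: transpose_def)
  then show sym: "M $ 2 $ 1 = M $ 1 $ 2" using assms by (simp add: positive_semidefinite_def)
  have q: "0 \<le> M $ 1 $ 1 * x\<^sup>2 + 2 * M $ 1 $ 2 * x * y + M $ 2 $ 2 * y\<^sup>2" for x y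
  proof -
    have "0 \<le> vector [x, y] \<bullet> (M *v (vector [x, y] :: real^2))"
      using assms by (auto simp: positive_semidefinite_def)
    then show ?thesis
      by (simp add: inner_vec_def sum_2 matrix_vector_mult_def sym algebra_simps power2_eq_square)
  qed
  show h1: "0 \<le> M $ 1 $ 1" using q[of 1 0] by simp
  show h2: "0 \<le> M $ 2 $ 2" using q[of 0 1] by simp
  show "(M $ 1 $ 2)\<^sup>2 \<le> M $ 1 $ 1 * M $ 2 $ 2"
  proof (cases "M $ 2 $ 2 = 0")
    case True
    have "M $ 1 $ 2 = 0"
    proof (rule ccontr)
      assume "M $ 1 $ 2 \<noteq> 0"
      then show False using q[of 1 "- (M $ 1 $ 1 + 1) / (2 * M $ 1 $ 2)"] True by simp
    qed
    then show ?thesis using True by simp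
  next
    case False
    then have "M $ 2 $ 2 > 0" using h2 by simp
    have "0 \<le> M $ 2 $ 2 * (M $ 1 $ 1 * M $ 2 $ 2 - (M $ 1 $ 2)\<^sup>2)"
      using q[of "M $ 2 $ 2" "- (M $ 1 $ 2)"] by (simp add: algebra_simps power2_eq_square)
    then show ?thesis using \<open>M $ 2 $ 2 > 0\<close> by (simp add: zero_le_mult_iff)
  qed
qed

text \<open>
  A Cholesky factorisation. It turns $f^*Hg$ into a Euclidean inner product of two vectors, from
  which the Cauchy--Schwarz type estimates below are immediate.
\<close>

lemma psd_factor:
  assumes "positive_semidefinite M"
  obtains p r s where "M $ 1 $ 1 = p\<^sup>2" "M $ 1 $ 2 = p * r" "M $ 2 $ 1 = p * r" "M $ 2 $ 2 = r\<^sup>2 + s\<^sup>2"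
proof (cases "M $ 1 $ 1 = 0")
  case True
  then have "M $ 1 $ 2 = 0" using psd_entries[OF assms] by simp
  then show ?thesis using that[of 0 0 "sqrt (M $ 2 $ 2)"] True psd_entries[OF assms] by simp
next
  case False
  define p where "p = sqrt (M $ 1 $ 1)"
  have p: "p\<^sup>2 = M $ 1 $ 1" "p \<noteq> 0" using psd_entries[OF assms] False by (auto simp: p_def)
  define r where "r = M $ 1 $ 2 / p"
  have "r\<^sup>2 \<le> M $ 2 $ 2" unfolding r_def power_divide p
    using psd_entries[OF assms] False by (simp add: divide_le_eq mult.commute)
  then show ?thesis using that[of p r "sqrt (M $ 2 $ 2 - r\<^sup>2)"] p psd_entries[OF assms] by (simp add: r_def)
qed

abbreviation row :: "real \<Rightarrow> real \<Rightarrow> complex^2 \<Rightarrow> complex" where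
  "row p r x \<equiv> of_real p * x $ 1 + of_real r * x $ 2"

lemma two_mult_le_squares: "2 * ((x::real) * y) \<le> x\<^sup>2 + y\<^sup>2"
  using sum_squares_bound[of x y] by simp

lemma half_sum_squares_bound:
  "x \<le> a * b + c * d \<Longrightarrow> x \<le> ((a\<^sup>2 + c\<^sup>2) + (b\<^sup>2 + d\<^sup>2)) / (2::real)"
  using two_mult_le_squares[of a b] two_mult_le_squares[of c d] by simp

context
  fixes H :: "real \<Rightarrow> real^2^2" and t :: real
  assumes psd: "positive_semidefinite (H t)"
begin

lemma energy_factor:
  obtains p r s where "H t $ 1 $ 1 = p\<^sup>2" "H t $ 1 $ 2 = p * r" "H t $ 2 $ 1 = p * r" "H t $ 2 $ 2 = r\<^sup>2 + s\<^sup>2"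
    "\<And>f g. ham_form H f g t = cnj (row p r (f t)) * (row p r (g t))
       + cnj (of_real s * f t $ 2) * (of_real s * g t $ 2)"
    "\<And>f. energy H f t = (norm (row p r (f t)))\<^sup>2 + (norm (of_real s * f t $ 2))\<^sup>2"
    "\<And>f. ham_form H f f t = of_real (energy H f t)"
proof -
  obtain p r s where prs: "H t $ 1 $ 1 = p\<^sup>2" "H t $ 1 $ 2 = p * r" "H t $ 2 $ 1 = p * r" "H t $ 2 $ 2 = r\<^sup>2 + s\<^sup>2"
    using psd_factor[OF psd] by metis
  have form: "ham_form H f g t = cnj (row p r (f t)) * (row p r (g t))
       + cnj (of_real s * f t $ 2) * (of_real s * g t $ 2)" for f g
    by (simp add: ham_form_expand ham_app_nth prs power2_eq_square algebra_simps)
  have form': "ham_form H f f t = of_real ((norm (row p r (f t)))\<^sup>2 + (norm (of_real s * f t $ 2))\<^sup>2)" for f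
    unfolding form of_real_add complex_norm_square[symmetric] by (simp only: complex_norm_square mult.commute)
  show thesis
    by (rule that[OF prs form]) (auto simp: energy_def form')
qed

lemma ham_form_self: "ham_form H f f t = of_real (energy H f t)"
  by (rule energy_factor) blast

lemma energy_nonneg: "0 \<le> energy H f t"
  by (rule energy_factor) simp

lemma norm_ham_form_le: "norm (ham_form H f g t) \<le> (energy H f t + energy H g t) / 2"
proof (rule energy_factor)
  fix p r s
  assume form: "\<And>f g. ham_form H f g t = cnj (row p r (f t)) * (row p r (g t))
       + cnj (of_real s * f t $ 2) * (of_real s * g t $ 2)"
    and en: "\<And>f. energy H f t = (norm (row p r (f t)))\<^sup>2 + (norm (of_real s * f t $ 2))\<^sup>2"
  let ?u = "\<lambda>f. row p r (f t)" and ?v = "\<lambda>f. of_real s * f t $ 2"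
  have "norm (ham_form H f g t) \<le> norm (?u f) * norm (?u g) + norm (?v f) * norm (?v g)"
    unfolding form by (rule order_trans[OF norm_triangle_ineq]) (simp only: norm_mult complex_mod_cnj)
  then show ?thesis unfolding en by (rule half_sum_squares_bound)
qed

lemma norm_add_square_le: "(norm (x + y :: complex))\<^sup>2 \<le> 2 * ((norm x)\<^sup>2 + (norm y)\<^sup>2)"
proof -
  have "(norm (x + y))\<^sup>2 \<le> (norm x + norm y)\<^sup>2" by (intro power_mono norm_triangle_ineq) auto
  then show ?thesis using two_mult_le_squares[of "norm x" "norm y"] by (simp add: power2_sum)
qed

lemma energy_add_le: "energy H (\<lambda>t. f t + g t) t \<le> 2 * (energy H f t + energy H g t)"
proof (rule energy_factor)
  fix p r s
  assume en: "\<And>f. energy H f t = (norm (row p r (f t)))\<^sup>2 + (norm (of_real s * f t $ 2))\<^sup>2"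
  let ?u = "\<lambda>f. row p r (f t)" and ?v = "\<lambda>f. of_real s * f t $ 2"
  have "?u (\<lambda>t. f t + g t) = ?u f + ?u g" "?v (\<lambda>t. f t + g t) = ?v f + ?v g"
    by (simp_all add: algebra_simps)
  then show ?thesis unfolding en
    using norm_add_square_le[of "?u f" "?u g"] norm_add_square_le[of "?v f" "?v g"] by simp
qed

text \<open>
  These are the Cauchy--Schwarz inequality for the form of $H$, applied to $f$ and a unit vector:
  the components of $Hf$ are its pairings with the unit vectors.
\<close>

lemma norm_ham_app_square_le:
  "(norm (ham_app H f t $ 1))\<^sup>2 \<le> H t $ 1 $ 1 * energy H f t"
  "(norm (ham_app H f t $ 2))\<^sup>2 \<le> H t $ 2 $ 2 * energy H f t"
proof -
  obtain p r s where prs: "H t $ 1 $ 1 = p\<^sup>2" "H t $ 1 $ 2 = p * r" "H t $ 2 $ 1 = p * r" "H t $ 2 $ 2 = r\<^sup>2 + s\<^sup>2"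
    and en: "energy H f t = (norm (row p r (f t)))\<^sup>2 + (norm (of_real s * f t $ 2))\<^sup>2"
    by (rule energy_factor) blast
  define u where "u = row p r (f t)"
  define v where "v = of_real s * f t $ 2"
  have 1: "ham_app H f t $ 1 = of_real p * u" "ham_app H f t $ 2 = of_real r * u + of_real s * v"
    by (simp_all add: ham_app_nth prs u_def v_def algebra_simps power2_eq_square)
  have en: "energy H f t = (norm u)\<^sup>2 + (norm v)\<^sup>2" using en by (simp add: u_def v_def)
  show "(norm (ham_app H f t $ 1))\<^sup>2 \<le> H t $ 1 $ 1 * energy H f t"
    unfolding 1 prs en by (simp add: norm_mult power_mult_distrib mult_left_mono)
  have "(norm (of_real r * u + of_real s * v))\<^sup>2 \<le> (\<bar>r\<bar> * norm u + \<bar>s\<bar> * norm v)\<^sup>2"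
    by (intro power_mono) (auto intro: order_trans[OF norm_triangle_ineq] simp: norm_mult)
  also have "\<dots> \<le> (r\<^sup>2 + s\<^sup>2) * ((norm u)\<^sup>2 + (norm v)\<^sup>2)"
  proof -
    have "0 \<le> (\<bar>r\<bar> * norm v - \<bar>s\<bar> * norm u)\<^sup>2" by simp
    then show ?thesis by (simp add: power2_sum power2_diff power_mult_distrib algebra_simps)
  qed
  finally show "(norm (ham_app H f t $ 2))\<^sup>2 \<le> H t $ 2 $ 2 * energy H f t" unfolding 1 prs en .
qed

lemma le_half_sum_of_square_le: "0 \<le> h \<Longrightarrow> 0 \<le> q \<Longrightarrow> x\<^sup>2 \<le> h * q \<Longrightarrow> x \<le> (h + q) / (2::real)"
proof -
  assume a: "0 \<le> h" "0 \<le> q" "x\<^sup>2 \<le> h * q"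
  have "x\<^sup>2 \<le> ((h + q) / 2)\<^sup>2"
    using a(3) two_mult_le_squares[of h q] by (simp add: power_divide power2_sum)
  then show ?thesis using a by (simp add: power2_le_iff_abs_le abs_le_iff)
qed

lemma norm_J_ham_app_le_energy:
  "norm (J_ham_app H f t) \<le> H t $ 1 $ 1 + H t $ 2 $ 2 + energy H f t"
proof -
  have "norm (ham_app H f t $ 1) \<le> (H t $ 1 $ 1 + energy H f t) / 2" "norm (ham_app H f t $ 2) \<le> (H t $ 2 $ 2 + energy H f t) / 2"
    using le_half_sum_of_square_le norm_ham_app_square_le psd_entries[OF psd] energy_nonneg by auto
  then show ?thesis
    using norm_vec2_le[of "J_ham_app H f t"] psd_entries[OF psd] by (simp add: J_ham_app_nth)
qed

lemma energy_le_diagonal: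
  "energy H f t \<le> 2 * (H t $ 1 $ 1 * (norm (f t $ 1))\<^sup>2 + H t $ 2 $ 2 * (norm (f t $ 2))\<^sup>2)"
proof (rule energy_factor)
  fix p r s
  assume prs: "H t $ 1 $ 1 = p\<^sup>2" "H t $ 2 $ 2 = r\<^sup>2 + s\<^sup>2"
    and en: "\<And>f. energy H f t = (norm (row p r (f t)))\<^sup>2 + (norm (of_real s * f t $ 2))\<^sup>2"
  have A: "(norm (row p r (f t)))\<^sup>2 \<le> 2 * (p\<^sup>2 * (norm (f t $ 1))\<^sup>2 + r\<^sup>2 * (norm (f t $ 2))\<^sup>2)"
    using norm_add_square_le[of "of_real p * f t $ 1" "of_real r * f t $ 2"]
    by (simp add: norm_mult power_mult_distrib)
  have B: "(norm (of_real s * f t $ 2))\<^sup>2 = s\<^sup>2 * (norm (f t $ 2))\<^sup>2"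
    by (simp add: norm_mult power_mult_distrib)
  have C: "x \<le> 2 * (a + b) \<Longrightarrow> 0 \<le> c \<Longrightarrow> x + c \<le> 2 * (a + (b + c))" for x a b c :: real by simp
  show ?thesis unfolding en prs distrib_right B by (rule C[OF A]) simp
qed

lemma norm_J_ham_app_le:
  "norm (J_ham_app H f t) \<le> 2 * (H t $ 1 $ 1 + H t $ 2 $ 2) * norm (f t)"
proof -
  obtain p r s where prs: "H t $ 1 $ 1 = p\<^sup>2" "H t $ 1 $ 2 = p * r" "H t $ 2 $ 1 = p * r" "H t $ 2 $ 2 = r\<^sup>2 + s\<^sup>2"
    by (rule energy_factor)
  have h3: "\<bar>p * r\<bar> \<le> (p\<^sup>2 + r\<^sup>2 + s\<^sup>2) / 2"
  proof -
    have aux: "2 * x \<le> y \<Longrightarrow> 0 \<le> z \<Longrightarrow> x \<le> (y + z) / 2" for x y z :: real by simp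
    show ?thesis unfolding abs_mult
      by (rule aux) (use two_mult_le_squares[of "\<bar>p\<bar>" "\<bar>r\<bar>"] in simp_all)
  qed
  have "norm (ham_app H f t $ 1) \<le> \<bar>p\<^sup>2\<bar> * norm (f t $ 1) + \<bar>p * r\<bar> * norm (f t $ 2)"
    unfolding ham_app_nth prs by (rule order_trans[OF norm_triangle_ineq]) (simp only: norm_mult norm_of_real order_refl)
  also have "\<dots> \<le> \<bar>p\<^sup>2\<bar> * norm (f t) + \<bar>p * r\<bar> * norm (f t)"
    by (intro add_mono mult_left_mono Finite_Cartesian_Product.norm_nth_le) auto
  finally have 1: "norm (ham_app H f t $ 1) \<le> (\<bar>p\<^sup>2\<bar> + \<bar>p * r\<bar>) * norm (f t)" by (simp add: algebra_simps)
  have "norm (ham_app H f t $ 2) \<le> \<bar>p * r\<bar> * norm (f t $ 1) + \<bar>r\<^sup>2 + s\<^sup>2\<bar> * norm (f t $ 2)"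
    unfolding ham_app_nth prs by (rule order_trans[OF norm_triangle_ineq]) (simp only: norm_mult norm_of_real order_refl)
  also have "\<dots> \<le> \<bar>p * r\<bar> * norm (f t) + \<bar>r\<^sup>2 + s\<^sup>2\<bar> * norm (f t)"
    by (intro add_mono mult_left_mono Finite_Cartesian_Product.norm_nth_le) auto
  finally have 2: "norm (ham_app H f t $ 2) \<le> (\<bar>p * r\<bar> + \<bar>r\<^sup>2 + s\<^sup>2\<bar>) * norm (f t)" by (simp add: algebra_simps)
  have "norm (J_ham_app H f t) \<le> ((\<bar>p\<^sup>2\<bar> + \<bar>p * r\<bar>) + (\<bar>p * r\<bar> + \<bar>r\<^sup>2 + s\<^sup>2\<bar>)) * norm (f t)"
    using norm_vec2_le[of "J_ham_app H f t"] 1 2 by (simp add: J_ham_app_nth distrib_right)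
  also have "\<dots> \<le> (2 * (p\<^sup>2 + (r\<^sup>2 + s\<^sup>2))) * norm (f t)"
    using h3 by (intro mult_right_mono) auto
  finally show ?thesis unfolding prs .
qed

lemma ham_form_cnj: "ham_form H f g t = cnj (ham_form H g f t)"
proof -
  obtain p r s where "\<And>f g. ham_form H f g t = cnj (row p r (f t)) * (row p r (g t))
       + cnj (of_real s * f t $ 2) * (of_real s * g t $ 2)"
    by (rule energy_factor) blast
  then show ?thesis by (simp only: complex_cnj_add complex_cnj_mult complex_cnj_cnj mult.commute)
qed

lemma ham_form_eq_if_ham_app_eq:
  assumes "ham_app H f t = ham_app H g t"
  shows "ham_form H f f t = ham_form H g g t"
proof -
  have "ham_form H f f t = ham_form H f g t" using assms by (simp add: ham_form_expand)
  also have "\<dots> = cnj (ham_form H g f t)" by (rule ham_form_cnj)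
  also have "\<dots> = cnj (ham_form H g g t)" using assms by (simp add: ham_form_expand)
  also have "\<dots> = ham_form H g g t" by (rule ham_form_cnj[symmetric])
  finally show ?thesis .
qed

end

section \<open>The integral operator on one half-interval\<close>

lemma borel_measurable_ham_app:
  assumes "H \<in> borel_measurable M" "f \<in> borel_measurable M"
  shows "(\<lambda>t. ham_app H f t $ 1) \<in> borel_measurable M" "(\<lambda>t. ham_app H f t $ 2) \<in> borel_measurable M"
proof -
  have [measurable]: "(\<lambda>t. H t $ i $ j) \<in> borel_measurable M" for i j
    by (rule borel_measurable_matrix_nth[OF assms(1)])
  have [measurable]: "(\<lambda>t. f t $ 1) \<in> borel_measurable M" "(\<lambda>t. f t $ 2) \<in> borel_measurable M"
    using assms(2) by (auto simp: borel_measurable_vec2_iff)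
  show "(\<lambda>t. ham_app H f t $ 1) \<in> borel_measurable M" "(\<lambda>t. ham_app H f t $ 2) \<in> borel_measurable M"
    unfolding ham_app_nth by measurable
qed

lemma borel_measurable_J_ham_app:
  assumes "H \<in> borel_measurable M" "f \<in> borel_measurable M"
  shows "J_ham_app H f \<in> borel_measurable M"
  unfolding borel_measurable_vec2_iff J_ham_app_nth
  using borel_measurable_ham_app[OF assms] by simp

lemma borel_measurable_ham_form:
  assumes "H \<in> borel_measurable M" "f \<in> borel_measurable M" "g \<in> borel_measurable M"
  shows "ham_form H f g \<in> borel_measurable M"
proof -
  have "(\<lambda>t. f t $ 1) \<in> borel_measurable M" "(\<lambda>t. f t $ 2) \<in> borel_measurable M"
    using assms(2) by (auto simp: borel_measurable_vec2_iff)
  then have "(\<lambda>t. cnj (f t $ 1)) \<in> borel_measurable M" "(\<lambda>t. cnj (f t $ 2)) \<in> borel_measurable M"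
    by (auto intro: borel_measurable_continuous_on[OF continuous_on_cnj[OF continuous_on_id]])
  then have "(\<lambda>t. ham_form H f g t) \<in> borel_measurable M"
    unfolding ham_form_expand using borel_measurable_ham_app[OF assms(1,3)]
    by (intro borel_measurable_add borel_measurable_times)
  then show ?thesis by simp
qed

lemma J_ham_app_fun_linear:
  "J_ham_app H (\<lambda>t. f t + g t) = (\<lambda>t. J_ham_app H f t + J_ham_app H g t)"
  "J_ham_app H (\<lambda>t. c *s f t) = (\<lambda>t. c *s J_ham_app H f t)"
  by (simp_all add: fun_eq_iff J_ham_app_linear)

lemma J_ham_app_zero: "J_ham_app H (\<lambda>_. 0) = (\<lambda>_. 0)"
  by (simp add: fun_eq_iff vec2_eq_iff J_ham_app_nth ham_app_nth)

text \<open>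
  One half-interval $(a,b)$ with a regular and a singular endpoint. The set \<open>S t\<close> is the part between
  the regular endpoint and \<open>t\<close>, the filter \<open>E\<close> describes the approach to the regular endpoint, and
  \<open>eps\<close> is the sign that makes $\mathcal I f$ an antiderivative of $JHf$. The case of a left
  half-interval and that of a right one are the two alternatives of \<open>side\<close>; only the basic lemmas
  distinguish them.
\<close>

locale half_ham =
  fixes a b :: real and H :: "real \<Rightarrow> real^2^2" and S :: "real \<Rightarrow> real set" and eps :: real
    and Iop :: "(real \<Rightarrow> complex^2) \<Rightarrow> real \<Rightarrow> complex^2" and E :: "real filter"
  assumes ab: "a < b" and ham: "hamiltonian a b H"
    and side: "S = (\<lambda>t. {a<..<t}) \<and> eps = 1 \<and> E = at_right a \<or> S = (\<lambda>t. {t<..<b}) \<and> eps = -1 \<and> E = at_left b"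
    and Iop_def: "\<And>f t. Iop f t = eps *\<^sub>R (LINT s|lebesgue_on (S t). J_ham_app H f s)"
    and int_H: "\<And>t. a < t \<Longrightarrow> t < b \<Longrightarrow> integrable (lebesgue_on (S t)) H"
    and not_int_H: "\<not> integrable (lebesgue_on {a<..<b}) H"
    and int_h1: "integrable (lebesgue_on {a<..<b}) (\<lambda>t. H t $ 1 $ 1)"
    and HS: "integrable (lebesgue_on {a<..<b}) (\<lambda>t. (LINT s|lebesgue_on (S t). H s $ 2 $ 2) * H t $ 1 $ 1)"
begin

abbreviation M :: "real measure" where "M \<equiv> lebesgue_on {a<..<b}"

lemma H_meas: "H \<in> borel_measurable M"
  using ham by (simp add: hamiltonian_def)

lemma psd_AE: "AE t in M. positive_semidefinite (H t)"
  using ham by (simp add: hamiltonian_def)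

lemma S_sets: "S t \<in> sets lebesgue"
  using side by auto

lemma S_subset: "a < t \<Longrightarrow> t < b \<Longrightarrow> S t \<subseteq> {a<..<b}"
  using side by auto

lemma S_mono: "a < t \<Longrightarrow> t < b \<Longrightarrow> s \<in> S t \<Longrightarrow> S s \<subseteq> S t"
  using side by auto

lemma interval_subset_S:
  assumes "a < s" "s \<le> t" "t < b"
  obtains u where "a < u" "u < b" "{s..t} \<subseteq> S u"
proof -
  have "{s..t} \<subseteq> S ((t + b) / 2) \<or> {s..t} \<subseteq> S ((a + s) / 2)" using side assms by auto
  then show thesis using that[of "(t + b) / 2"] that[of "(a + s) / 2"] assms by auto
qed

lemma E_nontrivial: "E \<noteq> bot"
  using side trivial_limit_at_right_real[of a] trivial_limit_at_left_real[of b] by (elim disjE conjE) simp_all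

lemma eventually_E:
  assumes "a < t" "t < b"
  shows "\<forall>\<^sub>F s in E. a < s \<and> s < b \<and> s \<in> S t"
  using side
proof (elim disjE conjE)
  assume "S = (\<lambda>t. {a<..<t})" "E = at_right a"
  with assms show ?thesis by (auto simp: eventually_at_right[OF ab] intro!: exI[of _ t])
next
  assume "S = (\<lambda>t. {t<..<b})" "E = at_left b"
  with assms show ?thesis by (auto simp: eventually_at_left[OF ab] intro!: exI[of _ t])
qed

lemma eventually_E_in: "\<forall>\<^sub>F s in E. a < s \<and> s < b"
  using eventually_E[of "(a + b) / 2"] ab by (auto elim!: eventually_mono)

lemma meas_S: "f \<in> borel_measurable M \<Longrightarrow> a < t \<Longrightarrow> t < b \<Longrightarrow> f \<in> borel_measurable (lebesgue_on (S t))"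
  by (rule measurable_restrict_mono[OF _ S_subset])

lemma AE_S: "AE t in M. P t \<Longrightarrow> a < t \<Longrightarrow> t < b \<Longrightarrow> AE s in lebesgue_on (S t). P s"
  by (rule AE_lebesgue_on_subset[OF _ S_subset]) (auto simp: S_sets)

text \<open>
  The functions to which $\mathcal I$ can be applied. All functions in $L^2(H)$ and all iterates of
  $\mathcal I$ on constants are of this kind.
\<close>

definition adm :: "(real \<Rightarrow> complex^2) \<Rightarrow> bool" where
  "adm f \<longleftrightarrow> (\<forall>t. a < t \<and> t < b \<longrightarrow> integrable (lebesgue_on (S t)) (J_ham_app H f))"

lemma adm_S: "adm f \<Longrightarrow> a < t \<Longrightarrow> t < b \<Longrightarrow> integrable (lebesgue_on (S t)) (J_ham_app H f)"
  by (simp add: adm_def)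

lemma adm_interval:
  assumes "adm f" "a < s" "s \<le> t" "t < b"
  shows "integrable (lebesgue_on {s..t}) (J_ham_app H f)"
proof -
  obtain u where u: "a < u" "u < b" "{s..t} \<subseteq> S u" by (rule interval_subset_S[OF assms(2-)])
  show ?thesis by (rule integrable_lebesgue_on_subset[OF adm_S[OF assms(1) u(1,2)] u(3)]) (auto simp: S_sets)
qed

lemma adm_add: "adm f \<Longrightarrow> adm g \<Longrightarrow> adm (\<lambda>t. f t + g t)"
  by (simp add: adm_def J_ham_app_fun_linear)

lemma integrable_vec_scale:
  assumes "integrable N (f :: real \<Rightarrow> complex^2)" shows "integrable N (\<lambda>t. c *s f t)"
    "(LINT t|N. c *s f t) = c *s (LINT t|N. f t)"
proof -
  have "bounded_linear (\<lambda>x :: complex^2. c *s x)"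
    by (rule bounded_linear_intro[where K="norm c"])
      (auto simp: vec_eq_iff algebra_simps norm_vec_def norm_mult L2_set_right_distrib)
  from integrable_bounded_linear[OF this assms] integral_bounded_linear[OF this assms]
  show "integrable N (\<lambda>t. c *s f t)" "(LINT t|N. c *s f t) = c *s (LINT t|N. f t)" by auto
qed

lemma adm_scale: "adm f \<Longrightarrow> adm (\<lambda>t. c *s f t)"
  by (simp add: adm_def J_ham_app_fun_linear integrable_vec_scale)

lemma adm_sum: "(\<And>i. i \<in> A \<Longrightarrow> adm (f i)) \<Longrightarrow> adm (\<lambda>t. \<Sum>i\<in>A. f i t)"
proof (induction A rule: infinite_finite_induct)
  case (insert x F)
  then have "adm (\<lambda>t. f x t + (\<Sum>i\<in>F. f i t))" by (intro adm_add) auto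
  then show ?case using insert by simp
qed (simp_all add: adm_def J_ham_app_zero)

lemma Iop_cong:
  assumes "AE s in M. ham_app H f s = ham_app H g s" "f \<in> borel_measurable M" "g \<in> borel_measurable M"
    and t: "a < t" "t < b"
  shows "Iop f t = Iop g t"
proof -
  have "(LINT s|lebesgue_on (S t). J_ham_app H f s) = (LINT s|lebesgue_on (S t). J_ham_app H g s)"
  proof (rule integral_cong_AE)
    show "AE s in lebesgue_on (S t). J_ham_app H f s = J_ham_app H g s"
      using AE_S[OF assms(1) t] by (simp add: J_ham_app_eq_iff)
  qed (use assms t in \<open>auto intro!: meas_S borel_measurable_J_ham_app H_meas\<close>)
  then show ?thesis by (simp add: Iop_def)
qed

lemma Iop_cong_pointwise:
  assumes "\<And>s. a < s \<Longrightarrow> s < b \<Longrightarrow> f s = g s" "a < t" "t < b"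
  shows "Iop f t = Iop g t"
  unfolding Iop_def
  by (rule arg_cong[where f="\<lambda>x. eps *\<^sub>R x"], rule Bochner_Integration.integral_cong[OF refl])
    (use S_subset[OF assms(2,3)] assms(1) in \<open>auto simp: J_ham_app_def ham_app_def\<close>)

lemma Iop_add:
  assumes "adm f" "adm g" "a < t" "t < b"
  shows "Iop (\<lambda>t. f t + g t) t = Iop f t + Iop g t"
  unfolding Iop_def J_ham_app_linear
  using assms by (simp add: adm_S scaleR_right_distrib)

lemma Iop_scale:
  assumes "adm f" "a < t" "t < b"
  shows "Iop (\<lambda>t. c *s f t) t = c *s Iop f t"
  unfolding Iop_def J_ham_app_linear
  using assms by (simp add: adm_S integrable_vec_scale) (simp add: vec_eq_iff)

text \<open>
  The boundary point \<open>t\<close> of the open set \<open>S t\<close> has measure zero, so the integrals over \<open>S s\<close> and \<open>S t\<close>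
  differ by the one over the closed interval; the sign \<open>eps\<close> makes this true on both sides.
\<close>

lemma Iop_diff:
  assumes f: "adm f" and st: "a < s" "s \<le> t" "t < b"
  shows "Iop f t - Iop f s = (LINT x|lebesgue_on {s..t}. J_ham_app H f x)"
proof -
  let ?g = "J_ham_app H f"
  have st': "a < t" "s < b" using st by auto
  have eqI: "(LINT x|lebesgue_on (S u). ?g x) = integral (S u) ?g" "?g integrable_on S u" if "a < u" "u < b" for u
    using adm_S[OF f that] by (auto intro: lebesgue_integral_eq_integral integrable_on_lebesgue_on simp: S_sets)
  have eqst: "(LINT x|lebesgue_on {s..t}. ?g x) = integral {s..t} ?g"
    using adm_interval[OF f st] by (intro lebesgue_integral_eq_integral) auto
  from side show ?thesis
  proof
    assume l: "S = (\<lambda>t. {a<..<t}) \<and> eps = 1 \<and> E = at_right a"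
    have "?g integrable_on {a..t}" using eqI(2)[of t] l st' st by (simp add: integrable_on_Icc_iff_Ioo)
    then have "integral {a..s} ?g + integral {s..t} ?g = integral {a..t} ?g"
      using st by (intro Henstock_Kurzweil_Integration.integral_combine) auto
    then show ?thesis
      using l eqI(1)[of s] eqI(1)[of t] eqst st st' by (simp add: Iop_def integral_open_interval_real algebra_simps)
  next
    assume r: "S = (\<lambda>t. {t<..<b}) \<and> eps = - 1 \<and> E = at_left b"
    have "?g integrable_on {s..b}" using eqI(2)[of s] r st' st by (simp add: integrable_on_Icc_iff_Ioo)
    then have "integral {s..t} ?g + integral {t..b} ?g = integral {s..b} ?g"
      using st by (intro Henstock_Kurzweil_Integration.integral_combine) auto
    then show ?thesis
      using r eqI(1)[of s] eqI(1)[of t] eqst st st' by (simp add: Iop_def integral_open_interval_real algebra_simps)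
  qed
qed

lemma norm_Iop_le:
  assumes f: "adm f" and t: "a < t" "t < b" and s: "s \<in> S t \<or> s = t"
  shows "norm (Iop f s) \<le> (LINT x|lebesgue_on (S t). indicator (S s) x * norm (J_ham_app H f x))"
proof -
  have sub: "S s \<subseteq> S t" using s S_mono[OF t] by auto
  have "norm (Iop f s) = norm (LINT x|lebesgue_on (S s). J_ham_app H f x)"
    using side by (auto simp: Iop_def)
  also have "\<dots> \<le> (LINT x|lebesgue_on (S s). norm (J_ham_app H f x))" by (rule integral_norm_bound)
  also have "\<dots> = (LINT x|lebesgue_on (S t). indicator (S s) x * norm (J_ham_app H f x))"
    using sub by (simp add: integral_restrict_space S_sets)
      (intro Bochner_Integration.integral_cong refl, auto simp: indicator_def)
  finally show ?thesis .
qed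

lemma Iop_bounded:
  assumes f: "adm f" and t: "a < t" "t < b" and s: "s \<in> S t"
  shows "norm (Iop f s) \<le> (LINT x|lebesgue_on (S t). norm (J_ham_app H f x))"
proof -
  have int: "integrable (lebesgue_on (S t)) (\<lambda>x. norm (J_ham_app H f x))"
    using adm_S[OF f t] by simp
  have "norm (Iop f s) \<le> (LINT x|lebesgue_on (S t). indicator (S s) x * norm (J_ham_app H f x))"
    by (rule norm_Iop_le) (use assms in auto)
  also have "\<dots> \<le> (LINT x|lebesgue_on (S t). norm (J_ham_app H f x))"
  proof (rule integral_mono)
    show "integrable (lebesgue_on (S t)) (\<lambda>x. indicator (S s) x * norm (J_ham_app H f x))"
      using S_mono[OF t s]
      by (intro integrable_real_mult_indicator[of _ _ "\<lambda>x. norm (J_ham_app H f x)", simplified mult.commute] int)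
        (auto simp: sets_restrict_space_iff S_sets)
  qed (use int in \<open>auto simp: indicator_def\<close>)
  finally show ?thesis .
qed

lemma Iop_tendsto_0:
  assumes f: "adm f"
  shows "(Iop f \<longlongrightarrow> 0) E"
proof (rule tendstoI)
  fix e :: real assume e: "e > 0"
  define t where "t = (a + b) / 2"
  have t: "a < t" "t < b" using ab by (auto simp: t_def)
  have int: "integrable (lebesgue_on (S t)) (\<lambda>x. norm (J_ham_app H f x))"
    using adm_S[OF f t] by simp
  obtain d where d: "d > 0" and small: "\<And>A. A \<in> sets (lebesgue_on (S t)) \<Longrightarrow> emeasure (lebesgue_on (S t)) A < ennreal d \<Longrightarrow>
      (LINT x|lebesgue_on (S t). indicator A x * norm (J_ham_app H f x)) < e"
    by (rule integrable_small_on_small_sets[OF int norm_ge_zero e]) blast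
  have "\<forall>\<^sub>F s in E. s \<in> S t \<and> emeasure lebesgue (S s) < ennreal d"
  proof -
    define u where "u = (if eps = 1 then min t (a + d / 2) else max t (b - d / 2))"
    have u: "a < u" "u < b" using t d by (auto simp: u_def)
    have *: "s \<in> S t \<and> emeasure lebesgue (S s) < ennreal d" if "s \<in> S u" for s
      using side that d by (auto simp: u_def ennreal_less_iff)
    show ?thesis using eventually_E[OF u] by eventually_elim (use * in auto)
  qed
  then show "\<forall>\<^sub>F s in E. dist (Iop f s) 0 < e"
  proof eventually_elim
    case (elim s)
    have sub: "S s \<subseteq> S t" using elim S_mono[OF t] by auto
    have "norm (Iop f s) \<le> (LINT x|lebesgue_on (S t). indicator (S s) x * norm (J_ham_app H f x))"
      by (rule norm_Iop_le) (use f t elim in auto)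
    also have "\<dots> < e"
      by (rule small) (use sub elim in \<open>auto simp: sets_restrict_space_iff S_sets emeasure_restrict_space\<close>)
    finally show ?case by (simp add: dist_norm)
  qed
qed

text \<open>
  Since all increments of \<open>fh\<close> and of $\mathcal I g$ are the integrals of $JHg$, the two functions
  differ by a constant.
\<close>

lemma ac_rep_iff:
  assumes g: "adm g"
  shows "ac_rep a b H f g fh \<longleftrightarrow>
    (\<exists>v. \<forall>t. a < t \<and> t < b \<longrightarrow> fh t = v + Iop g t) \<and> ham_eq a b H fh f"
proof -
  have "(\<forall>s t. a < s \<and> s \<le> t \<and> t < b \<longrightarrow> fh t - fh s = (LINT x|lebesgue_on {s..t}. J_ham_app H g x)) \<longleftrightarrow>
    (\<exists>v. \<forall>t. a < t \<and> t < b \<longrightarrow> fh t = v + Iop g t)" (is "?l = ?r")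
  proof
    assume l: ?l
    have eq: "fh t - Iop g t = fh s - Iop g s" if "a < s" "s \<le> t" "t < b" for s t
      using l that Iop_diff[OF g that] by (auto simp: algebra_simps)
    define m where "m = (a + b) / 2"
    have m: "a < m" "m < b" using ab by (auto simp: m_def)
    have "fh t = (fh m - Iop g m) + Iop g t" if "a < t" "t < b" for t
      using eq[of m t] eq[of t m] m that by (cases "m \<le> t") (auto simp: algebra_simps)
    then show ?r by blast
  next
    assume ?r
    then obtain v where v: "\<And>t. a < t \<Longrightarrow> t < b \<Longrightarrow> fh t = v + Iop g t" by blast
    show ?l using Iop_diff[OF g] by (auto simp: v)
  qed
  then show ?thesis
    unfolding ac_rep_def
    using locally_absolutely_continuous_derivative_iff[of a b "J_ham_app H g" fh] adm_interval[OF g] by auto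
qed

lemma rep_tendsto:
  assumes "adm g" and "\<And>t. a < t \<Longrightarrow> t < b \<Longrightarrow> fh t = v + Iop g t"
  shows "(fh \<longlongrightarrow> v) E"
proof -
  have "((\<lambda>t. v + Iop g t) \<longlongrightarrow> v + 0) E" by (intro tendsto_intros Iop_tendsto_0 assms)
  then show ?thesis
    unfolding add_0_right
    by (rule Lim_transform_eventually) (use eventually_E_in assms(2) in \<open>auto elim!: eventually_mono\<close>)
qed

lemma Iop_continuous:
  assumes g: "adm g"
  shows "continuous_on {a<..<b} (Iop g)"
proof -
  have "isCont (Iop g) t" if t: "a < t" "t < b" for t
  proof -
    define c where "c = (a + t) / 2"
    define d where "d = (t + b) / 2"
    have cd: "a < c" "c < t" "t < d" "d < b" using t by (auto simp: c_def d_def)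
    have "J_ham_app H g integrable_on {c..d}"
      using adm_interval[OF g, of c d] cd by (intro integrable_on_lebesgue_on) auto
    then have C: "continuous_on {c..d} (\<lambda>x. Iop g c + integral {c..x} (J_ham_app H g))"
      by (intro continuous_intros indefinite_integral_continuous_1)
    have Eq: "Iop g c + integral {c..x} (J_ham_app H g) = Iop g x" if "x \<in> {c..d}" for x
    proof -
      have "integral {c..x} (J_ham_app H g) = (LINT u|lebesgue_on {c..x}. J_ham_app H g u)"
        using adm_interval[OF g, of c x] cd that by (intro lebesgue_integral_eq_integral[symmetric]) auto
      then show ?thesis using Iop_diff[OF g, of c x] cd that by (simp add: algebra_simps)
    qed
    have "continuous_on {c..d} (Iop g)" by (rule continuous_on_eq[OF C Eq])
    then have "continuous_on {c<..<d} (Iop g)" by (rule continuous_on_subset) auto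
    then show ?thesis using cd by (simp add: continuous_on_eq_continuous_at)
  qed
  then show ?thesis by (simp add: continuous_on_eq_continuous_at)
qed

lemma Iop_measurable: "adm g \<Longrightarrow> Iop g \<in> borel_measurable M"
  using continuous_imp_measurable_on_sets_lebesgue[OF Iop_continuous] by simp

lemma H_entries_integrable:
  assumes "a < t" "t < b"
  shows "integrable (lebesgue_on (S t)) (\<lambda>s. H s $ i $ j)"
proof -
  have "bounded_linear (\<lambda>x :: real^2^2. x $ i $ j)"
    by (rule bounded_linear_compose[OF bounded_linear_vec_nth bounded_linear_vec_nth])
  from integrable_bounded_linear[OF this int_H[OF assms]] show ?thesis by simp
qed

text \<open>
  Near the regular endpoint $H$ is integrable, so boundedness there suffices.
\<close>

lemma bounded_adm:
  assumes f: "f \<in> borel_measurable M" and bd: "\<And>t. a < t \<Longrightarrow> t < b \<Longrightarrow> \<exists>B. \<forall>s\<in>S t. norm (f s) \<le> B"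
  shows "adm f"
  unfolding adm_def
proof (intro allI impI; elim conjE)
  fix t assume t: "a < t" "t < b"
  obtain B where B: "\<And>s. s \<in> S t \<Longrightarrow> norm (f s) \<le> B" using bd[OF t] by blast
  show "integrable (lebesgue_on (S t)) (J_ham_app H f)"
  proof (rule Bochner_Integration.integrable_bound)
    show "integrable (lebesgue_on (S t)) (\<lambda>s. 2 * (H s $ 1 $ 1 + H s $ 2 $ 2) * B)"
      using H_entries_integrable[OF t] by (intro integrable_mult_left integrable_mult_right) auto
    show "J_ham_app H f \<in> borel_measurable (lebesgue_on (S t))"
      by (intro meas_S[OF _ t] borel_measurable_J_ham_app H_meas f)
    have "AE s in lebesgue_on (S t). positive_semidefinite (H s)" by (rule AE_S[OF psd_AE t])
    then show "AE s in lebesgue_on (S t). norm (J_ham_app H f s) \<le> norm (2 * (H s $ 1 $ 1 + H s $ 2 $ 2) * B)"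
      using AE_space
    proof eventually_elim
      case (elim s)
      then have "norm (f s) \<le> B" using B by simp
      have "norm (J_ham_app H f s) \<le> 2 * (H s $ 1 $ 1 + H s $ 2 $ 2) * norm (f s)"
        by (rule norm_J_ham_app_le[of H s]) (use elim in simp)
      also have "\<dots> \<le> 2 * (H s $ 1 $ 1 + H s $ 2 $ 2) * B"
        using psd_entries[of "H s"] elim \<open>norm (f s) \<le> B\<close> by (intro mult_left_mono) auto
      finally show ?case by simp
    qed
  qed
qed

lemma adm_const: "adm (\<lambda>_. v)"
  by (rule bounded_adm) auto

lemma adm_Iop: "adm f \<Longrightarrow> adm (Iop f)"
  by (rule bounded_adm) (use Iop_measurable Iop_bounded in blast)+

end

section \<open>Square-integrable functions on one half-interval\<close>

text \<open>
  The component $\xi_\phi^*x$ that occurs in the definition of $L^2(H)$.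
\<close>

definition xi_comp :: "real \<Rightarrow> complex^2 \<Rightarrow> complex" where
  "xi_comp \<phi> x = (\<Sum>i\<in>UNIV. complex_of_real (xi_dir \<phi> $ i) * x $ i)"

lemma xi_comp_eq: "xi_comp \<phi> x = of_real (cos \<phi>) * x $ 1 + of_real (sin \<phi>) * x $ 2"
  by (simp add: xi_comp_def sum_2 xi_dir_def)

lemma xi_comp_linear: "xi_comp \<phi> (x + y) = xi_comp \<phi> x + xi_comp \<phi> y" "xi_comp \<phi> (c *s x) = c * xi_comp \<phi> x"
  "xi_comp \<phi> (x - y) = xi_comp \<phi> x - xi_comp \<phi> y"
  by (simp_all add: xi_comp_eq algebra_simps)

lemma bounded_linear_xi_comp: "bounded_linear (xi_comp \<phi>)"
proof -
  have "bounded_linear (\<lambda>x :: complex^2. of_real (cos \<phi>) * x $ 1 + of_real (sin \<phi>) * x $ 2)"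
    by (intro bounded_linear_add bounded_linear_const_mult bounded_linear_vec_nth)
  then show ?thesis by (simp add: xi_comp_eq[abs_def])
qed

lemma rank_one:
  assumes psd: "positive_semidefinite M" and r: "range (\<lambda>x. M *v x) = span {xi_dir \<phi>}"
  obtains k where "k \<noteq> 0" "M $ 1 $ 1 = k * cos \<phi> * cos \<phi>" "M $ 1 $ 2 = k * cos \<phi> * sin \<phi>"
    "M $ 2 $ 1 = k * cos \<phi> * sin \<phi>" "M $ 2 $ 2 = k * sin \<phi> * sin \<phi>"
proof -
  have "M *v vector [1, 0] \<in> span {xi_dir \<phi>}" "M *v vector [0, 1] \<in> span {xi_dir \<phi>}"
    using r by blast+
  then obtain \<alpha> \<beta> where "M *v vector [1, 0] = \<alpha> *\<^sub>R xi_dir \<phi>" "M *v vector [0, 1] = \<beta> *\<^sub>R xi_dir \<phi>"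
    unfolding span_singleton by blast
  then have e: "M $ 1 $ 1 = \<alpha> * cos \<phi>" "M $ 2 $ 1 = \<alpha> * sin \<phi>" "M $ 1 $ 2 = \<beta> * cos \<phi>" "M $ 2 $ 2 = \<beta> * sin \<phi>"
    by (simp_all add: vec2_eq_iff matrix_vector_mult_def sum_2 xi_dir_def)
  have sym: "\<alpha> * sin \<phi> = \<beta> * cos \<phi>" using psd_entries(1)[OF psd] e by simp
  define k where "k = \<alpha> * cos \<phi> + \<beta> * sin \<phi>"
  have sc: "sin \<phi> * sin \<phi> + cos \<phi> * cos \<phi> = 1" using sin_cos_squared_add[of \<phi>] by (simp add: power2_eq_square)
  have k1: "k * cos \<phi> = \<alpha>"
  proof -
    have "k * cos \<phi> = \<alpha> * (cos \<phi> * cos \<phi>) + sin \<phi> * (\<beta> * cos \<phi>)" by (simp add: k_def algebra_simps)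
    also have "\<dots> = \<alpha> * (sin \<phi> * sin \<phi> + cos \<phi> * cos \<phi>)" unfolding sym[symmetric] by (simp only: algebra_simps)
    finally show ?thesis by (simp only: sc mult_1_right)
  qed
  have k2: "k * sin \<phi> = \<beta>"
  proof -
    have "k * sin \<phi> = cos \<phi> * (\<alpha> * sin \<phi>) + \<beta> * (sin \<phi> * sin \<phi>)" by (simp add: k_def algebra_simps)
    also have "\<dots> = \<beta> * (sin \<phi> * sin \<phi> + cos \<phi> * cos \<phi>)" unfolding sym by (simp only: algebra_simps)
    finally show ?thesis by (simp only: sc mult_1_right)
  qed
  have "k \<noteq> 0"
  proof
    assume "k = 0"
    then have "\<alpha> = 0" "\<beta> = 0" using k1 k2 by auto
    then have "M *v x = 0" for x by (simp add: vec2_eq_iff matrix_vector_mult_def sum_2 e)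
    then have "xi_dir \<phi> \<in> {0}" using r span_base[of "xi_dir \<phi>" "{xi_dir \<phi>}"] by auto
    then have "cos \<phi> = 0" "sin \<phi> = 0" by (simp_all add: vec2_eq_iff xi_dir_def)
    then show False using sc by simp
  qed
  moreover have "M $ 1 $ 1 = k * cos \<phi> * cos \<phi>" "M $ 1 $ 2 = k * cos \<phi> * sin \<phi>"
    "M $ 2 $ 1 = k * cos \<phi> * sin \<phi>" "M $ 2 $ 2 = k * sin \<phi> * sin \<phi>"
    using e sym by (simp_all add: k1[symmetric] k2[symmetric] ac_simps)
  ultimately show thesis by (rule that)
qed

text \<open>
  Here $H(t)$ is a multiple of $\xi_\phi\xi_\phi^*$. Thus $Hf$ determines $\xi_\phi^*f$, and
  $\xi_\phi^*JHf$ vanishes because $\xi_\phi^*J\xi_\phi = 0$.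
\<close>

lemma indivisible_pointwise:
  assumes psd: "positive_semidefinite (H t)" and r: "range (\<lambda>x. H t *v x) = span {xi_dir \<phi>}"
  shows "ham_app H f t = ham_app H g t \<Longrightarrow> xi_comp \<phi> (f t) = xi_comp \<phi> (g t)"
    and "xi_comp \<phi> (J_ham_app H f t) = 0"
proof -
  obtain k where k: "k \<noteq> 0" "H t $ 1 $ 1 = k * cos \<phi> * cos \<phi>" "H t $ 1 $ 2 = k * cos \<phi> * sin \<phi>"
    "H t $ 2 $ 1 = k * cos \<phi> * sin \<phi>" "H t $ 2 $ 2 = k * sin \<phi> * sin \<phi>"
    by (rule rank_one[OF psd r])
  have 1: "ham_app H f t $ 1 = of_real (k * cos \<phi>) * xi_comp \<phi> (f t)"
      "ham_app H f t $ 2 = of_real (k * sin \<phi>) * xi_comp \<phi> (f t)" for f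
    by (simp_all add: ham_app_nth k xi_comp_eq algebra_simps)
  show "xi_comp \<phi> (J_ham_app H f t) = 0"
    by (simp add: xi_comp_eq J_ham_app_nth 1)
  assume "ham_app H f t = ham_app H g t"
  then have "of_real (k * cos \<phi>) * xi_comp \<phi> (f t) = of_real (k * cos \<phi>) * xi_comp \<phi> (g t)"
    "of_real (k * sin \<phi>) * xi_comp \<phi> (f t) = of_real (k * sin \<phi>) * xi_comp \<phi> (g t)"
    unfolding 1[symmetric] by auto
  moreover have "cos \<phi> \<noteq> 0 \<or> sin \<phi> \<noteq> 0" using sin_zero_abs_cos_one[of \<phi>] by auto
  ultimately show "xi_comp \<phi> (f t) = xi_comp \<phi> (g t)" using k(1) by auto
qed

lemma Cauchy_Schwarz_integral:
  fixes x h e :: "'a \<Rightarrow> real"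
  assumes h: "integrable N h" and e: "integrable N e" and x: "integrable N x"
    and le: "AE t in N. 0 \<le> h t \<and> 0 \<le> e t \<and> 0 \<le> x t \<and> (x t)\<^sup>2 \<le> h t * e t"
  shows "(LINT t|N. x t)\<^sup>2 \<le> (LINT t|N. h t) * (LINT t|N. e t)"
proof -
  have [measurable]: "h \<in> borel_measurable N" "e \<in> borel_measurable N" using h e by auto
  have nx: "0 \<le> (LINT t|N. x t)" "0 \<le> (LINT t|N. h t)" "0 \<le> (LINT t|N. e t)"
    by (intro integral_nonneg_AE; use le in eventually_elim; simp)+
  have "ennreal (LINT t|N. x t) = (\<integral>\<^sup>+t. ennreal (x t) \<partial>N)"
    using x le by (intro nn_integral_eq_integral[symmetric]) auto
  also have "\<dots> \<le> (\<integral>\<^sup>+t. ennreal (sqrt (h t)) * ennreal (sqrt (e t)) \<partial>N)"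
  proof (rule nn_integral_mono_AE)
    show "AE t in N. ennreal (x t) \<le> ennreal (sqrt (h t)) * ennreal (sqrt (e t))"
      using le
    proof eventually_elim
      case (elim t)
      then have "x t \<le> sqrt (h t * e t)" by (intro real_le_rsqrt) auto
      then show ?case using elim by (simp add: real_sqrt_mult ennreal_mult'[symmetric] ennreal_leI)
    qed
  qed
  finally have "ennreal (LINT t|N. x t) ^ 2 \<le> (\<integral>\<^sup>+t. ennreal (sqrt (h t)) * ennreal (sqrt (e t)) \<partial>N)\<^sup>2"
    by (intro power_mono) auto
  also have "\<dots> \<le> (\<integral>\<^sup>+t. ennreal (sqrt (h t)) ^ 2 \<partial>N) * (\<integral>\<^sup>+t. ennreal (sqrt (e t)) ^ 2 \<partial>N)"
    by (rule Cauchy_Schwarz_nn_integral) measurable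
  also have "(\<integral>\<^sup>+t. ennreal (sqrt (h t)) ^ 2 \<partial>N) = (\<integral>\<^sup>+t. ennreal (h t) \<partial>N)"
    by (rule nn_integral_cong_AE) (use le in eventually_elim, simp add: ennreal_power)
  also have "(\<integral>\<^sup>+t. ennreal (sqrt (e t)) ^ 2 \<partial>N) = (\<integral>\<^sup>+t. ennreal (e t) \<partial>N)"
    by (rule nn_integral_cong_AE) (use le in eventually_elim, simp add: ennreal_power)
  also have "(\<integral>\<^sup>+t. ennreal (h t) \<partial>N) = ennreal (LINT t|N. h t)"
    using h le by (intro nn_integral_eq_integral) auto
  also have "(\<integral>\<^sup>+t. ennreal (e t) \<partial>N) = ennreal (LINT t|N. e t)"
    using e le by (intro nn_integral_eq_integral) auto
  finally have "ennreal ((LINT t|N. x t)\<^sup>2) \<le> ennreal ((LINT t|N. h t) * (LINT t|N. e t))"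
    using nx by (simp add: ennreal_power ennreal_mult)
  then show ?thesis using nx by (simp add: ennreal_le_iff)
qed

context half_ham
begin

lemma L2_iff:
  "f \<in> L2 a b H \<longleftrightarrow> f \<in> borel_measurable M \<and> integrable M (energy H f) \<and>
    (\<forall>c d \<phi>. a \<le> c \<and> d \<le> b \<and> indivisible_of_type H \<phi> c d \<longrightarrow>
       (\<exists>z. AE t in lebesgue_on {c<..<d}. xi_comp \<phi> (f t) = z))"
proof -
  have "integrable M (ham_form H f f) \<longleftrightarrow> integrable M (energy H f)" if f: "f \<in> borel_measurable M"
  proof
    assume "integrable M (ham_form H f f)"
    then show "integrable M (energy H f)" unfolding energy_def[abs_def] by (rule integrable_Re)
  next
    assume "integrable M (energy H f)"
    then have "integrable M (\<lambda>t. complex_of_real (energy H f t))" by simp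
    then show "integrable M (ham_form H f f)"
      by (rule integrable_cong_AE_imp)
        (use psd_AE borel_measurable_ham_form[OF H_meas f f] in \<open>auto elim!: eventually_mono simp: ham_form_self\<close>)
  qed
  then show ?thesis unfolding L2_def xi_comp_def[symmetric] by auto
qed

lemma L2_meas: "f \<in> L2 a b H \<Longrightarrow> f \<in> borel_measurable M"
  and L2_energy: "f \<in> L2 a b H \<Longrightarrow> integrable M (energy H f)"
  by (simp_all add: L2_iff)

lemma L2_indivisible:
  assumes "f \<in> L2 a b H" "a \<le> c" "d \<le> b" "indivisible_of_type H \<phi> c d"
  shows "\<exists>z. AE t in lebesgue_on {c<..<d}. xi_comp \<phi> (f t) = z"
  using assms(1)[unfolded L2_iff, THEN conjunct2, THEN conjunct2, THEN spec, THEN spec, THEN spec, THEN mp, of c d \<phi>] assms(2-) by simp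

lemma energy_meas: "f \<in> borel_measurable M \<Longrightarrow> energy H f \<in> borel_measurable M"
  unfolding energy_def[abs_def] using borel_measurable_ham_form[OF H_meas, of f f] by (simp add: borel_measurable_complex_iff)

lemma energy_nonneg_AE: "AE t in M. 0 \<le> energy H f t"
  using psd_AE by eventually_elim (rule energy_nonneg)

lemma L2_adm:
  assumes f: "f \<in> L2 a b H"
  shows "adm f"
  unfolding adm_def
proof (intro allI impI; elim conjE)
  fix t assume t: "a < t" "t < b"
  show "integrable (lebesgue_on (S t)) (J_ham_app H f)"
  proof (rule Bochner_Integration.integrable_bound)
    show "integrable (lebesgue_on (S t)) (\<lambda>s. H s $ 1 $ 1 + H s $ 2 $ 2 + energy H f s)"
      using H_entries_integrable[OF t] integrable_lebesgue_on_subset[OF L2_energy[OF f] S_subset[OF t]]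
      by (intro Bochner_Integration.integrable_add) (auto simp: S_sets)
    show "J_ham_app H f \<in> borel_measurable (lebesgue_on (S t))"
      by (intro meas_S[OF _ t] borel_measurable_J_ham_app H_meas L2_meas f)
    have "AE s in lebesgue_on (S t). positive_semidefinite (H s)" by (rule AE_S[OF psd_AE t])
    then show "AE s in lebesgue_on (S t). norm (J_ham_app H f s) \<le> norm (H s $ 1 $ 1 + H s $ 2 $ 2 + energy H f s)"
    proof eventually_elim
      case (elim s)
      show ?case using norm_J_ham_app_le_energy[of H s f, OF elim] unfolding real_norm_def by linarith
    qed
  qed
qed

lemma indivisible_AE:
  assumes "a \<le> c" "d \<le> b" "indivisible_of_type H \<phi> c d"
  shows "AE t in lebesgue_on {c<..<d}. positive_semidefinite (H t) \<and> range (\<lambda>x. H t *v x) = span {xi_dir \<phi>}"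
proof -
  have "AE t in lebesgue_on {c<..<d}. positive_semidefinite (H t)"
    by (rule AE_lebesgue_on_subset[OF psd_AE]) (use assms in auto)
  moreover have "AE t in lebesgue_on {c<..<d}. range (\<lambda>x. H t *v x) = span {xi_dir \<phi>}"
    using assms(3) by (simp add: indivisible_of_type_def)
  ultimately show ?thesis by eventually_elim simp
qed

text \<open>
  The set \<open>L2 a b H\<close> consists of representatives; on indivisible intervals the required component of
  a function depends only on its class.
\<close>

lemma L2_cong:
  assumes f: "f \<in> L2 a b H" and eq: "ham_eq a b H f g" and g: "g \<in> borel_measurable M"
  shows "g \<in> L2 a b H"
  unfolding L2_iff
proof (intro conjI allI impI; (elim conjE)?)
  have "AE t in M. energy H f t = energy H g t"
    using psd_AE eq[unfolded ham_eq_def]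
  proof eventually_elim
    case (elim t)
    show ?case unfolding energy_def using ham_form_eq_if_ham_app_eq[of H t f g, OF elim] by (rule arg_cong)
  qed
  then show "integrable M (energy H g)"
    by (rule integrable_cong_AE_imp[OF L2_energy[OF f] energy_meas[OF g]])
  fix c d \<phi> assume cd: "a \<le> c" "d \<le> b" "indivisible_of_type H \<phi> c d"
  from L2_indivisible[OF f cd] obtain z where z: "AE t in lebesgue_on {c<..<d}. xi_comp \<phi> (f t) = z" ..
  have "AE t in lebesgue_on {c<..<d}. ham_app H f t = ham_app H g t"
    by (rule AE_lebesgue_on_subset[OF eq[unfolded ham_eq_def]]) (use cd in auto)
  with z indivisible_AE[OF cd] have "AE t in lebesgue_on {c<..<d}. xi_comp \<phi> (g t) = z"
  proof eventually_elim
    case (elim t)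
    show ?case using indivisible_pointwise(1)[of H t \<phi> f g] elim by simp
  qed
  then show "\<exists>z. AE t in lebesgue_on {c<..<d}. xi_comp \<phi> (g t) = z" by (rule exI)
qed (rule g)

lemma L2_add:
  assumes f: "f \<in> L2 a b H" and g: "g \<in> L2 a b H"
  shows "(\<lambda>t. f t + g t) \<in> L2 a b H"
  unfolding L2_iff
proof (intro conjI allI impI; (elim conjE)?)
  show m: "(\<lambda>t. f t + g t) \<in> borel_measurable M" using L2_meas[OF f] L2_meas[OF g] by simp
  show "integrable M (energy H (\<lambda>t. f t + g t))"
  proof (rule Bochner_Integration.integrable_bound)
    show "integrable M (\<lambda>t. 2 * (energy H f t + energy H g t))" using L2_energy[OF f] L2_energy[OF g] by simp
    show "AE t in M. norm (energy H (\<lambda>t. f t + g t) t) \<le> norm (2 * (energy H f t + energy H g t))"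
      using psd_AE
    proof eventually_elim
      case (elim t)
      show ?case using energy_add_le[of H t f g, OF elim] energy_nonneg[of H t "\<lambda>t. f t + g t", OF elim] by simp
    qed
  qed (rule energy_meas[OF m])
  fix c d \<phi> assume cd: "a \<le> c" "d \<le> b" "indivisible_of_type H \<phi> c d"
  from L2_indivisible[OF f cd] obtain z where z: "AE t in lebesgue_on {c<..<d}. xi_comp \<phi> (f t) = z" ..
  from L2_indivisible[OF g cd] obtain z' where z': "AE t in lebesgue_on {c<..<d}. xi_comp \<phi> (g t) = z'" ..
  from z z' have "AE t in lebesgue_on {c<..<d}. xi_comp \<phi> (f t + g t) = z + z'"
    by eventually_elim (simp add: xi_comp_linear)
  then show "\<exists>z. AE t in lebesgue_on {c<..<d}. xi_comp \<phi> (f t + g t) = z" by (rule exI)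
qed

lemma L2_scale:
  assumes f: "f \<in> L2 a b H"
  shows "(\<lambda>t. k *s f t) \<in> L2 a b H"
  unfolding L2_iff
proof (intro conjI allI impI; (elim conjE)?)
  show m: "(\<lambda>t. k *s f t) \<in> borel_measurable M"
    using L2_meas[OF f] by (auto simp: borel_measurable_vec2_iff)
  have "energy H (\<lambda>t. k *s f t) t = (norm k)\<^sup>2 * energy H f t" for t
  proof -
    have "ham_form H (\<lambda>t. k *s f t) (\<lambda>t. k *s f t) t = of_real ((norm k)\<^sup>2) * ham_form H f f t"
      unfolding complex_norm_square by (simp add: ham_form_expand ham_app_linear algebra_simps)
    then show ?thesis by (simp add: energy_def)
  qed
  then have "energy H (\<lambda>t. k *s f t) = (\<lambda>t. (norm k)\<^sup>2 * energy H f t)" by (rule ext)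
  then show "integrable M (energy H (\<lambda>t. k *s f t))" using L2_energy[OF f] by simp
  fix c d \<phi> assume cd: "a \<le> c" "d \<le> b" "indivisible_of_type H \<phi> c d"
  from L2_indivisible[OF f cd] obtain z where z: "AE t in lebesgue_on {c<..<d}. xi_comp \<phi> (f t) = z" ..
  then have "AE t in lebesgue_on {c<..<d}. xi_comp \<phi> (k *s f t) = k * z"
    by eventually_elim (simp add: xi_comp_linear)
  then show "\<exists>z. AE t in lebesgue_on {c<..<d}. xi_comp \<phi> (k *s f t) = z" by (rule exI)
qed

lemma L2_diff: "f \<in> L2 a b H \<Longrightarrow> g \<in> L2 a b H \<Longrightarrow> (\<lambda>t. f t - g t) \<in> L2 a b H"
  using L2_add[of f "\<lambda>t. (- 1) *s g t"] L2_scale[of g "- 1"] by (simp add: vector_sneg_minus1[symmetric])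

lemma L2_const_1: "(\<lambda>_. vector [x, 0]) \<in> L2 a b H"
proof -
  have "energy H (\<lambda>_. vector [x, 0]) t = (norm x)\<^sup>2 * H t $ 1 $ 1" for t
  proof -
    have "ham_form H (\<lambda>_. vector [x, 0]) (\<lambda>_. vector [x, 0]) t = of_real ((norm x)\<^sup>2 * H t $ 1 $ 1)"
      unfolding of_real_mult complex_norm_square by (simp add: ham_form_expand ham_app_nth)
    then show ?thesis by (simp only: energy_def Re_complex_of_real)
  qed
  then have "energy H (\<lambda>_. vector [x, 0]) = (\<lambda>t. (norm x)\<^sup>2 * H t $ 1 $ 1)" by (rule ext)
  then have "integrable M (energy H (\<lambda>_. vector [x, 0]))" using int_h1 by simp
  then show ?thesis by (auto simp: L2_iff)
qed

lemma L2_zero: "(\<lambda>_. 0) \<in> L2 a b H"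
proof -
  have "vector [0, 0] = (0 :: complex^2)" by (simp add: vec2_eq_iff)
  then show ?thesis using L2_const_1[of 0] by simp
qed
text \<open>
  If a nonzero constant $(0,y)^T$ were square integrable, then $h_2$, and together with $h_1$ the
  whole of $H$, would be integrable up to the singular endpoint.
\<close>

lemma L2_const_2:
  assumes "(\<lambda>_. vector [0, y]) \<in> L2 a b H"
  shows "y = 0"
proof (rule ccontr)
  assume y: "y \<noteq> 0"
  have "energy H (\<lambda>_. vector [0, y]) t = (norm y)\<^sup>2 * H t $ 2 $ 2" for t
  proof -
    have "ham_form H (\<lambda>_. vector [0, y]) (\<lambda>_. vector [0, y]) t = of_real ((norm y)\<^sup>2 * H t $ 2 $ 2)"
      unfolding of_real_mult complex_norm_square by (simp add: ham_form_expand ham_app_nth)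
    then show ?thesis by (simp only: energy_def Re_complex_of_real)
  qed
  then have "energy H (\<lambda>_. vector [0, y]) = (\<lambda>t. (norm y)\<^sup>2 * H t $ 2 $ 2)" by (rule ext)
  then have "integrable M (\<lambda>t. (norm y)\<^sup>2 * H t $ 2 $ 2)" using L2_energy[OF assms] by simp
  then have h2: "integrable M (\<lambda>t. H t $ 2 $ 2)" using y by simp
  have "integrable M H"
  proof (rule Bochner_Integration.integrable_bound)
    show "integrable M (\<lambda>t. 4 * (H t $ 1 $ 1 + H t $ 2 $ 2))" using h2 int_h1 by simp
    show "AE t in M. norm (H t) \<le> norm (4 * (H t $ 1 $ 1 + H t $ 2 $ 2))"
      using psd_AE
    proof eventually_elim
      case (elim t)
      obtain p r s where prs: "H t $ 1 $ 1 = p\<^sup>2" "H t $ 1 $ 2 = p * r" "H t $ 2 $ 1 = p * r" "H t $ 2 $ 2 = r\<^sup>2 + s\<^sup>2"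
        by (rule psd_factor[OF elim])
      have aux: "2 * x \<le> y \<Longrightarrow> 0 \<le> z \<Longrightarrow> 0 \<le> y \<Longrightarrow> x \<le> y + z" for x y z :: real by simp
      have h3: "\<bar>p * r\<bar> \<le> (p\<^sup>2 + r\<^sup>2) + s\<^sup>2" unfolding abs_mult
        by (rule aux) (use two_mult_le_squares[of "\<bar>p\<bar>" "\<bar>r\<bar>"] in simp_all)
      have nv: "norm (x :: real^2) \<le> \<bar>x $ 1\<bar> + \<bar>x $ 2\<bar>" for x
        using norm_le_l1_cart[of x] by (simp add: sum_2)
      have "norm (H t) \<le> norm (H t $ 1) + norm (H t $ 2)"
        unfolding norm_vec_def using L2_set_le_sum[of UNIV "\<lambda>i. L2_set (\<lambda>j. norm (H t $ i $ j)) UNIV"]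
        by (simp add: sum_2 norm_vec_def)
      also have "\<dots> \<le> \<bar>H t $ 1 $ 1\<bar> + \<bar>H t $ 1 $ 2\<bar> + (\<bar>H t $ 2 $ 1\<bar> + \<bar>H t $ 2 $ 2\<bar>)"
        by (intro add_mono nv)
      also have "\<dots> \<le> 4 * (p\<^sup>2 + (r\<^sup>2 + s\<^sup>2))" using h3 unfolding prs by simp
      finally show ?case by (simp add: prs)
    qed
  qed (rule H_meas)
  then show False using not_int_H by contradiction
qed

lemma xi_comp_Iop_const:
  assumes f: "adm f" and cd: "a \<le> c" "d \<le> b" "indivisible_of_type H \<phi> c d"
  shows "\<exists>z. \<forall>t\<in>{c<..<d}. xi_comp \<phi> (Iop f t) = z"
proof -
  have eq: "xi_comp \<phi> (Iop f t) = xi_comp \<phi> (Iop f s)" if st: "c < s" "s \<le> t" "t < d" for s t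
  proof -
    have st': "a < s" "s \<le> t" "t < b" using st cd by auto
    have "xi_comp \<phi> (Iop f t) - xi_comp \<phi> (Iop f s) = xi_comp \<phi> (LINT x|lebesgue_on {s..t}. J_ham_app H f x)"
      using Iop_diff[OF f st'] by (simp add: xi_comp_linear[symmetric])
    also have "\<dots> = (LINT x|lebesgue_on {s..t}. xi_comp \<phi> (J_ham_app H f x))"
      by (rule integral_bounded_linear[OF bounded_linear_xi_comp adm_interval[OF f st'], symmetric])
    also have "\<dots> = (LINT x|lebesgue_on {s..t}. 0)"
    proof (rule integral_cong_AE)
      show "(\<lambda>x. xi_comp \<phi> (J_ham_app H f x)) \<in> borel_measurable (lebesgue_on {s..t})"
        using integrable_bounded_linear[OF bounded_linear_xi_comp adm_interval[OF f st']] by simp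
      have "AE x in lebesgue_on {s..t}. positive_semidefinite (H x) \<and> range ((*v) (H x)) = span {xi_dir \<phi>}"
        by (rule AE_lebesgue_on_subset[OF indivisible_AE[OF cd]]) (use st in auto)
      then show "AE x in lebesgue_on {s..t}. xi_comp \<phi> (J_ham_app H f x) = 0"
        by eventually_elim (simp add: indivisible_pointwise(2))
    qed simp
    finally show ?thesis by simp
  qed
  have "c < d" using cd by (simp add: indivisible_of_type_def)
  have "xi_comp \<phi> (Iop f t) = xi_comp \<phi> (Iop f ((c + d) / 2))" if "t \<in> {c<..<d}" for t
    using eq[of t "(c + d) / 2"] eq[of "(c + d) / 2" t] that \<open>c < d\<close> by (cases "t \<le> (c + d) / 2") auto
  then show ?thesis by blast
qed

text \<open>
  The condition on indivisible intervals holds for every function $v + \mathcal If$, because the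
  derivative of its component along $\xi_\phi$ vanishes there. So only the integrability has to be
  checked.
\<close>

lemma L2_rep_iff:
  assumes f: "adm f"
  shows "(\<lambda>t. v + Iop f t) \<in> L2 a b H \<longleftrightarrow> integrable M (energy H (\<lambda>t. v + Iop f t))"
proof -
  have "\<exists>z. AE t in lebesgue_on {c<..<d}. xi_comp \<phi> (v + Iop f t) = z"
    if "a \<le> c" "d \<le> b" "indivisible_of_type H \<phi> c d" for c d \<phi>
  proof -
    from xi_comp_Iop_const[OF f that] obtain z where z: "\<forall>t\<in>{c<..<d}. xi_comp \<phi> (Iop f t) = z" ..
    then have "AE t in lebesgue_on {c<..<d}. xi_comp \<phi> (v + Iop f t) = xi_comp \<phi> v + z"
      by (intro AE_I2) (simp add: xi_comp_linear)
    then show ?thesis by (rule exI)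
  qed
  then show ?thesis using Iop_measurable[OF f] by (simp add: L2_iff)
qed

end

section \<open>Keeping the integral operator inside the $L^2$ space\<close>

context half_ham
begin

text \<open>
  Interchanging the order of integration over the pairs $(t,s)$ for which $s$ is not between the
  regular endpoint and $t$. Up to the diagonal these are the pairs for which $t$ is between the
  regular endpoint and $s$.
\<close>

lemma Tonelli_complement:
  fixes p q :: "real \<Rightarrow> ennreal"
  assumes p[measurable]: "p \<in> borel_measurable M" and q[measurable]: "q \<in> borel_measurable M"
  shows "(\<integral>\<^sup>+t. q t * (\<integral>\<^sup>+s. p s * indicator (- S t) s \<partial>M) \<partial>M) = (\<integral>\<^sup>+s. p s * (\<integral>\<^sup>+t. q t * indicator (S s) t \<partial>M) \<partial>M)"
    (is "?l = ?r")
    and "(\<lambda>t. \<integral>\<^sup>+s. p s * indicator (- S t) s \<partial>M) \<in> borel_measurable M"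
proof -
  interpret M: finite_measure M by (rule finite_measure_lebesgue_on) simp
  interpret MM: pair_sigma_finite M M ..
  have id[measurable]: "(\<lambda>x. x) \<in> borel_measurable M"
    by (rule measurable_restrict_space1) (rule measurable_completion, simp)
  have pr: "{x \<in> space (M \<Otimes>\<^sub>M M). snd x \<in> - S (fst x)} \<in> sets (M \<Otimes>\<^sub>M M)"
  proof -
    have [measurable]: "(\<lambda>x. fst x) \<in> borel_measurable (M \<Otimes>\<^sub>M M)" "(\<lambda>x. snd x) \<in> borel_measurable (M \<Otimes>\<^sub>M M)"
      using measurable_compose[OF measurable_fst id] measurable_compose[OF measurable_snd id] by auto
    from side show ?thesis
    proof
      assume "S = (\<lambda>t. {a<..<t}) \<and> eps = 1 \<and> E = at_right a"
      then have "{x \<in> space (M \<Otimes>\<^sub>M M). snd x \<in> - S (fst x)} = {x \<in> space (M \<Otimes>\<^sub>M M). \<not> (a < snd x \<and> snd x < fst x)}" by auto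
      also have "\<dots> \<in> sets (M \<Otimes>\<^sub>M M)" by measurable
      finally show ?thesis .
    next
      assume "S = (\<lambda>t. {t<..<b}) \<and> eps = - 1 \<and> E = at_left b"
      then have "{x \<in> space (M \<Otimes>\<^sub>M M). snd x \<in> - S (fst x)} = {x \<in> space (M \<Otimes>\<^sub>M M). \<not> (fst x < snd x \<and> snd x < b)}" by auto
      also have "\<dots> \<in> sets (M \<Otimes>\<^sub>M M)" by measurable
      finally show ?thesis .
    qed
  qed
  have ind: "(\<lambda>x. indicator (- S (fst x)) (snd x) :: ennreal) \<in> borel_measurable (M \<Otimes>\<^sub>M M)"
  proof -
    have "(\<lambda>x. indicator {x \<in> space (M \<Otimes>\<^sub>M M). snd x \<in> - S (fst x)} x :: ennreal) \<in> borel_measurable (M \<Otimes>\<^sub>M M)"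
      using pr by simp
    then show ?thesis by (rule measurable_cong[THEN iffD1, rotated]) (auto simp: indicator_def)
  qed
  have ps: "(\<lambda>x. p (snd x) * indicator (- S (fst x)) (snd x)) \<in> borel_measurable (M \<Otimes>\<^sub>M M)"
    by (intro borel_measurable_times_ennreal ind) simp
  show meas: "(\<lambda>t. \<integral>\<^sup>+s. p s * indicator (- S t) s \<partial>M) \<in> borel_measurable M"
    using M.borel_measurable_nn_integral_fst[OF ps] by simp
  have inner: "(\<lambda>s. p s * indicator (- S t) s) \<in> borel_measurable M" if "t \<in> space M" for t
    using measurable_Pair2[OF ps that] by simp
  have "?l = (\<integral>\<^sup>+t. (\<integral>\<^sup>+s. q t * (p s * indicator (- S t) s) \<partial>M) \<partial>M)"
    by (intro nn_integral_cong nn_integral_cmult[symmetric] inner)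
  also have "\<dots> = (\<integral>\<^sup>+s. (\<integral>\<^sup>+t. q t * (p s * indicator (- S t) s) \<partial>M) \<partial>M)"
  proof (rule MM.Fubini'[symmetric])
    have "(\<lambda>x. q (fst x) * (p (snd x) * indicator (- S (fst x)) (snd x))) \<in> borel_measurable (M \<Otimes>\<^sub>M M)"
      by (intro borel_measurable_times_ennreal ps) simp
    then show "(\<lambda>(t, s). q t * (p s * indicator (- S t) s)) \<in> borel_measurable (M \<Otimes>\<^sub>M M)"
      by (simp add: case_prod_unfold)
  qed
  also have "\<dots> = ?r"
  proof (rule nn_integral_cong)
    fix s assume s: "s \<in> space M"
    have "{s} \<in> null_sets lebesgue" by (metis negligible_iff_null_sets negligible_sing)
    then have "AE t in lebesgue. t \<noteq> s" by (rule AE_not_in[THEN eventually_mono]) simp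
    then have "AE t in lebesgue. t \<in> {a<..<b} \<longrightarrow> t \<noteq> s" by eventually_elim simp
    \<comment> \<open>Off the diagonal, $s\notin S(t)$ is equivalent to $t\in S(s)$.\<close>
    then have ne: "AE t in M. t \<noteq> s" by (simp add: AE_restrict_space_iff)
    have "(\<integral>\<^sup>+t. q t * (p s * indicator (- S t) s) \<partial>M) = (\<integral>\<^sup>+t. p s * (q t * indicator (S s) t) \<partial>M)"
    proof (rule nn_integral_cong_AE)
      show "AE t in M. q t * (p s * indicator (- S t) s) = p s * (q t * indicator (S s) t)"
        using ne AE_space
      proof eventually_elim
        case (elim t)
        then have "s \<in> - S t \<longleftrightarrow> t \<in> S s" using side s by auto
        then have "(indicator (- S t) s :: ennreal) = indicator (S s) t" by (simp only: indicator_def)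
        then show ?case by (simp only: ac_simps)
      qed
    qed
    also have "\<dots> = p s * (\<integral>\<^sup>+t. q t * indicator (S s) t \<partial>M)"
    proof (rule nn_integral_cmult)
      have "S s \<in> sets M" using s S_subset[of s] by (simp add: sets_restrict_space_iff S_sets)
      then show "(\<lambda>t. q t * indicator (S s) t) \<in> borel_measurable M" by measurable
    qed
    finally show "(\<integral>\<^sup>+t. q t * (p s * indicator (- S t) s) \<partial>M) = p s * (\<integral>\<^sup>+t. q t * indicator (S s) t \<partial>M)" .
  qed
  finally show "?l = ?r" .
qed

lemma integral_split_S:
  fixes \<phi> :: "real \<Rightarrow> complex"
  assumes \<phi>: "integrable M \<phi>" and t: "a < t" "t < b"
  shows "(LINT s|M. \<phi> s) = (LINT s|lebesgue_on (S t). \<phi> s) + (LINT s|lebesgue_on ({a<..<b} - S t). \<phi> s)"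
proof -
  have 1: "integrable lebesgue (\<lambda>s. indicator (S t) s *\<^sub>R \<phi> s)"
    using integrable_lebesgue_on_subset[OF \<phi> S_subset[OF t]] by (simp add: integrable_restrict_space S_sets)
  have D: "{a<..<b} - S t \<in> sets lebesgue" by (intro sets.Diff S_sets) simp
  have 2: "integrable lebesgue (\<lambda>s. indicator ({a<..<b} - S t) s *\<^sub>R \<phi> s)"
    using integrable_lebesgue_on_subset[OF \<phi> _ D] D by (simp add: integrable_restrict_space)
  have "(LINT s|M. \<phi> s) = (LINT s|lebesgue. indicator (S t) s *\<^sub>R \<phi> s + indicator ({a<..<b} - S t) s *\<^sub>R \<phi> s)"
    unfolding integral_restrict_space[of "{a<..<b}" lebesgue, simplified]
    using S_subset[OF t] by (intro Bochner_Integration.integral_cong refl) (auto simp: indicator_def)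
  also have "\<dots> = (LINT s|lebesgue. indicator (S t) s *\<^sub>R \<phi> s) + (LINT s|lebesgue. indicator ({a<..<b} - S t) s *\<^sub>R \<phi> s)"
    by (rule Bochner_Integration.integral_add[OF 1 2])
  finally show ?thesis using D by (simp add: integral_restrict_space S_sets)
qed

text \<open>
  Integrating the pointwise Cauchy--Schwarz inequality: the growth of the $i$-th component of
  $\int Hf$ is controlled by the $i$-th diagonal entry of $H$ alone.
\<close>

lemma ham_app_integral_square_le:
  assumes f: "f \<in> L2 a b H" and A: "A \<subseteq> {a<..<b}" "A \<in> sets lebesgue"
    and int: "integrable (lebesgue_on A) (\<lambda>s. ham_app H f s $ i)" "integrable (lebesgue_on A) (\<lambda>s. H s $ i $ i)"
  shows "(norm (LINT s|lebesgue_on A. ham_app H f s $ i))\<^sup>2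
    \<le> (LINT s|lebesgue_on A. H s $ i $ i) * (LINT s|M. energy H f s)"
proof -
  have i: "i = 1 \<or> i = 2" by (rule exhaust_2)
  have psdA: "AE s in lebesgue_on A. positive_semidefinite (H s)"
    by (rule AE_lebesgue_on_subset[OF psd_AE A]) simp
  have eA: "integrable (lebesgue_on A) (energy H f)"
    by (rule integrable_lebesgue_on_subset[OF L2_energy[OF f] A]) simp
  have "(norm (LINT s|lebesgue_on A. ham_app H f s $ i))\<^sup>2 \<le> (LINT s|lebesgue_on A. norm (ham_app H f s $ i))\<^sup>2"
    by (intro power_mono integral_norm_bound) simp
  also have "\<dots> \<le> (LINT s|lebesgue_on A. H s $ i $ i) * (LINT s|lebesgue_on A. energy H f s)"
  proof (rule Cauchy_Schwarz_integral[OF int(2) eA])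
    show "AE s in lebesgue_on A. 0 \<le> H s $ i $ i \<and> 0 \<le> energy H f s \<and> 0 \<le> norm (ham_app H f s $ i) \<and>
        (norm (ham_app H f s $ i))\<^sup>2 \<le> H s $ i $ i * energy H f s"
      using psdA
    proof eventually_elim
      case (elim s)
      then show ?case using psd_entries[OF elim] energy_nonneg[of H s f] norm_ham_app_square_le[of H s f] i by auto
    qed
  qed (use int(1) in simp)
  also have "\<dots> \<le> (LINT s|lebesgue_on A. H s $ i $ i) * (LINT s|M. energy H f s)"
  proof (rule mult_left_mono)
    have "(LINT s|lebesgue_on A. energy H f s) = (LINT s|M. indicator A s * energy H f s)"
      using A by (simp add: integral_restrict_space)
        (intro Bochner_Integration.integral_cong refl, auto simp: indicator_def)
    also have "\<dots> \<le> (LINT s|M. energy H f s)"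
    proof (rule integral_mono_AE)
      show "integrable M (\<lambda>s. indicator A s * energy H f s)"
        using A integrable_real_mult_indicator[OF _ L2_energy[OF f], of A] by (simp add: mult.commute sets_restrict_space_iff)
      show "AE s in M. indicator A s * energy H f s \<le> energy H f s"
        using energy_nonneg_AE by eventually_elim (auto simp: indicator_def)
    qed (rule L2_energy[OF f])
    finally show "(LINT s|lebesgue_on A. energy H f s) \<le> (LINT s|M. energy H f s)" .
    show "0 \<le> (LINT s|lebesgue_on A. H s $ i $ i)"
      by (rule integral_nonneg_AE) (use psdA in eventually_elim, use i psd_entries in auto)
  qed
  finally show ?thesis .
qed

lemma nn_integral_entry:
  assumes "A \<subseteq> {a<..<b}" "A \<in> sets lebesgue" "integrable (lebesgue_on A) (\<lambda>s. H s $ i $ i)"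
  shows "ennreal (LINT s|lebesgue_on A. H s $ i $ i) = (\<integral>\<^sup>+s. ennreal (H s $ i $ i) * indicator A s \<partial>M)"
proof -
  have i: "i = 1 \<or> i = 2" by (rule exhaust_2)
  have psdA: "AE s in lebesgue_on A. positive_semidefinite (H s)"
    by (rule AE_lebesgue_on_subset[OF psd_AE assms(1,2)]) simp
  have "ennreal (LINT s|lebesgue_on A. H s $ i $ i) = (\<integral>\<^sup>+s. ennreal (H s $ i $ i) \<partial>lebesgue_on A)"
    by (rule nn_integral_eq_integral[symmetric, OF assms(3)]) (use psdA in eventually_elim, use i psd_entries in auto)
  also have "\<dots> = (\<integral>\<^sup>+s. ennreal (H s $ i $ i) * indicator A s \<partial>M)"
    using assms(1,2) by (simp add: nn_integral_restrict_space)
      (intro nn_integral_cong, auto simp: indicator_def)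
  finally show ?thesis .
qed

text \<open>
  Subtracting from $\mathcal If$ the limit of its second component at the singular endpoint leaves
  a function $u$ with $|u_1(t)|^2 \le N\int_{S(t)}h_2$ and $|u_2(t)|^2 \le N\int_{S(t)^c}h_1$, where
  $N$ is the squared norm of $f$. Integrated against $h_1$ and $h_2$, respectively, both bounds give
  the integral that (HS) assumes to be finite, the second one after Tonelli's theorem.
\<close>

lemma regularize:
  assumes f: "f \<in> L2 a b H"
  shows "\<exists>c. (\<lambda>t. Iop f t + vector [0, c]) \<in> L2 a b H"
proof -
  have af: "adm f" by (rule L2_adm[OF f])
  let ?N = "LINT s|M. energy H f s"
  let ?h1 = "\<lambda>t. H t $ 1 $ 1" and ?h2 = "\<lambda>t. H t $ 2 $ 2"
  have N: "0 \<le> ?N" by (rule integral_nonneg_AE[OF energy_nonneg_AE])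
  have i1: "integrable M (\<lambda>s. ham_app H f s $ 1)"
  proof (rule Bochner_Integration.integrable_bound)
    show "integrable M (\<lambda>s. (?h1 s + energy H f s) / 2)" using int_h1 L2_energy[OF f] by simp
    show "AE s in M. norm (ham_app H f s $ 1) \<le> norm ((?h1 s + energy H f s) / 2)"
      using psd_AE
    proof eventually_elim
      case (elim s)
      have "norm (ham_app H f s $ 1) \<le> (?h1 s + energy H f s) / 2"
        by (rule le_half_sum_of_square_le) (use psd_entries[OF elim] energy_nonneg[of H s f] norm_ham_app_square_le[of H s f] elim in auto)
      then show ?case by simp
    qed
  qed (rule borel_measurable_ham_app[OF H_meas L2_meas[OF f]])
  \<comment> \<open>Minus the limit of the second component of $\mathcal If$ at the singular endpoint.\<close>
  define c where "c = - of_real eps * (LINT s|M. ham_app H f s $ 1)"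
  define u where "u = (\<lambda>t. vector [0, c] + Iop f t)"
  have eps: "\<bar>eps\<bar> = 1" using side by auto
  have nth: "Iop f t $ i = of_real eps * (LINT s|lebesgue_on (S t). J_ham_app H f s $ i)"
      and nth_int: "integrable (lebesgue_on (S t)) (\<lambda>s. J_ham_app H f s $ i)" if "a < t" "t < b" for t i
    using integral_bounded_linear[OF bounded_linear_vec_nth[of i] adm_S[OF af that]]
      integrable_bounded_linear[OF bounded_linear_vec_nth[of i] adm_S[OF af that]]
    unfolding Iop_def vector_scaleR_component by (simp_all add: scaleR_conv_of_real)
  define H2 where "H2 t = (LINT s|lebesgue_on (S t). ?h2 s)" for t
  define K1 where "K1 t = (LINT s|lebesgue_on ({a<..<b} - S t). ?h1 s)" for t
  have u1: "(norm (u t $ 1))\<^sup>2 \<le> H2 t * ?N" if t: "a < t" "t < b" for t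
  proof -
    have "integrable (lebesgue_on (S t)) (\<lambda>s. ham_app H f s $ 2)"
      using nth_int[OF t, of 1] by (simp add: J_ham_app_nth)
    from ham_app_integral_square_le[OF f S_subset[OF t] S_sets this H_entries_integrable[OF t]]
    show ?thesis by (simp add: u_def H2_def nth[OF t] J_ham_app_nth norm_mult eps)
  qed
  have Dint: "integrable (lebesgue_on ({a<..<b} - S t)) (\<lambda>s. ?h1 s)" "integrable (lebesgue_on ({a<..<b} - S t)) (\<lambda>s. ham_app H f s $ 1)" for t
    by (rule integrable_lebesgue_on_subset[OF int_h1], auto simp: S_sets,
        rule integrable_lebesgue_on_subset[OF i1], auto simp: S_sets)
  have Dsets: "{a<..<b} - S t \<subseteq> {a<..<b}" "{a<..<b} - S t \<in> sets lebesgue" for t by (auto simp: S_sets)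
  have u2: "(norm (u t $ 2))\<^sup>2 \<le> K1 t * ?N" if t: "a < t" "t < b" for t
  proof -
    have "u t $ 2 = - of_real eps * (LINT s|lebesgue_on ({a<..<b} - S t). ham_app H f s $ 1)"
      unfolding u_def vector_add_component nth[OF t] J_ham_app_nth vector_2 c_def integral_split_S[OF i1 t]
      by (simp add: algebra_simps)
    then show ?thesis using ham_app_integral_square_le[OF f Dsets Dint(2) Dint(1), of t]
      by (simp add: K1_def norm_mult eps)
  qed
  have H2e: "ennreal (H2 t) = (\<integral>\<^sup>+s. ennreal (?h2 s) * indicator (S t) s \<partial>M)" and H20: "0 \<le> H2 t" if t: "a < t" "t < b" for t
    unfolding H2_def
    by (rule nn_integral_entry[OF S_subset[OF t] S_sets H_entries_integrable[OF t]],
        rule integral_nonneg_AE, use AE_S[OF psd_AE t] in eventually_elim, use psd_entries in auto)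
  have K1e: "ennreal (K1 t) = (\<integral>\<^sup>+s. ennreal (?h1 s) * indicator (- S t) s \<partial>M)" for t
    unfolding K1_def nn_integral_entry[OF Dsets Dint(1)]
    by (rule nn_integral_cong) (auto simp: indicator_def)
  have K10: "0 \<le> K1 t" for t
    unfolding K1_def
  proof (rule integral_nonneg_AE)
    have "AE s in lebesgue_on ({a<..<b} - S t). positive_semidefinite (H s)"
      by (rule AE_lebesgue_on_subset[OF psd_AE Dsets]) simp
    then show "AE s in lebesgue_on ({a<..<b} - S t). 0 \<le> ?h1 s" by eventually_elim (rule psd_entries)
  qed
  have um: "u \<in> borel_measurable M" using Iop_measurable[OF af] by (simp add: u_def)
  have hm: "(\<lambda>t. ennreal (?h1 t)) \<in> borel_measurable M" "(\<lambda>t. ennreal (?h2 t)) \<in> borel_measurable M"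
    using borel_measurable_matrix_nth[OF H_meas] by auto
  have "integrable M (energy H u)"
  proof (rule integrableI_bounded[OF energy_meas[OF um]])
    let ?X = "\<lambda>t. ennreal (H2 t * ?h1 t)" and ?Y = "\<lambda>t. ennreal (?h2 t) * (\<integral>\<^sup>+s. ennreal (?h1 s) * indicator (- S t) s \<partial>M)"
    have Xfin: "(\<integral>\<^sup>+t. ?X t \<partial>M) < \<infinity>"
    proof -
      have "(\<integral>\<^sup>+t. ?X t \<partial>M) \<le> (\<integral>\<^sup>+t. ennreal (norm (H2 t * ?h1 t)) \<partial>M)"
        by (intro nn_integral_mono ennreal_leI) simp
      also have "\<dots> < \<infinity>" using HS unfolding H2_def[symmetric] integrable_iff_bounded by simp
      finally show ?thesis .
    qed
    have "(\<integral>\<^sup>+t. ?Y t \<partial>M) = (\<integral>\<^sup>+s. ennreal (?h1 s) * (\<integral>\<^sup>+t. ennreal (?h2 t) * indicator (S s) t \<partial>M) \<partial>M)"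
      by (rule Tonelli_complement(1)[OF hm])
    also have "\<dots> = (\<integral>\<^sup>+t. ?X t \<partial>M)"
      using H2e H20 by (intro nn_integral_cong) (simp add: H2e[symmetric] ennreal_mult' mult.commute)
    finally have Y: "(\<integral>\<^sup>+t. ?Y t \<partial>M) = (\<integral>\<^sup>+t. ?X t \<partial>M)" .
    have "(\<integral>\<^sup>+t. ennreal (norm (energy H u t)) \<partial>M) \<le> (\<integral>\<^sup>+t. ennreal (2 * ?N) * (?X t + ?Y t) \<partial>M)"
    proof (rule nn_integral_mono_AE)
      show "AE t in M. ennreal (norm (energy H u t)) \<le> ennreal (2 * ?N) * (?X t + ?Y t)"
        using psd_AE AE_space
      proof eventually_elim
        case (elim t)
        then have t: "a < t" "t < b" by auto
        note h = psd_entries[OF elim(1)]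
        have "energy H u t \<le> 2 * (?h1 t * (norm (u t $ 1))\<^sup>2 + ?h2 t * (norm (u t $ 2))\<^sup>2)"
          by (rule energy_le_diagonal[of H t u, OF elim(1)])
        also have "\<dots> \<le> 2 * (?h1 t * (H2 t * ?N) + ?h2 t * (K1 t * ?N))"
          using u1[OF t] u2[OF t] h by (intro mult_left_mono add_mono) auto
        also have "\<dots> = 2 * ?N * (H2 t * ?h1 t + ?h2 t * K1 t)" by (simp add: algebra_simps)
        finally have "ennreal (norm (energy H u t)) \<le> ennreal (2 * ?N * (H2 t * ?h1 t + ?h2 t * K1 t))"
          using energy_nonneg[of H t u, OF elim(1)] by (intro ennreal_leI) simp
        also have "\<dots> = ennreal (2 * ?N) * (?X t + ?Y t)"
          using N h H20[OF t] K10 by (simp add: ennreal_mult' ennreal_plus K1e[symmetric])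
        finally show ?case .
      qed
    qed
    also have "\<dots> = ennreal (2 * ?N) * (\<integral>\<^sup>+t. ?X t + ?Y t \<partial>M)"
      using HS unfolding H2_def[symmetric]
      by (intro nn_integral_cmult borel_measurable_add borel_measurable_times_ennreal Tonelli_complement(2)[OF hm] hm) auto
    also have "(\<integral>\<^sup>+t. ?X t + ?Y t \<partial>M) = (\<integral>\<^sup>+t. ?X t \<partial>M) + (\<integral>\<^sup>+t. ?Y t \<partial>M)"
      using HS unfolding H2_def[symmetric]
      by (intro nn_integral_add borel_measurable_times_ennreal Tonelli_complement(2)[OF hm] hm) auto
    also have "ennreal (2 * ?N) * \<dots> < \<infinity>"
      using Xfin unfolding Y by (simp add: ennreal_mult_less_top)
    finally show "(\<integral>\<^sup>+t. ennreal (norm (energy H u t)) \<partial>M) < \<infinity>" .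
  qed
  then have "u \<in> L2 a b H" unfolding u_def by (simp add: L2_rep_iff[OF af])
  then show ?thesis unfolding u_def by (intro exI[of _ c]) (simp add: add.commute)
qed

end

section \<open>The order of a half-interval and the omega sequence\<close>

lemma vector_0_minus: "(- 1) *s (x :: complex^2) = - x"
  by (simp add: vec_eq_iff)

lemma vector_0_diff: "vector [0, x - y] = (vector [0, x] - vector [0, y] :: complex^2)"
  by (simp add: vec2_eq_iff)

context half_ham
begin

abbreviation LL :: "(real \<Rightarrow> complex^2) set" where "LL \<equiv> L2 a b H"

lemma L2_cong_eq:
  assumes f: "f \<in> LL" and eq: "\<And>t. a < t \<Longrightarrow> t < b \<Longrightarrow> f t = g t"
  shows "g \<in> LL"
proof (rule L2_cong[OF f])
  show "ham_eq a b H f g" unfolding ham_eq_def using eq by (intro AE_I2) (simp add: ham_app_def)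
  show "g \<in> borel_measurable M"
    by (rule measurable_cong[THEN iffD1, OF _ L2_meas[OF f]]) (simp add: eq)
qed

lemma Iop_sum:
  assumes "finite A" "\<And>i. i \<in> A \<Longrightarrow> adm (f i)" "a < t" "t < b"
  shows "Iop (\<lambda>t. \<Sum>i\<in>A. f i t) t = (\<Sum>i\<in>A. Iop (f i) t)"
  using assms
proof (induction A rule: finite_induct)
  case empty
  then show ?case by (simp add: Iop_def J_ham_app_zero)
next
  case (insert x F)
  then have "Iop (\<lambda>t. f x t + (\<Sum>i\<in>F. f i t)) t = Iop (f x) t + Iop (\<lambda>t. \<Sum>i\<in>F. f i t) t"
    by (intro Iop_add adm_sum) auto
  then show ?case using insert by simp
qed

text \<open>
  The general solution of $u_{n} = v_n + \mathcal Iu_{n-1}$, $u_0 = v_0$. The functions $w_n$ and those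
  in the definition of the order are all of this form.
\<close>

definition iter_sum :: "(nat \<Rightarrow> complex^2) \<Rightarrow> nat \<Rightarrow> real \<Rightarrow> complex^2" where
  "iter_sum v n t = (\<Sum>k\<le>n. (Iop ^^ k) (\<lambda>_. v (n - k)) t)"

lemma adm_funpow: "adm f \<Longrightarrow> adm ((Iop ^^ k) f)"
  by (induction k) (auto intro: adm_Iop)

lemma iter_sum_adm: "adm (iter_sum v n)"
proof -
  have "iter_sum v n = (\<lambda>t. \<Sum>k\<le>n. (Iop ^^ k) (\<lambda>_. v (n - k)) t)" by (simp add: fun_eq_iff iter_sum_def)
  then show ?thesis by (simp add: adm_sum adm_funpow adm_const)
qed

lemma iter_sum_0: "iter_sum v 0 = (\<lambda>_. v 0)"
  by (simp add: fun_eq_iff iter_sum_def)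

lemma iter_sum_Suc:
  assumes t: "a < t" "t < b"
  shows "iter_sum v (Suc n) t = v (Suc n) + Iop (iter_sum v n) t"
proof -
  have iter_sum: "iter_sum v n = (\<lambda>t. \<Sum>k\<le>n. (Iop ^^ k) (\<lambda>_. v (n - k)) t)" by (simp add: fun_eq_iff iter_sum_def)
  have "Iop (iter_sum v n) t = (\<Sum>k\<le>n. Iop ((Iop ^^ k) (\<lambda>_. v (n - k))) t)"
    unfolding iter_sum by (rule Iop_sum) (use t in \<open>auto intro: adm_funpow adm_const\<close>)
  then show ?thesis unfolding iter_sum_def by (simp add: sum.atMost_Suc_shift del: sum.atMost_Suc)
qed

lemma iter_sum_cong: "(\<And>i. i \<le> n \<Longrightarrow> v i = v' i) \<Longrightarrow> iter_sum v n = iter_sum v' n"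
  by (simp add: fun_eq_iff iter_sum_def)

lemma iter_sum_add:
  "a < t \<Longrightarrow> t < b \<Longrightarrow> iter_sum (\<lambda>i. v i + v' i) n t = iter_sum v n t + iter_sum v' n t"
proof (induction n arbitrary: t)
  case (Suc n)
  have "Iop (iter_sum (\<lambda>i. v i + v' i) n) t = Iop (\<lambda>t. iter_sum v n t + iter_sum v' n t) t"
    by (rule Iop_cong_pointwise) (use Suc in auto)
  then show ?case using Suc.prems by (simp add: iter_sum_Suc Iop_add iter_sum_adm)
qed (simp add: iter_sum_0)

lemma iter_sum_scale:
  "a < t \<Longrightarrow> t < b \<Longrightarrow> iter_sum (\<lambda>i. c *s v i) n t = c *s iter_sum v n t"
proof (induction n arbitrary: t)
  case (Suc n)
  have "Iop (iter_sum (\<lambda>i. c *s v i) n) t = Iop (\<lambda>t. c *s iter_sum v n t) t"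
    by (rule Iop_cong_pointwise) (use Suc in auto)
  then show ?case using Suc.prems by (simp add: iter_sum_Suc Iop_scale iter_sum_adm vector_add_ldistrib)
qed (simp add: iter_sum_0)

lemma iter_sum_diff:
  assumes "a < t" "t < b"
  shows "iter_sum (\<lambda>i. v i - v' i) n t = iter_sum v n t - iter_sum v' n t"
proof -
  have "(\<lambda>i. v i - v' i) = (\<lambda>i. v i + (- 1) *s v' i)" by (simp add: vector_0_minus)
  then show ?thesis using iter_sum_add[OF assms, of v "\<lambda>i. (- 1) *s v' i"] iter_sum_scale[OF assms, of "- 1" v']
    by (simp add: vector_0_minus)
qed

lemma iter_sum_zero: "a < t \<Longrightarrow> t < b \<Longrightarrow> iter_sum (\<lambda>i. 0) n t = 0"
  using iter_sum_scale[of t 0 "\<lambda>_. 0" n] by simp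

lemma iter_sum_sum:
  assumes "finite A" "a < t" "t < b"
  shows "iter_sum (\<lambda>j. \<Sum>i\<in>A. v i j) n t = (\<Sum>i\<in>A. iter_sum (v i) n t)"
  using assms by (induction A rule: finite_induct) (simp_all add: iter_sum_add iter_sum_zero)

text \<open>
  If the first $j$ of the constants vanish, then so do the first $j$ functions of the recursion.
\<close>

lemma iter_sum_shift:
  assumes "\<And>i. i < j \<Longrightarrow> v i = 0" "j \<le> n" "a < t" "t < b"
  shows "iter_sum v n t = iter_sum (\<lambda>i. v (i + j)) (n - j) t"
proof -
  have "Iop (\<lambda>_. 0) = (\<lambda>_. 0)" by (simp add: fun_eq_iff Iop_def J_ham_app_zero)
  then have z: "(Iop ^^ k) (\<lambda>_. 0) = (\<lambda>_. 0)" for k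
    by (induction k) simp_all
  have "iter_sum v n t = (\<Sum>k\<le>n - j. (Iop ^^ k) (\<lambda>_. v (n - k)) t)"
    unfolding iter_sum_def
  proof (rule sum.mono_neutral_right)
    show "\<forall>i\<in>{..n} - {..n - j}. (Iop ^^ i) (\<lambda>_. v (n - i)) t = 0"
    proof
      fix i assume "i \<in> {..n} - {..n - j}"
      then have "v (n - i) = 0" using assms(1,2) by (intro assms(1)) auto
      then show "(Iop ^^ i) (\<lambda>_. v (n - i)) t = 0" by (simp add: z)
    qed
  qed auto
  also have "\<dots> = iter_sum (\<lambda>i. v (i + j)) (n - j) t"
    unfolding iter_sum_def
  proof (rule sum.cong[OF refl])
    fix k assume "k \<in> {..n - j}"
    then have "n - j - k + j = n - k" using assms(2) by auto
    then show "(Iop ^^ k) (\<lambda>_. v (n - k)) t = (Iop ^^ k) (\<lambda>_. v (n - j - k + j)) t" by simp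
  qed
  finally show ?thesis .
qed

lemma w_gen_iter_sum: "w_gen Iop \<omega> n = iter_sum (\<lambda>i. vector [0, \<omega> i]) n"
  by (simp add: fun_eq_iff w_gen_def iter_sum_def)

lemma w_gen_adm: "adm (w_gen Iop \<omega> n)"
  by (simp add: w_gen_iter_sum iter_sum_adm)

lemma w_gen_0: "w_gen Iop \<omega> 0 = (\<lambda>_. vector [0, \<omega> 0])"
  by (simp add: w_gen_iter_sum iter_sum_0)

lemma w_gen_Suc: "a < t \<Longrightarrow> t < b \<Longrightarrow> w_gen Iop \<omega> (Suc n) t = vector [0, \<omega> (Suc n)] + Iop (w_gen Iop \<omega> n) t"
  by (simp add: w_gen_iter_sum iter_sum_Suc)

lemma iter_sum_meas: "iter_sum v n \<in> borel_measurable M"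
proof (cases n)
  case 0
  then show ?thesis by (simp add: iter_sum_0)
next
  case (Suc m)
  have "(\<lambda>t. v (Suc m) + Iop (iter_sum v m) t) \<in> borel_measurable M"
    using Iop_measurable[OF iter_sum_adm] by simp
  then show ?thesis unfolding Suc by (rule measurable_cong[THEN iffD1, rotated]) (simp add: iter_sum_Suc)
qed

lemma order_set:
  "ham_order Iop LL = Inf {enat n | n. \<exists>v. v 0 = vector [0, 1] \<and> iter_sum v n \<in> LL}"
proof -
  have "(\<exists>v. (\<lambda>t. (Iop ^^ n) (\<lambda>_. vector [0, 1]) t + (\<Sum>k<n. (Iop ^^ k) (\<lambda>_. v (n - k)) t)) \<in> LL) \<longleftrightarrow>
      (\<exists>v. v 0 = vector [0, 1] \<and> iter_sum v n \<in> LL)" for n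
  proof -
    have eq: "iter_sum v n = (\<lambda>t. (Iop ^^ n) (\<lambda>_. vector [0, 1]) t + (\<Sum>k<n. (Iop ^^ k) (\<lambda>_. v (n - k)) t))"
      if "v 0 = vector [0, 1]" for v
      using that by (simp add: fun_eq_iff iter_sum_def lessThan_Suc_atMost[symmetric] add.commute)
    show ?thesis
    proof
      assume "\<exists>v. (\<lambda>t. (Iop ^^ n) (\<lambda>_. vector [0, 1]) t + (\<Sum>k<n. (Iop ^^ k) (\<lambda>_. v (n - k)) t)) \<in> LL"
      then obtain v where v: "(\<lambda>t. (Iop ^^ n) (\<lambda>_. vector [0, 1]) t + (\<Sum>k<n. (Iop ^^ k) (\<lambda>_. v (n - k)) t)) \<in> LL" ..
      define v' where "v' = v(0 := vector [0, 1])"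
      have "(\<Sum>k<n. (Iop ^^ k) (\<lambda>_. v' (n - k)) t) = (\<Sum>k<n. (Iop ^^ k) (\<lambda>_. v (n - k)) t)" for t
        by (intro sum.cong refl) (simp add: v'_def)
      then have "iter_sum v' n \<in> LL" using v by (subst eq) (auto simp: v'_def)
      then show "\<exists>v. v 0 = vector [0, 1] \<and> iter_sum v n \<in> LL" by (intro exI[of _ v']) (simp add: v'_def)
    next
      assume "\<exists>v. v 0 = vector [0, 1] \<and> iter_sum v n \<in> LL"
      then obtain v where "v 0 = vector [0, 1]" "iter_sum v n \<in> LL" by blast
      then show "\<exists>v. (\<lambda>t. (Iop ^^ n) (\<lambda>_. vector [0, 1]) t + (\<Sum>k<n. (Iop ^^ k) (\<lambda>_. v (n - k)) t)) \<in> LL"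
        by (intro exI[of _ v]) (simp add: eq)
    qed
  qed
  then show ?thesis unfolding ham_order_def by simp
qed

lemma order_le: "v 0 = vector [0, 1] \<Longrightarrow> iter_sum v n \<in> LL \<Longrightarrow> ham_order Iop LL \<le> enat n"
  unfolding order_set by (rule Inf_lower) blast

lemma order_leI:
  assumes "v 0 = vector [0, c]" "c \<noteq> 0" "iter_sum v n \<in> LL"
  shows "ham_order Iop LL \<le> enat n"
proof (rule order_le[of "\<lambda>i. (1 / c) *s v i"])
  show "(1 / c) *s v 0 = vector [0, 1]" using assms by (simp add: vec2_eq_iff)
  show "iter_sum (\<lambda>i. (1 / c) *s v i) n \<in> LL"
    by (rule L2_cong_eq[OF L2_scale[OF assms(3), of "1 / c"]]) (simp add: iter_sum_scale)
qed

lemma order_attained: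
  assumes "ham_order Iop LL = enat n"
  shows "\<exists>v. v 0 = vector [0, 1] \<and> iter_sum v n \<in> LL"
proof -
  define A where "A = {enat n | n. \<exists>v. v 0 = vector [0, 1] \<and> iter_sum v n \<in> LL}"
  have o: "Inf A = enat n" using assms unfolding order_set A_def .
  then have ne: "A \<noteq> {}" by (auto simp: Inf_enat_def)
  then obtain x where "x \<in> A" by auto
  then have "(LEAST x. x \<in> A) \<in> A" by (rule LeastI)
  moreover have "Inf A = (LEAST x. x \<in> A)" unfolding Inf_enat_def using ne by (rule if_not_P)
  ultimately have "enat n \<in> A" using o by simp
  then show ?thesis by (simp add: A_def)
qed

lemma order_pos: "ham_order Iop LL = enat n \<Longrightarrow> 1 \<le> n"
proof (rule ccontr)
  assume n: "ham_order Iop LL = enat n" "\<not> 1 \<le> n"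
  from order_attained[OF n(1)] obtain v where v: "v 0 = vector [0, 1]" "iter_sum v n \<in> LL" by blast
  have "n = 0" using n by simp
  have "(\<lambda>_. vector [0, 1]) \<in> LL" using v(2) unfolding \<open>n = 0\<close> iter_sum_0 v(1) .
  then show False using L2_const_2 by fastforce
qed

definition correction :: "(real \<Rightarrow> complex^2) \<Rightarrow> complex" where
  "correction f = (SOME c. (\<lambda>t. Iop f t + vector [0, c]) \<in> LL)"

lemma correction: "f \<in> LL \<Longrightarrow> (\<lambda>t. Iop f t + vector [0, correction f]) \<in> LL"
  unfolding correction_def by (rule someI_ex[OF regularize])

text \<open>
  The difference between the solutions of the recursion with the constants $v_n$ and with constants
  $(0,\omega_n)^T$, for the sequence $\omega$ found in \<open>remove_first_components\<close>.
\<close>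

primrec defect :: "(nat \<Rightarrow> complex^2) \<Rightarrow> nat \<Rightarrow> real \<Rightarrow> complex^2" where
  "defect v 0 = (\<lambda>_. vector [v 0 $ 1, 0])"
| "defect v (Suc n) = (\<lambda>t. vector [v (Suc n) $ 1, 0] + (Iop (defect v n) t + vector [0, correction (defect v n)]))"

lemma defect_L2: "defect v n \<in> LL"
  by (induction n) (auto intro!: L2_const_1 L2_add correction)

text \<open>
  In the definition of the order arbitrary constants $v_k\in\mathbb C^2$ are allowed, in $w_n$ only
  multiples of $(0,1)^T$. Modulo $L^2(H)$ this makes no difference: the constants $(1,0)^T$ are in
  $L^2(H)$, and so are the functions obtained from them by applying $\mathcal I$ and correcting.
\<close>

lemma remove_first_components:
  "\<exists>\<omega>. \<omega> 0 = v 0 $ 2 \<and> (\<forall>n t. a < t \<and> t < b \<longrightarrow> iter_sum v n t = w_gen Iop \<omega> n t + defect v n t)"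
proof -
  define \<omega> where "\<omega> n = (case n of 0 \<Rightarrow> v 0 $ 2 | Suc m \<Rightarrow> v (Suc m) $ 2 - correction (defect v m))" for n
  have \<omega>0: "\<omega> 0 = v 0 $ 2" and \<omega>S: "\<omega> (Suc m) = v (Suc m) $ 2 - correction (defect v m)" for m
    by (simp_all add: \<omega>_def)
  have "iter_sum v n t = w_gen Iop \<omega> n t + defect v n t" if "a < t" "t < b" for n t
    using that
  proof (induction n arbitrary: t)
    case 0
    then show ?case by (simp add: iter_sum_0 w_gen_0 \<omega>0 vec2_eq_iff)
  next
    case (Suc n)
    have "Iop (iter_sum v n) t = Iop (\<lambda>t. w_gen Iop \<omega> n t + defect v n t) t"
      by (rule Iop_cong_pointwise) (use Suc in auto)
    also have "\<dots> = Iop (w_gen Iop \<omega> n) t + Iop (defect v n) t"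
      using Suc.prems by (intro Iop_add w_gen_adm L2_adm defect_L2)
    finally show ?case using Suc.prems by (simp add: iter_sum_Suc w_gen_Suc vec2_eq_iff \<omega>S)
  qed
  then show ?thesis by (intro exI[of _ \<omega>]) (simp add: \<omega>_def)
qed

text \<open>
  Once one $w_n$ is square integrable, the corrections are the only possible continuation of
  $\omega$.
\<close>

primrec extension :: "(real \<Rightarrow> complex^2) \<Rightarrow> nat \<Rightarrow> real \<Rightarrow> complex^2" where
  "extension f 0 = f"
| "extension f (Suc n) = (\<lambda>t. Iop (extension f n) t + vector [0, correction (extension f n)])"

lemma extension_L2: "f \<in> LL \<Longrightarrow> extension f n \<in> LL"
  by (induction n) (auto intro!: correction)

lemma extend_omega:
  assumes w: "w_gen Iop \<omega> n0 \<in> LL"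
  shows "\<exists>\<omega>'. \<omega>' 0 = \<omega> 0 \<and> (\<forall>n\<ge>n0. w_gen Iop \<omega>' n \<in> LL)"
proof -
  let ?W = "extension (w_gen Iop \<omega> n0)"
  define \<omega>' where "\<omega>' j = (if j \<le> n0 then \<omega> j else correction (?W (j - n0 - 1)))" for j
  have eq: "?W k t = w_gen Iop \<omega>' (n0 + k) t" if "a < t" "t < b" for k t
    using that
  proof (induction k arbitrary: t)
    case 0
    have "w_gen Iop \<omega>' n0 = w_gen Iop \<omega> n0"
      unfolding w_gen_iter_sum by (rule iter_sum_cong) (simp add: \<omega>'_def)
    then show ?case by simp
  next
    case (Suc k)
    have "Iop (?W k) t = Iop (w_gen Iop \<omega>' (n0 + k)) t"
      by (rule Iop_cong_pointwise) (use Suc in auto)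
    moreover have "\<omega>' (Suc (n0 + k)) = correction (?W k)" by (simp add: \<omega>'_def)
    ultimately show ?case using Suc.prems by (simp add: w_gen_Suc)
  qed
  have "w_gen Iop \<omega>' n \<in> LL" if "n \<ge> n0" for n
    using L2_cong_eq[OF extension_L2[OF w, of "n - n0"] eq] that by simp
  then show ?thesis by (intro exI[of _ \<omega>']) (simp add: \<omega>'_def)
qed

lemma omega_exists:
  assumes "ham_order Iop LL = enat n0"
  shows "\<exists>\<omega>. \<omega> 0 = 1 \<and> (\<forall>n\<ge>n0. w_gen Iop \<omega> n \<in> LL)"
proof -
  from order_attained[OF assms] obtain v where v: "v 0 = vector [0, 1]" "iter_sum v n0 \<in> LL" by blast
  from remove_first_components[of v] obtain \<omega> where \<omega>: "\<omega> 0 = v 0 $ 2"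
    "\<And>n t. a < t \<Longrightarrow> t < b \<Longrightarrow> iter_sum v n t = w_gen Iop \<omega> n t + defect v n t" by blast
  have "w_gen Iop \<omega> n0 \<in> LL"
    by (rule L2_cong_eq[OF L2_diff[OF v(2) defect_L2[of v n0]]]) (simp add: \<omega>(2))
  from extend_omega[OF this] show ?thesis using \<omega>(1) v(1) by simp
qed

text \<open>
  If two sequences first differ at the index $j\ge1$, the difference of the corresponding functions
  with index $n = \max\{j,n_0\}$ is a square integrable solution of the recursion that starts $j$
  steps later. This would show that the order is at most $n-j < n_0$.
\<close>

lemma omega_unique:
  assumes o: "ham_order Iop LL = enat n0"
    and \<omega>: "\<omega> 0 = 1" "\<forall>n\<ge>n0. w_gen Iop \<omega> n \<in> LL"
    and \<omega>': "\<omega>' 0 = 1" "\<forall>n\<ge>n0. w_gen Iop \<omega>' n \<in> LL"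
  shows "\<omega> = \<omega>'"
proof (rule ccontr)
  assume "\<omega> \<noteq> \<omega>'"
  then have ex: "\<exists>i. \<omega> i \<noteq> \<omega>' i" by (simp add: fun_eq_iff)
  define j where "j = (LEAST i. \<omega> i \<noteq> \<omega>' i)"
  have j: "\<omega> j \<noteq> \<omega>' j" unfolding j_def by (rule LeastI_ex[OF ex])
  have less: "\<omega> i = \<omega>' i" if "i < j" for i using not_less_Least[OF that[unfolded j_def]] by simp
  have j1: "1 \<le> j" using j \<omega>(1) \<omega>'(1) by (cases j) auto
  define n where "n = max j n0"
  define v where "v i = (vector [0, \<omega> i - \<omega>' i] :: complex^2)" for i
  have v0: "v i = 0" if "i < j" for i using less[OF that] by (simp add: v_def vec2_eq_iff)
  have d: "(\<lambda>t. w_gen Iop \<omega> n t - w_gen Iop \<omega>' n t) \<in> LL"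
    using \<omega> \<omega>' by (intro L2_diff) (auto simp: n_def)
  have "iter_sum (\<lambda>i. v (i + j)) (n - j) \<in> LL"
  proof (rule L2_cong_eq[OF d])
    fix t assume t: "a < t" "t < b"
    have "iter_sum v n t = w_gen Iop \<omega> n t - w_gen Iop \<omega>' n t"
      using iter_sum_diff[OF t, of "\<lambda>i. vector [0, \<omega> i]" "\<lambda>i. vector [0, \<omega>' i]" n]
      by (simp add: v_def[abs_def] vector_0_diff w_gen_iter_sum)
    moreover have "iter_sum v n t = iter_sum (\<lambda>i. v (i + j)) (n - j) t"
      by (rule iter_sum_shift[OF v0 _ t]) (auto simp: n_def)
    ultimately show "w_gen Iop \<omega> n t - w_gen Iop \<omega>' n t = iter_sum (\<lambda>i. v (i + j)) (n - j) t" by simp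
  qed
  then have "ham_order Iop LL \<le> enat (n - j)"
    by (rule order_leI[rotated 2]) (use j in \<open>auto simp: v_def\<close>)
  then show False using o order_pos[OF o] j1 by (auto simp: n_def)
qed

lemma omega_seq:
  assumes o: "ham_order Iop LL = enat n0"
  shows "omega_seq Iop LL 0 = 1" "n0 \<le> n \<Longrightarrow> w_gen Iop (omega_seq Iop LL) n \<in> LL"
    and "\<omega> 0 = 1 \<Longrightarrow> \<forall>n\<ge>n0. w_gen Iop \<omega> n \<in> LL \<Longrightarrow> omega_seq Iop LL = \<omega>"
proof -
  have "\<exists>!\<omega>. \<omega> 0 = 1 \<and> (\<forall>n. ham_order Iop LL \<le> enat n \<longrightarrow> w_gen Iop \<omega> n \<in> LL)"
    using omega_exists[OF o] omega_unique[OF o] by (intro ex_ex1I) (auto simp: o)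
  from theI'[OF this] have *: "omega_seq Iop LL 0 = 1 \<and> (\<forall>n. ham_order Iop LL \<le> enat n \<longrightarrow> w_gen Iop (omega_seq Iop LL) n \<in> LL)"
    unfolding omega_seq_def .
  then show "omega_seq Iop LL 0 = 1" "n0 \<le> n \<Longrightarrow> w_gen Iop (omega_seq Iop LL) n \<in> LL" by (auto simp: o)
  show "\<omega> 0 = 1 \<Longrightarrow> \<forall>n\<ge>n0. w_gen Iop \<omega> n \<in> LL \<Longrightarrow> omega_seq Iop LL = \<omega>"
    using * by (intro omega_unique[OF o]) (auto simp: o)
qed

text \<open>
  A combination of $w_0,\dots,w_m$ is again a solution of the recursion, and its first constant is
  $(0,\delta_m)^T$.
\<close>

lemma independent_w:
  assumes \<omega>: "\<omega> 0 = 1" and L: "(\<lambda>t. \<Sum>i\<le>m. \<delta> i *s w_gen Iop \<omega> i t) \<in> LL" and nz: "\<delta> m \<noteq> 0"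
  shows "ham_order Iop LL \<le> enat m"
proof -
  define u where "u i j = (if j < m - i then 0 else \<delta> i *s (vector [0, \<omega> (j - (m - i))] :: complex^2))" for i j
  have eq: "iter_sum (\<lambda>j. \<Sum>i\<le>m. u i j) m t = (\<Sum>i\<le>m. \<delta> i *s w_gen Iop \<omega> i t)" if t: "a < t" "t < b" for t
  proof -
    have "iter_sum (u i) m t = \<delta> i *s w_gen Iop \<omega> i t" if i: "i \<le> m" for i
    proof -
      have "iter_sum (u i) m t = iter_sum (\<lambda>j. u i (j + (m - i))) (m - (m - i)) t"
        by (rule iter_sum_shift[OF _ _ t]) (auto simp: u_def)
      also have "(\<lambda>j. u i (j + (m - i))) = (\<lambda>j. \<delta> i *s vector [0, \<omega> j])"
        by (simp only: u_def not_add_less2 if_False add_diff_cancel_right')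
      also have "m - (m - i) = i" using i by simp
      finally show ?thesis by (simp add: iter_sum_scale[OF t] w_gen_iter_sum)
    qed
    then show ?thesis by (simp add: iter_sum_sum[OF _ t])
  qed
  show ?thesis
  proof (rule order_leI)
    have "(\<Sum>i\<le>m. u i 0) = (\<Sum>i\<in>{m}. u i 0)"
      by (rule sum.mono_neutral_right) (auto simp: u_def)
    then show "(\<Sum>i\<le>m. u i 0) = vector [0, \<delta> m]" by (simp add: u_def \<omega> vec2_eq_iff)
    show "iter_sum (\<lambda>j. \<Sum>i\<le>m. u i j) m \<in> LL" by (rule L2_cong_eq[OF L]) (simp add: eq)
  qed (rule nz)
qed

end

section \<open>Indivisible half-intervals and uniqueness of boundary values\<close>

text \<open>
  The hypotheses say that the unit vector $(-\sin\phi,\cos\phi)^T$ is in the kernel; a symmetric matrix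
  with that kernel vector is its trace times the projection onto the orthogonal direction.
\<close>

lemma range_kernel:
  fixes M :: "real^2^2"
  assumes sym: "M $ 2 $ 1 = M $ 1 $ 2" and nz: "M \<noteq> 0"
    and k1: "M $ 1 $ 1 * sin \<phi> = M $ 1 $ 2 * cos \<phi>" and k2: "M $ 1 $ 2 * sin \<phi> = M $ 2 $ 2 * cos \<phi>"
  shows "range (\<lambda>x. M *v x) = span {xi_dir \<phi>}"
proof -
  define k where "k = M $ 1 $ 1 + M $ 2 $ 2"
  define c where "c = cos \<phi>"
  define s where "s = sin \<phi>"
  have cs: "c * c + s * s = 1" by (simp add: c_def s_def)
  have k1: "M $ 1 $ 1 * s = M $ 1 $ 2 * c" and k2: "M $ 1 $ 2 * s = M $ 2 $ 2 * c"
    using k1 k2 by (auto simp: c_def s_def)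
  have 1: "M $ 1 $ 1 = k * c * c"
  proof -
    have "k * c * c = M $ 1 $ 1 * (c * c) + (M $ 2 $ 2 * c) * c" by (simp add: k_def algebra_simps)
    also have "\<dots> = M $ 1 $ 1 * (c * c) + (M $ 1 $ 2 * c) * s" unfolding k2[symmetric] by (simp only: ac_simps)
    also have "\<dots> = M $ 1 $ 1 * (c * c + s * s)" unfolding k1[symmetric] by (simp only: algebra_simps)
    finally show ?thesis by (simp add: cs)
  qed
  have 2: "M $ 1 $ 2 = k * c * s"
  proof -
    have "k * c * s = (M $ 1 $ 1 * s) * c + (M $ 2 $ 2 * c) * s" by (simp add: k_def algebra_simps)
    also have "\<dots> = M $ 1 $ 2 * (c * c + s * s)" unfolding k1 k2[symmetric] by (simp only: algebra_simps)
    finally show ?thesis by (simp add: cs)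
  qed
  have 3: "M $ 2 $ 2 = k * s * s"
  proof -
    have "k * s * s = (M $ 1 $ 1 * s) * s + M $ 2 $ 2 * (s * s)" by (simp add: k_def algebra_simps)
    also have "\<dots> = (M $ 1 $ 2 * s) * c + M $ 2 $ 2 * (s * s)" unfolding k1 by (simp only: ac_simps)
    also have "\<dots> = M $ 2 $ 2 * (c * c + s * s)" unfolding k2 by (simp only: algebra_simps)
    finally show ?thesis by (simp add: cs)
  qed
  have "k \<noteq> 0"
  proof
    assume "k = 0"
    then have "M = 0" using 1 2 3 sym by (simp add: vec2_eq_iff)
    then show False using nz by simp
  qed
  have Mx: "M *v x = (k * (c * x $ 1 + s * x $ 2)) *\<^sub>R xi_dir \<phi>" for x
    by (simp add: vec2_eq_iff matrix_vector_mult_def sum_2 sym 1 2 3 xi_dir_def algebra_simps flip: c_def s_def)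
  show ?thesis
    unfolding span_singleton
  proof (intro equalityI subsetI)
    fix y assume "y \<in> range (\<lambda>z. z *\<^sub>R xi_dir \<phi>)"
    then obtain z where y: "y = z *\<^sub>R xi_dir \<phi>" by auto
    have "M *v ((z / k) *\<^sub>R xi_dir \<phi>) = (z * (c * c + s * s)) *\<^sub>R xi_dir \<phi>"
      unfolding Mx using \<open>k \<noteq> 0\<close> by (simp add: xi_dir_def algebra_simps flip: c_def s_def)
    then have "y = M *v ((z / k) *\<^sub>R xi_dir \<phi>)" by (simp add: y cs)
    then show "y \<in> range (\<lambda>x. M *v x)" by (rule range_eqI)
  next
    fix y assume "y \<in> range (\<lambda>x. M *v x)"
    then show "y \<in> range (\<lambda>z. z *\<^sub>R xi_dir \<phi>)" unfolding Mx by auto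
  qed
qed

context half_ham
begin

lemma real_kernel_imp_indivisible:
  assumes nz: "x \<noteq> 0 \<or> y \<noteq> 0"
    and k: "AE t in M. H t $ 1 $ 1 * x + H t $ 1 $ 2 * y = 0 \<and> H t $ 2 $ 1 * x + H t $ 2 $ 2 * y = 0"
  shows "indivisible H a b"
proof -
  define r where "r = sqrt (x\<^sup>2 + y\<^sup>2)"
  have r: "r > 0" "r\<^sup>2 = x\<^sup>2 + y\<^sup>2" using nz by (auto simp: r_def sum_power2_gt_zero_iff)
  have "(y / r)\<^sup>2 + (- x / r)\<^sup>2 = (x\<^sup>2 + y\<^sup>2) / r\<^sup>2" by (simp add: power_divide add_divide_distrib)
  also have "\<dots> = 1" unfolding r(2)[symmetric] using r(1) by simp
  finally have "(y / r)\<^sup>2 + (- x / r)\<^sup>2 = 1" .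
  then obtain \<phi> where \<phi>: "y / r = cos \<phi>" "- x / r = sin \<phi>" by (rule sincos_total_2pi) blast
  then have xy: "y = r * cos \<phi>" "x = - r * sin \<phi>" using r by (auto simp: field_simps)
  have "AE t in M. H t \<noteq> 0" using ham by (simp add: hamiltonian_def)
  with k psd_AE have "AE t in M. range (\<lambda>x. H t *v x) = span {xi_dir \<phi>}"
  proof eventually_elim
    case (elim t)
    have "r * (H t $ 1 $ 2 * cos \<phi> - H t $ 1 $ 1 * sin \<phi>) = 0" "r * (H t $ 2 $ 2 * cos \<phi> - H t $ 1 $ 2 * sin \<phi>) = 0"
      using elim(1) psd_entries(1)[OF elim(2)] by (simp_all add: xy algebra_simps)
    then show ?case using r(1) by (intro range_kernel psd_entries(1)[OF elim(2)] elim(3)) auto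
  qed
  then show ?thesis using ab unfolding indivisible_def indivisible_of_type_def by blast
qed

lemma kernel_trivial:
  assumes ni: "\<not> indivisible H a b" and k: "AE t in M. ham_app H (\<lambda>_. v) t = 0"
  shows "v = 0"
proof -
  have re: "AE t in M. H t $ 1 $ 1 * Re (v $ 1) + H t $ 1 $ 2 * Re (v $ 2) = 0 \<and> H t $ 2 $ 1 * Re (v $ 1) + H t $ 2 $ 2 * Re (v $ 2) = 0"
    using k by eventually_elim (simp add: vec2_eq_iff ham_app_nth complex_eq_iff)
  have im: "AE t in M. H t $ 1 $ 1 * Im (v $ 1) + H t $ 1 $ 2 * Im (v $ 2) = 0 \<and> H t $ 2 $ 1 * Im (v $ 1) + H t $ 2 $ 2 * Im (v $ 2) = 0"
    using k by eventually_elim (simp add: vec2_eq_iff ham_app_nth complex_eq_iff)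
  show ?thesis using real_kernel_imp_indivisible[OF _ re] real_kernel_imp_indivisible[OF _ im] ni
    by (auto simp: vec2_eq_iff complex_eq_iff)
qed

lemma ac_repE:
  assumes "adm g" "ac_rep a b H f g fh"
  obtains v where "\<And>t. a < t \<Longrightarrow> t < b \<Longrightarrow> fh t = v + Iop g t" "ham_eq a b H fh f"
    "ham_eq a b H (\<lambda>t. v + Iop g t) f" "(fh \<longlongrightarrow> v) E"
proof -
  from assms(2)[unfolded ac_rep_iff[OF assms(1)]] obtain v
    where v: "\<forall>t. a < t \<and> t < b \<longrightarrow> fh t = v + Iop g t" and eq: "ham_eq a b H fh f"
    by (elim conjE exE)
  have "ham_eq a b H (\<lambda>t. v + Iop g t) f"
    using eq AE_space unfolding ham_eq_def by eventually_elim (simp add: ham_app_def v)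
  moreover have "(fh \<longlongrightarrow> v) E" by (rule rep_tendsto[OF assms(1)]) (simp add: v)
  ultimately show thesis using v eq by (intro that) auto
qed

lemma ac_repI:
  assumes "adm g" "ham_eq a b H fh f" "\<And>t. a < t \<Longrightarrow> t < b \<Longrightarrow> fh t = v + Iop g t"
  shows "ac_rep a b H f g fh"
  unfolding ac_rep_iff[OF assms(1)] using assms(2,3) by (intro conjI exI[of _ v]) auto

text \<open>
  Two boundary values of the same class differ by a constant vector in the kernel of $H$.
\<close>

lemma value_eq:
  assumes ni: "\<not> indivisible H a b" and g: "adm g" and eq: "ham_eq a b H (\<lambda>t. v + Iop g t) f"
  shows "(THE v. \<exists>fh. ac_rep a b H f g fh \<and> (fh \<longlongrightarrow> v) E) = v"
proof (rule the_equality)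
  have "ac_rep a b H f g (\<lambda>t. v + Iop g t)" by (rule ac_repI[OF g eq]) simp
  moreover have "((\<lambda>t. v + Iop g t) \<longlongrightarrow> v) E" by (rule rep_tendsto[OF g]) simp
  ultimately show "\<exists>fh. ac_rep a b H f g fh \<and> (fh \<longlongrightarrow> v) E"
    by (rule_tac x="\<lambda>t. v + Iop g t" in exI) simp
  fix u assume "\<exists>fh. ac_rep a b H f g fh \<and> (fh \<longlongrightarrow> u) E"
  then obtain fh where fh: "ac_rep a b H f g fh" "(fh \<longlongrightarrow> u) E" by (elim exE conjE)
  obtain u' where eq': "ham_eq a b H (\<lambda>t. u' + Iop g t) f" and "(fh \<longlongrightarrow> u') E"
    by (rule ac_repE[OF g fh(1)])
  then have "u' = u" using tendsto_unique[OF E_nontrivial _ fh(2)] by simp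
  have "AE t in M. ham_app H (\<lambda>_. u - v) t = 0"
    using eq[unfolded ham_eq_def] eq'[unfolded ham_eq_def]
  proof eventually_elim
    case (elim t)
    then have "ham_app H (\<lambda>t. v + Iop g t) t = ham_app H (\<lambda>t. u + Iop g t) t"
      using \<open>u' = u\<close> by simp
    then have "ham_app H (\<lambda>_. v) t = ham_app H (\<lambda>_. u) t"
      unfolding ham_app_linear(1)[of H "\<lambda>_. v" "Iop g" t] ham_app_linear(1)[of H "\<lambda>_. u" "Iop g" t] by simp
    then show ?case using ham_app_linear(2)[of H "\<lambda>_. u" "\<lambda>_. v" t] by simp
  qed
  from kernel_trivial[OF ni this] show "u = v" by simp
qed

text \<open>
  On an indivisible half-interval all entries of $H$ are multiples of $h_1$ unless $\cos\phi = 0$;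
  as $h_1$ is integrable and $H$ is not, the type is that of $(0,1)^T$.
\<close>

lemma indivisible_diagonal:
  assumes "indivisible H a b"
  shows "AE t in M. H t $ 1 $ 1 = 0 \<and> H t $ 1 $ 2 = 0 \<and> H t $ 2 $ 1 = 0"
proof -
  obtain \<phi> where type: "indivisible_of_type H \<phi> a b" using assms unfolding indivisible_def by blast
  have AE: "AE t in M. positive_semidefinite (H t) \<and> range (\<lambda>x. H t *v x) = span {xi_dir \<phi>}"
    by (rule indivisible_AE[OF order_refl order_refl type])
  have c0: "cos \<phi> = 0"
  proof (rule ccontr)
    assume c: "cos \<phi> \<noteq> 0"
    \<comment> \<open>For $\cos\phi\ne0$ the matrix $H(t)$ is $h_1(t)$ times this constant matrix.\<close>
    define C :: "real^2^2" where "C = vector [vector [1, sin \<phi> / cos \<phi>], vector [sin \<phi> / cos \<phi>, (sin \<phi> / cos \<phi>)\<^sup>2]]"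
    have "integrable M (\<lambda>t. H t $ 1 $ 1 *\<^sub>R C)" using int_h1 by simp
    then have "integrable M H"
    proof (rule integrable_cong_AE_imp[OF _ H_meas])
      show "AE t in M. H t $ 1 $ 1 *\<^sub>R C = H t"
        using AE
      proof eventually_elim
        case (elim t)
        obtain k where "H t $ 1 $ 1 = k * cos \<phi> * cos \<phi>" "H t $ 1 $ 2 = k * cos \<phi> * sin \<phi>"
            "H t $ 2 $ 1 = k * cos \<phi> * sin \<phi>" "H t $ 2 $ 2 = k * sin \<phi> * sin \<phi>"
          by (rule rank_one[of "H t" \<phi>]) (use elim in auto)
        then show ?case using c by (simp add: vec2_eq_iff C_def power2_eq_square field_simps)
      qed
    qed
    then show False using not_int_H by contradiction
  qed
  show ?thesis using AE
  proof eventually_elim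
    case (elim t)
    obtain k where "H t $ 1 $ 1 = k * cos \<phi> * cos \<phi>" "H t $ 1 $ 2 = k * cos \<phi> * sin \<phi>"
        "H t $ 2 $ 1 = k * cos \<phi> * sin \<phi>" "H t $ 2 $ 2 = k * sin \<phi> * sin \<phi>"
      by (rule rank_one[of "H t" \<phi>]) (use elim in auto)
    then show ?case by (simp add: c0)
  qed
qed

lemma indivisible_ham_app_0:
  assumes "indivisible H a b" "AE t in M. f t $ 2 = g t $ 2"
  shows "ham_eq a b H f g"
  unfolding ham_eq_def using indivisible_diagonal[OF assms(1)] assms(2)
  by eventually_elim (simp add: vec2_eq_iff ham_app_nth)

lemma indivisible_Iop_2:
  assumes i: "indivisible H a b" and f: "adm f" and t: "a < t" "t < b"
  shows "Iop f t $ 2 = 0"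
proof -
  have "(LINT s|lebesgue_on (S t). J_ham_app H f s) $ 2 = (LINT s|lebesgue_on (S t). J_ham_app H f s $ 2)"
    by (rule integral_bounded_linear[OF bounded_linear_vec_nth adm_S[OF f t], symmetric])
  also have "\<dots> = (LINT s|lebesgue_on (S t). 0)"
  proof (rule integral_cong_AE)
    show "(\<lambda>s. J_ham_app H f s $ 2) \<in> borel_measurable (lebesgue_on (S t))"
      using integrable_bounded_linear[OF bounded_linear_vec_nth adm_S[OF f t]] by simp
    show "AE s in lebesgue_on (S t). J_ham_app H f s $ 2 = 0"
      using AE_S[OF indivisible_diagonal[OF i] t] by eventually_elim (simp add: J_ham_app_nth ham_app_nth)
  qed simp
  finally show ?thesis unfolding Iop_def vector_scaleR_component by simp
qed

text \<open>
  The sequence $1,0,0,\dots$ has the defining property of $\omega$: the second component of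
  $\mathcal If$ is $\int h_1 f_1 + h_3 f_2 = 0$ up to sign, hence $Hw_n = 0$ for $n\ge1$.
\<close>

lemma indivisible_omega:
  assumes i: "indivisible H a b" and o: "ham_order Iop LL = enat n0" and n: "n \<ge> 1"
  shows "omega_seq Iop LL n = 0"
proof -
  define \<omega> :: "nat \<Rightarrow> complex" where "\<omega> k = (if k = 0 then 1 else 0)" for k
  have "w_gen Iop \<omega> k \<in> LL" if k: "k \<ge> n0" for k
  proof -
    obtain m where m: "k = Suc m" using order_pos[OF o] k by (cases k) auto
    have meas: "w_gen Iop \<omega> k \<in> borel_measurable M" by (simp add: w_gen_iter_sum iter_sum_meas)
    show ?thesis
    proof (rule L2_cong[OF L2_zero _ meas], rule indivisible_ham_app_0[OF i])
      show "AE t in M. 0 $ 2 = w_gen Iop \<omega> k t $ 2"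
        unfolding m by (intro AE_I2) (simp add: w_gen_Suc indivisible_Iop_2[OF i w_gen_adm] \<omega>_def)
    qed
  qed
  then have "omega_seq Iop LL = \<omega>" by (intro omega_seq(3)[OF o]) (simp_all add: \<omega>_def)
  then show ?thesis using n by (simp add: \<omega>_def)
qed

text \<open>
  The second component of $v + \mathcal Ig$ is the constant $v_2$, and nonzero constants
  $(0,v_2)^T$ are not in $L^2(H)$.
\<close>

lemma indivisible_value_2:
  assumes i: "indivisible H a b" and g: "adm g" and f: "f \<in> LL" and eq: "ham_eq a b H (\<lambda>t. v + Iop g t) f"
  shows "v $ 2 = 0"
proof -
  have "ham_eq a b H (\<lambda>t. v + Iop g t) (\<lambda>_. vector [0, v $ 2])"
    by (rule indivisible_ham_app_0[OF i], rule AE_I2) (simp add: indivisible_Iop_2[OF i g])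
  then have "ham_eq a b H f (\<lambda>_. vector [0, v $ 2])"
    using eq unfolding ham_eq_def by eventually_elim simp
  then have "(\<lambda>_. vector [0, v $ 2]) \<in> LL" by (rule L2_cong[OF f]) simp
  then show ?thesis by (rule L2_const_2)
qed

lemma Tmax_iff:
  "(f, g) \<in> Tmax a b H \<longleftrightarrow> f \<in> LL \<and> g \<in> LL \<and> (\<exists>v. ham_eq a b H (\<lambda>t. v + Iop g t) f)"
proof -
  have "(\<exists>fh. ac_rep a b H f g fh) \<longleftrightarrow> (\<exists>v. ham_eq a b H (\<lambda>t. v + Iop g t) f)" if g: "g \<in> LL"
  proof
    assume "\<exists>fh. ac_rep a b H f g fh"
    then obtain fh where "ac_rep a b H f g fh" ..
    then obtain v where "ham_eq a b H (\<lambda>t. v + Iop g t) f" by (rule ac_repE[OF L2_adm[OF g]])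
    then show "\<exists>v. ham_eq a b H (\<lambda>t. v + Iop g t) f" ..
  next
    assume "\<exists>v. ham_eq a b H (\<lambda>t. v + Iop g t) f"
    then obtain v where "ham_eq a b H (\<lambda>t. v + Iop g t) f" ..
    then have "ac_rep a b H f g (\<lambda>t. v + Iop g t)" by (rule ac_repI[OF L2_adm[OF g]]) simp
    then show "\<exists>fh. ac_rep a b H f g fh" by (rule exI[of "ac_rep a b H f g"])
  qed
  then show ?thesis unfolding Tmax_def by auto
qed

end

section \<open>Representatives with a prescribed boundary value\<close>

context half_ham
begin

text \<open>
  The class of \<open>f\<close> has a locally absolutely continuous representative with derivative $JHg$ and with
  boundary value \<open>v\<close>. In this form the notion is linear in the triple \<open>f\<close>, \<open>g\<close>, \<open>v\<close>.
\<close>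

definition rep :: "(real \<Rightarrow> complex^2) \<Rightarrow> (real \<Rightarrow> complex^2) \<Rightarrow> complex^2 \<Rightarrow> bool" where
  "rep f g v \<longleftrightarrow> adm g \<and> ham_eq a b H (\<lambda>t. v + Iop g t) f"

lemma adm_cong_eq:
  assumes "adm g" "\<And>t. a < t \<Longrightarrow> t < b \<Longrightarrow> g t = g' t"
  shows "adm g'"
  unfolding adm_def
proof (intro allI impI; elim conjE)
  fix t assume t: "a < t" "t < b"
  show "integrable (lebesgue_on (S t)) (J_ham_app H g')"
    by (rule Bochner_Integration.integrable_cong[THEN iffD1, OF refl _ adm_S[OF assms(1) t]])
      (use S_subset[OF t] assms(2) in \<open>auto simp: J_ham_app_def ham_app_def\<close>)
qed

lemma adm_zero: "adm (\<lambda>_. 0)"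
  by (rule adm_const)

lemma L2_form_integrable:
  assumes f: "f \<in> LL" and g: "g \<in> LL"
  shows "integrable M (ham_form H f g)"
proof (rule Bochner_Integration.integrable_bound)
  show "integrable M (\<lambda>t. (energy H f t + energy H g t) / 2)"
    using L2_energy[OF f] L2_energy[OF g] by simp
  show "ham_form H f g \<in> borel_measurable M"
    by (intro borel_measurable_ham_form H_meas L2_meas f g)
  show "AE t in M. norm (ham_form H f g t) \<le> norm ((energy H f t + energy H g t) / 2)"
    using psd_AE
  proof eventually_elim
    case (elim t)
    show ?case using norm_ham_form_le[of H t f g, OF elim] unfolding real_norm_def by linarith
  qed
qed

lemma rep_cong_eq:
  assumes r: "rep f g v" and f: "\<And>t. a < t \<Longrightarrow> t < b \<Longrightarrow> f t = f' t" and g: "\<And>t. a < t \<Longrightarrow> t < b \<Longrightarrow> g t = g' t"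
  shows "rep f' g' v"
  unfolding rep_def
proof
  show "adm g'" by (rule adm_cong_eq[OF _ g]) (use r in \<open>simp add: rep_def\<close>)
  have "ham_eq a b H (\<lambda>t. v + Iop g t) f" using r by (simp add: rep_def)
  then show "ham_eq a b H (\<lambda>t. v + Iop g' t) f'"
    using AE_space unfolding ham_eq_def
  proof eventually_elim
    case (elim t)
    then have t: "a < t" "t < b" by auto
    then show ?case using elim Iop_cong_pointwise[OF g t] f[OF t] by (simp add: ham_app_def)
  qed
qed

lemma rep_cong:
  assumes r: "rep f g v" and f: "ham_eq a b H f f'" and g: "ham_eq a b H g g'"
    and m: "g \<in> borel_measurable M" "g' \<in> borel_measurable M"
  shows "rep f' g' v"
  unfolding rep_def
proof
  show "adm g'"
    unfolding adm_def
  proof (intro allI impI; elim conjE)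
    fix t assume t: "a < t" "t < b"
    have ag: "adm g" using r by (simp add: rep_def)
    show "integrable (lebesgue_on (S t)) (J_ham_app H g')"
    proof (rule integrable_cong_AE_imp[OF adm_S[OF ag t]])
      show "J_ham_app H g' \<in> borel_measurable (lebesgue_on (S t))"
        by (intro meas_S[OF _ t] borel_measurable_J_ham_app H_meas m)
      show "AE s in lebesgue_on (S t). J_ham_app H g s = J_ham_app H g' s"
        using AE_S[OF g[unfolded ham_eq_def] t] by eventually_elim (simp add: J_ham_app_eq_iff)
    qed
  qed
  have "ham_eq a b H (\<lambda>t. v + Iop g t) f" using r by (simp add: rep_def)
  then show "ham_eq a b H (\<lambda>t. v + Iop g' t) f'"
    using f AE_space unfolding ham_eq_def
  proof eventually_elim
    case (elim t)
    then have t: "a < t" "t < b" by auto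
    then show ?case using elim Iop_cong[OF g[unfolded ham_eq_def] m t] by (simp add: ham_app_def)
  qed
qed

lemma rep_add:
  assumes r: "rep f g v" and r': "rep f' g' v'"
  shows "rep (\<lambda>t. f t + f' t) (\<lambda>t. g t + g' t) (v + v')"
  unfolding rep_def
proof
  have a: "adm g" "adm g'" using r r' by (simp_all add: rep_def)
  then show "adm (\<lambda>t. g t + g' t)" by (rule adm_add)
  have "ham_eq a b H (\<lambda>t. v + Iop g t) f" "ham_eq a b H (\<lambda>t. v' + Iop g' t) f'" using r r' by (simp_all add: rep_def)
  then show "ham_eq a b H (\<lambda>t. (v + v') + Iop (\<lambda>t. g t + g' t) t) (\<lambda>t. f t + f' t)"
    using AE_space unfolding ham_eq_def
  proof eventually_elim
    case (elim t)
    then have t: "a < t" "t < b" by auto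
    have "ham_app H (\<lambda>t. (v + v') + Iop (\<lambda>t. g t + g' t) t) t = ham_app H (\<lambda>t. (v + Iop g t) + (v' + Iop g' t)) t"
      using Iop_add[OF a t] by (simp add: ham_app_def add_ac)
    also have "\<dots> = ham_app H (\<lambda>t. f t + f' t) t"
      unfolding ham_app_linear(1)[of H "\<lambda>t. v + Iop g t" "\<lambda>t. v' + Iop g' t"] ham_app_linear(1)[of H f f']
      using elim by simp
    finally show ?case .
  qed
qed

lemma rep_scale:
  assumes r: "rep f g v"
  shows "rep (\<lambda>t. c *s f t) (\<lambda>t. c *s g t) (c *s v)"
  unfolding rep_def
proof
  have a: "adm g" using r by (simp add: rep_def)
  then show "adm (\<lambda>t. c *s g t)" by (rule adm_scale)
  have "ham_eq a b H (\<lambda>t. v + Iop g t) f" using r by (simp add: rep_def)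
  then show "ham_eq a b H (\<lambda>t. c *s v + Iop (\<lambda>t. c *s g t) t) (\<lambda>t. c *s f t)"
    using AE_space unfolding ham_eq_def
  proof eventually_elim
    case (elim t)
    then have t: "a < t" "t < b" by auto
    have "ham_app H (\<lambda>t. c *s v + Iop (\<lambda>t. c *s g t) t) t = ham_app H (\<lambda>t. c *s (v + Iop g t)) t"
      using Iop_scale[OF a t] by (simp add: ham_app_def vector_add_ldistrib)
    also have "\<dots> = ham_app H (\<lambda>t. c *s f t) t"
      unfolding ham_app_linear(3)[of H c "\<lambda>t. v + Iop g t"] ham_app_linear(3)[of H c f]
      using elim by simp
    finally show ?case .
  qed
qed

lemma rep_zero: "rep (\<lambda>_. 0) (\<lambda>_. 0) 0"
  unfolding rep_def ham_eq_def by (simp add: adm_zero Iop_def J_ham_app_zero)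

lemma rep_const: "rep (\<lambda>_. v) (\<lambda>_. 0) v"
  unfolding rep_def ham_eq_def by (simp add: adm_zero Iop_def J_ham_app_zero)

lemma rep_sum:
  assumes "finite A" "\<And>i. i \<in> A \<Longrightarrow> rep (f i) (g i) (v i)"
  shows "rep (\<lambda>t. \<Sum>i\<in>A. f i t) (\<lambda>t. \<Sum>i\<in>A. g i t) (\<Sum>i\<in>A. v i)"
  using assms
proof (induction A rule: finite_induct)
  case (insert x F)
  then have "rep (\<lambda>t. f x t + (\<Sum>i\<in>F. f i t)) (\<lambda>t. g x t + (\<Sum>i\<in>F. g i t)) (v x + (\<Sum>i\<in>F. v i))"
    by (intro rep_add) auto
  then show ?case using insert by simp
qed (simp add: rep_zero)

lemma w_gen_rep:
  "rep (w_gen Iop \<omega> n) (\<lambda>t. if n = 0 then 0 else w_gen Iop \<omega> (n - 1) t) (vector [0, \<omega> n])"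
proof (cases n)
  case 0
  then show ?thesis using rep_const by (simp add: w_gen_0)
next
  case (Suc m)
  have "rep (\<lambda>t. vector [0, \<omega> n] + Iop (w_gen Iop \<omega> m) t) (w_gen Iop \<omega> m) (vector [0, \<omega> n])"
    unfolding rep_def ham_eq_def by (simp add: w_gen_adm)
  then show ?thesis by (rule rep_cong_eq) (simp_all add: Suc w_gen_Suc)
qed

lemma ac_rep_imp_rep:
  assumes "adm g" "ac_rep a b H f g fh" "(fh \<longlongrightarrow> v) E"
  shows "rep f g v"
proof -
  obtain u where "ham_eq a b H (\<lambda>t. u + Iop g t) f" "(fh \<longlongrightarrow> u) E"
    by (rule ac_repE[OF assms(1,2)])
  moreover from this have "u = v" using tendsto_unique[OF E_nontrivial _ assms(3)] by simp
  ultimately show ?thesis using assms(1) by (simp add: rep_def)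
qed

lemma rep_imp_ac_rep:
  assumes r: "rep f g v" and fh: "\<And>t. a < t \<Longrightarrow> t < b \<Longrightarrow> fh t = v + Iop g t"
  shows "ac_rep a b H f g fh" "(fh \<longlongrightarrow> v) E"
proof -
  have g: "adm g" and eq: "ham_eq a b H (\<lambda>t. v + Iop g t) f" using r by (simp_all add: rep_def)
  have "ham_eq a b H fh f"
    using eq AE_space unfolding ham_eq_def by eventually_elim (simp add: fh ham_app_def)
  then show "ac_rep a b H f g fh" using fh by (rule ac_repI[OF g])
  show "(fh \<longlongrightarrow> v) E" by (rule rep_tendsto[OF g fh])
qed

lemma Tmax_rep_iff: "(f, g) \<in> Tmax a b H \<longleftrightarrow> f \<in> LL \<and> g \<in> LL \<and> (\<exists>v. rep f g v)"
  unfolding Tmax_iff rep_def using L2_adm by auto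

lemma value_rep:
  "\<not> indivisible H a b \<Longrightarrow> rep f g v \<Longrightarrow> (THE v. \<exists>fh. ac_rep a b H f g fh \<and> (fh \<longlongrightarrow> v) E) = v"
  unfolding rep_def by (elim conjE) (rule value_eq)

lemma indivisible_rep_2: "indivisible H a b \<Longrightarrow> f \<in> LL \<Longrightarrow> rep f g v \<Longrightarrow> v $ 2 = 0"
  unfolding rep_def by (elim conjE) (rule indivisible_value_2)

text \<open>
  The first component of the boundary value can be changed at will, since the constant $(1,0)^T$ is
  zero as a class.
\<close>

lemma indivisible_rep_shift:
  assumes i: "indivisible H a b" and r: "rep f g v" and eq: "v $ 2 = v' $ 2"
  shows "rep f g v'"
proof -
  have g: "adm g" and r: "ham_eq a b H (\<lambda>t. v + Iop g t) f" using r by (simp_all add: rep_def)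
  have "ham_eq a b H (\<lambda>t. v + Iop g t) (\<lambda>t. v' + Iop g t)"
    by (rule indivisible_ham_app_0[OF i]) (simp add: eq)
  then have "ham_eq a b H (\<lambda>t. v' + Iop g t) f"
    using r unfolding ham_eq_def by eventually_elim simp
  then show ?thesis using g by (simp add: rep_def)
qed

end

lemma ham_eq_sym:
  assumes "ham_eq a b H f g" shows "ham_eq a b H g f"
  using assms unfolding ham_eq_def by eventually_elim simp

lemma ham_eq_trans:
  assumes "ham_eq a b H f g" "ham_eq a b H g k" shows "ham_eq a b H f k"
  using assms unfolding ham_eq_def by eventually_elim simp

lemma ham_eq_refl: "ham_eq a b H f f"
  by (simp add: ham_eq_def)

lemma ham_eq_diff:
  assumes "ham_eq a b H f g" "ham_eq a b H f' g'"
  shows "ham_eq a b H (\<lambda>t. f t - f' t) (\<lambda>t. g t - g' t)"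
  using assms unfolding ham_eq_def by eventually_elim (simp add: ham_app_linear)

section \<open>The two half-intervals of an elementary indefinite Hamiltonian\<close>

lemma integrable_lebesgue_on_Un:
  fixes f :: "real \<Rightarrow> 'b::{banach, second_countable_topology}"
  assumes "integrable (lebesgue_on A) f" "integrable (lebesgue_on B) f" "A \<in> sets lebesgue" "B \<in> sets lebesgue"
  shows "integrable (lebesgue_on (A \<union> B)) f"
proof -
  have "set_integrable lebesgue A f" "set_integrable lebesgue B f"
    using assms by (simp_all add: integrable_restrict_space set_integrable_def)
  then have "set_integrable lebesgue (A \<union> B) f" by (rule set_integrable_Un) (use assms in auto)
  then show ?thesis using assms by (simp add: integrable_restrict_space set_integrable_def)
qed

lemma kind_A_left:
  assumes h: "kind_A h"
  shows "half_ham (sm h) (sig h) (Ham h) (\<lambda>t. {sm h<..<t}) 1 (int_op_left (sm h) (Ham h)) (at_right (sm h))"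
proof
  show "sm h < sig h" "hamiltonian (sm h) (sig h) (Ham h)" using h by (simp_all add: kind_A_def)
  note hd = this
  show "int_op_left (sm h) (Ham h) f t = 1 *\<^sub>R (LINT s|lebesgue_on {sm h<..<t}. J_ham_app (Ham h) f s)" for f t
    by (simp add: int_op_left_def)
  obtain c where c: "sm h < c" "c < sig h" "integrable (lebesgue_on {sm h<..<c}) (Ham h)"
    using h unfolding kind_A_def limit_circle_left_def by blast
  show "integrable (lebesgue_on {sm h<..<t}) (Ham h)" if t: "sm h < t" "t < sig h" for t
  proof (cases "t \<le> c")
    case True
    then show ?thesis by (intro integrable_lebesgue_on_subset[OF c(3)]) auto
  next
    case False
    have "integrable (lebesgue_on {c..t}) (Ham h)" using hd c t False by (auto simp: hamiltonian_def)
    then have "integrable (lebesgue_on ({sm h<..<c} \<union> {c..t})) (Ham h)"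
      by (intro integrable_lebesgue_on_Un c(3)) auto
    then show ?thesis by (rule integrable_lebesgue_on_subset) auto
  qed
  show "\<not> integrable (lebesgue_on {sm h<..<sig h}) (Ham h)"
  proof
    assume i: "integrable (lebesgue_on {sm h<..<sig h}) (Ham h)"
    define c where "c = (sm h + sig h) / 2"
    have c: "sm h < c" "c < sig h" using hd by (auto simp: c_def)
    have "integrable (lebesgue_on {c<..<sig h}) (Ham h)"
      by (rule integrable_lebesgue_on_subset[OF i]) (use c in auto)
    then have "limit_circle_right (sm h) (sig h) (Ham h)" using c unfolding limit_circle_right_def by blast
    then show False using h by (simp add: kind_A_def)
  qed
  show "integrable (lebesgue_on {sm h<..<sig h}) (\<lambda>t. Ham h t $ 1 $ 1)"
    using h by (simp add: kind_A_def cond_I_def)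
  show "integrable (lebesgue_on {sm h<..<sig h}) (\<lambda>t. (LINT s|lebesgue_on {sm h<..<t}. Ham h s $ 2 $ 2) * Ham h t $ 1 $ 1)"
    using h by (simp add: kind_A_def cond_HS_left_def)
qed simp

lemma kind_A_right:
  assumes h: "kind_A h"
  shows "half_ham (sig h) (sp h) (Ham h) (\<lambda>t. {t<..<sp h}) (- 1) (int_op_right (sp h) (Ham h)) (at_left (sp h))"
proof
  show "sig h < sp h" "hamiltonian (sig h) (sp h) (Ham h)" using h by (simp_all add: kind_A_def)
  note hd = this
  show "int_op_right (sp h) (Ham h) f t = (- 1) *\<^sub>R (LINT s|lebesgue_on {t<..<sp h}. J_ham_app (Ham h) f s)" for f t
    by (simp add: int_op_right_def)
  obtain c where c: "sig h < c" "c < sp h" "integrable (lebesgue_on {c<..<sp h}) (Ham h)"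
    using h unfolding kind_A_def limit_circle_right_def by blast
  show "integrable (lebesgue_on {t<..<sp h}) (Ham h)" if t: "sig h < t" "t < sp h" for t
  proof (cases "c \<le> t")
    case True
    then show ?thesis by (intro integrable_lebesgue_on_subset[OF c(3)]) auto
  next
    case False
    have "integrable (lebesgue_on {t..c}) (Ham h)" using hd c t False by (auto simp: hamiltonian_def)
    then have "integrable (lebesgue_on ({t..c} \<union> {c<..<sp h})) (Ham h)"
      by (intro integrable_lebesgue_on_Un c(3)) auto
    then show ?thesis by (rule integrable_lebesgue_on_subset) auto
  qed
  show "\<not> integrable (lebesgue_on {sig h<..<sp h}) (Ham h)"
  proof
    assume i: "integrable (lebesgue_on {sig h<..<sp h}) (Ham h)"
    define c where "c = (sig h + sp h) / 2"
    have c: "sig h < c" "c < sp h" using hd by (auto simp: c_def)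
    have "integrable (lebesgue_on {sig h<..<c}) (Ham h)"
      by (rule integrable_lebesgue_on_subset[OF i]) (use c in auto)
    then have "limit_circle_left (sig h) (sp h) (Ham h)" using c unfolding limit_circle_left_def by blast
    then show False using h by (simp add: kind_A_def)
  qed
  show "integrable (lebesgue_on {sig h<..<sp h}) (\<lambda>t. Ham h t $ 1 $ 1)"
    using h by (simp add: kind_A_def cond_I_def)
  show "integrable (lebesgue_on {sig h<..<sp h}) (\<lambda>t. (LINT s|lebesgue_on {t<..<sp h}. Ham h s $ 2 $ 2) * Ham h t $ 1 $ 1)"
    using h by (simp add: kind_A_def cond_HS_right_def)
qed simp

locale kind_A_ham =
  fixes h :: indef_ham
  assumes kind: "kind_A h"

sublocale kind_A_ham \<subseteq> L: half_ham "sm h" "sig h" "Ham h" "\<lambda>t. {sm h<..<t}" 1 "int_op_left (sm h) (Ham h)" "at_right (sm h)"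
  by (rule kind_A_left[OF kind])

sublocale kind_A_ham \<subseteq> R: half_ham "sig h" "sp h" "Ham h" "\<lambda>t. {t<..<sp h}" "- 1" "int_op_right (sp h) (Ham h)" "at_left (sp h)"
  by (rule kind_A_right[OF kind])

context kind_A_ham
begin

lemma orders:
  obtains nm np where "order_minus h = enat nm" "order_plus h = enat np" "Delta h = max nm np"
proof -
  have "order_minus h \<noteq> \<infinity>" "order_plus h \<noteq> \<infinity>" using kind by (auto simp: kind_A_def)
  then obtain nm np where "order_minus h = enat nm" "order_plus h = enat np" by auto
  moreover from this have "Delta h = max nm np" by (simp add: Delta_def)
  ultimately show thesis by (rule that)
qed

lemma Delta_order: "order_minus h = enat (Delta h) \<or> order_plus h = enat (Delta h)"
  by (rule orders) (simp add: max_def)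

lemma Delta_pos: "1 \<le> Delta h"
proof (rule orders)
  fix nm np assume "order_minus h = enat nm" "Delta h = max nm np"
  then show "1 \<le> Delta h" using L.order_pos[of nm] by (simp add: order_minus_def)
qed

lemma omega_0: "omega_minus h 0 = 1" "omega_plus h 0 = 1"
  by (rule orders, simp add: omega_minus_def order_minus_def L.omega_seq(1),
      rule orders, simp add: omega_plus_def order_plus_def R.omega_seq(1))

lemma w_left: "t < sig h \<Longrightarrow> w h n t = w_gen (int_op_left (sm h) (Ham h)) (omega_minus h) n t"
  and w_right: "sig h < t \<Longrightarrow> w h n t = w_gen (int_op_right (sp h) (Ham h)) (omega_plus h) n t"
  by (simp_all add: w_def)

lemma w_meas: "w h n \<in> borel_measurable L.M" "w h n \<in> borel_measurable R.M"
proof -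
  show "w h n \<in> borel_measurable L.M"
    by (rule measurable_cong[THEN iffD1, OF _ L.iter_sum_meas[of "\<lambda>i. vector [0, omega_minus h i]" n]])
      (simp add: w_left L.w_gen_iter_sum)
  show "w h n \<in> borel_measurable R.M"
    by (rule measurable_cong[THEN iffD1, OF _ R.iter_sum_meas[of "\<lambda>i. vector [0, omega_plus h i]" n]])
      (simp add: w_right R.w_gen_iter_sum)
qed

lemma w_Delta_L2: "w h (Delta h) \<in> L.LL" "w h (Delta h) \<in> R.LL"
proof -
  obtain nm np where o: "order_minus h = enat nm" "order_plus h = enat np" "Delta h = max nm np" by (rule orders)
  show "w h (Delta h) \<in> L.LL"
    by (rule L.L2_cong_eq[OF L.omega_seq(2)[of nm "Delta h"]])
      (use o in \<open>simp_all add: order_minus_def w_left omega_minus_def\<close>)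
  show "w h (Delta h) \<in> R.LL"
    by (rule R.L2_cong_eq[OF R.omega_seq(2)[of np "Delta h"]])
      (use o in \<open>simp_all add: order_plus_def w_right omega_plus_def\<close>)
qed

lemma w_rep:
  "L.rep (w h n) (\<lambda>t. if n = 0 then 0 else w h (n - 1) t) (vector [0, omega_minus h n])"
  "R.rep (w h n) (\<lambda>t. if n = 0 then 0 else w h (n - 1) t) (vector [0, omega_plus h n])"
  by (rule L.rep_cong_eq[OF L.w_gen_rep]; simp add: w_left)
    (rule R.rep_cong_eq[OF R.w_gen_rep]; simp add: w_right)

lemma not_both_indivisible: "\<not> (left_indivisible h \<and> right_indivisible h)"
proof
  assume lr: "left_indivisible h \<and> right_indivisible h"
  have lt: "sm h < sig h" "sig h < sp h" using kind by (simp_all add: kind_A_def)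
  have "indivisible (Ham h) (sig h) ((sig h + sp h) / 2)"
  proof -
    obtain \<phi> where "indivisible_of_type (Ham h) \<phi> (sig h) (sp h)" using lr unfolding indivisible_def by auto
    then have "AE t in lebesgue_on {sig h<..<sp h}. range (\<lambda>x. Ham h t *v x) = span {xi_dir \<phi>}"
      by (simp add: indivisible_of_type_def)
    then have "AE t in lebesgue_on {sig h<..<(sig h + sp h) / 2}. range (\<lambda>x. Ham h t *v x) = span {xi_dir \<phi>}"
      by (rule AE_lebesgue_on_subset) (use lt in auto)
    then show ?thesis using lt unfolding indivisible_def indivisible_of_type_def by auto
  qed
  moreover have "(sig h + sp h) / 2 \<in> {sig h<..<sp h}" using lt by auto
  moreover have "sm h \<in> {sm h..<sig h}" using lt by simp
  ultimately show False using kind lr unfolding kind_A_def by auto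
qed

lemma omega_indivisible:
  "left_indivisible h \<Longrightarrow> n \<ge> 1 \<Longrightarrow> omega_minus h n = 0"
  "right_indivisible h \<Longrightarrow> n \<ge> 1 \<Longrightarrow> omega_plus h n = 0"
proof -
  obtain nm np where o: "order_minus h = enat nm" "order_plus h = enat np" by (rule orders)
  show "left_indivisible h \<Longrightarrow> n \<ge> 1 \<Longrightarrow> omega_minus h n = 0"
    using L.indivisible_omega[of nm n] o(1) unfolding omega_minus_def order_minus_def by simp
  show "right_indivisible h \<Longrightarrow> n \<ge> 1 \<Longrightarrow> omega_plus h n = 0"
    using R.indivisible_omega[of np n] o(2) unfolding omega_plus_def order_plus_def by simp
qed

lemma value_minus_rep: "\<not> left_indivisible h \<Longrightarrow> L.rep f g v \<Longrightarrow> value_minus h f g = v"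
  unfolding value_minus_def by (rule L.value_rep)

lemma value_plus_rep: "\<not> right_indivisible h \<Longrightarrow> R.rep f g v \<Longrightarrow> value_plus h f g = v"
  unfolding value_plus_def by (rule R.value_rep)

text \<open>
  It suffices to look at the half-interval whose order is the larger one.
\<close>

lemma w_independent:
  assumes "(\<lambda>t. \<Sum>i\<le>m. \<delta> i *s w h i t) \<in> L2_ham h" and m: "m < Delta h"
  shows "\<delta> m = 0"
proof (rule ccontr)
  assume nz: "\<delta> m \<noteq> 0"
  have l: "(\<lambda>t. \<Sum>i\<le>m. \<delta> i *s w h i t) \<in> L.LL" and r: "(\<lambda>t. \<Sum>i\<le>m. \<delta> i *s w h i t) \<in> R.LL"
    using assms(1) by (auto simp: L2_ham_def)
  have "(\<lambda>t. \<Sum>i\<le>m. \<delta> i *s w_gen (int_op_left (sm h) (Ham h)) (omega_minus h) i t) \<in> L.LL"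
    by (rule L.L2_cong_eq[OF l]) (simp add: w_left)
  then have "order_minus h \<le> enat m" unfolding order_minus_def by (rule L.independent_w[where \<omega>="omega_minus h" and \<delta>=\<delta> and m=m, OF omega_0(1) _ nz])
  moreover have "(\<lambda>t. \<Sum>i\<le>m. \<delta> i *s w_gen (int_op_right (sp h) (Ham h)) (omega_plus h) i t) \<in> R.LL"
    by (rule R.L2_cong_eq[OF r]) (simp add: w_right)
  then have "order_plus h \<le> enat m" unfolding order_plus_def by (rule R.independent_w[where \<omega>="omega_plus h" and \<delta>=\<delta> and m=m, OF omega_0(2) _ nz])
  ultimately show False using Delta_order m by auto
qed

lemma w_independent_all:
  assumes "(\<lambda>t. \<Sum>i<n. \<delta> i *s w h i t) \<in> L2_ham h" "n \<le> Delta h" "i < n"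
  shows "\<delta> i = 0"
  using assms
proof (induction n)
  case (Suc n)
  have "\<delta> n = 0" by (rule w_independent) (use Suc.prems in \<open>auto simp: lessThan_Suc_atMost\<close>)
  then show ?case using Suc by (cases "i = n") auto
qed simp

lemma w_Delta_integral_add:
  assumes "g \<in> L2_ham h" "g' \<in> L2_ham h"
  shows "w_Delta_integral h (\<lambda>t. g t + g' t) = w_Delta_integral h g + w_Delta_integral h g'"
    and "w_Delta_integral h (\<lambda>t. c *s g t) = c * w_Delta_integral h g"
proof -
  have int: "integrable (lebesgue_on ({sm h<..<sig h} \<union> {sig h<..<sp h})) (ham_form (Ham h) (w h (Delta h)) g)"
    if g: "g \<in> L2_ham h" for g
    by (rule integrable_lebesgue_on_Un)
      (use L.L2_form_integrable[OF w_Delta_L2(1), of g] R.L2_form_integrable[OF w_Delta_L2(2), of g] g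
        in \<open>auto simp: L2_ham_def\<close>)
  have 1: "ham_form (Ham h) k (\<lambda>t. g t + g' t) = (\<lambda>t. ham_form (Ham h) k g t + ham_form (Ham h) k g' t)" for k
    by (rule ext) (rule ham_form_linear_right)
  have 2: "ham_form (Ham h) k (\<lambda>t. c *s g t) = (\<lambda>t. c * ham_form (Ham h) k g t)" for k
    by (rule ext) (rule ham_form_linear_right)
  show "w_Delta_integral h (\<lambda>t. g t + g' t) = w_Delta_integral h g + w_Delta_integral h g'"
    unfolding w_Delta_integral_def 1 by (rule Bochner_Integration.integral_add[OF int[OF assms(1)] int[OF assms(2)]])
  show "w_Delta_integral h (\<lambda>t. c *s g t) = c * w_Delta_integral h g"
    unfolding w_Delta_integral_def 2 by simp
qed

lemma w_Delta_integral_cong: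
  assumes eq: "ham_equal h g g'" and m: "g \<in> borel_measurable L.M" "g \<in> borel_measurable R.M"
    "g' \<in> borel_measurable L.M" "g' \<in> borel_measurable R.M"
  shows "w_Delta_integral h g = w_Delta_integral h g'"
proof -
  have "AE t in lebesgue_on ({sm h<..<sig h} \<union> {sig h<..<sp h}). ham_form (Ham h) (w h (Delta h)) g t = ham_form (Ham h) (w h (Delta h)) g' t"
  proof -
    have "AE t in lebesgue. t \<in> {sm h<..<sig h} \<longrightarrow> ham_app (Ham h) g t = ham_app (Ham h) g' t"
      "AE t in lebesgue. t \<in> {sig h<..<sp h} \<longrightarrow> ham_app (Ham h) g t = ham_app (Ham h) g' t"
      using eq by (simp_all add: ham_equal_def ham_eq_def AE_restrict_space_iff)
    then have "AE t in lebesgue. t \<in> {sm h<..<sig h} \<union> {sig h<..<sp h} \<longrightarrow>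
        ham_form (Ham h) (w h (Delta h)) g t = ham_form (Ham h) (w h (Delta h)) g' t"
      by eventually_elim (auto simp: ham_form_expand)
    moreover have "{sm h<..<sig h} \<union> {sig h<..<sp h} \<in> sets lebesgue" by simp
    ultimately show ?thesis by (subst AE_restrict_space_iff) auto
  qed
  moreover have "ham_form (Ham h) (w h (Delta h)) k \<in> borel_measurable (lebesgue_on ({sm h<..<sig h} \<union> {sig h<..<sp h}))"
    if "k \<in> borel_measurable L.M" "k \<in> borel_measurable R.M" for k
  proof -
    let ?A = "{sm h<..<sig h}" and ?B = "{sig h<..<sp h}" and ?F = "ham_form (Ham h) (w h (Delta h)) k"
    have "?F \<in> borel_measurable L.M" "?F \<in> borel_measurable R.M"
      using that by (auto intro!: borel_measurable_ham_form L.H_meas R.H_meas w_meas)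
    then have "(\<lambda>t. indicator ?A t *\<^sub>R ?F t + indicator ?B t *\<^sub>R ?F t) \<in> borel_measurable lebesgue"
      by (intro borel_measurable_add) (simp_all add: borel_measurable_restrict_space_iff)
    moreover have "indicator ?A t *\<^sub>R ?F t + indicator ?B t *\<^sub>R ?F t = indicator (?A \<union> ?B) t *\<^sub>R ?F t" for t
      by (auto simp: indicator_def)
    ultimately show ?thesis by (simp add: borel_measurable_restrict_space_iff)
  qed
  ultimately show ?thesis unfolding w_Delta_integral_def using m by (intro integral_cong_AE) auto
qed

end

section \<open>The span of the generators\<close>

lemma scale_graph_Pair:
  "scale_graph c (((f, x, y), (g, x', y')), (v, v')) =
    (((\<lambda>t. c *s f t, \<lambda>i. c * x i, \<lambda>i. c * y i), (\<lambda>t. c *s g t, \<lambda>i. c * x' i, \<lambda>i. c * y' i)), (c *s v, c *s v'))"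
  by (simp add: scale_graph_def scale_pair_def scale_model_def)

lemma graph_plus:
  "((((f :: real \<Rightarrow> complex^2), (x :: nat \<Rightarrow> complex), (y :: nat \<Rightarrow> complex)),
      ((g :: real \<Rightarrow> complex^2), (x' :: nat \<Rightarrow> complex), (y' :: nat \<Rightarrow> complex))), ((v :: complex^2), (v' :: complex^2)))
    + (((F, X, Y), (G, X', Y')), (V, V'))
    = (((\<lambda>t. f t + F t, \<lambda>i. x i + X i, \<lambda>i. y i + Y i), (\<lambda>t. g t + G t, \<lambda>i. x' i + X' i, \<lambda>i. y' i + Y' i)), (v + V, v' + V'))"
  by (simp add: plus_fun_def)

lemma graph_zero:
  "(0 :: (model_vec \<times> model_vec) \<times> boundary_val) =
    (((\<lambda>_. 0, \<lambda>_. 0, \<lambda>_. 0), (\<lambda>_. 0, \<lambda>_. 0, \<lambda>_. 0)), (0, 0))"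
  by (simp add: zero_prod_def zero_fun_def)

lemma scale_graph_sum:
  assumes "finite K"
  shows "(\<Sum>k\<in>K. scale_graph (u k) (((f k, x k, y k), (g k, x' k, y' k)), (v k, v' k))) =
    (((\<lambda>t. \<Sum>k\<in>K. u k *s f k t, \<lambda>i. \<Sum>k\<in>K. u k * x k i, \<lambda>i. \<Sum>k\<in>K. u k * y k i),
      (\<lambda>t. \<Sum>k\<in>K. u k *s g k t, \<lambda>i. \<Sum>k\<in>K. u k * x' k i, \<lambda>i. \<Sum>k\<in>K. u k * y' k i)),
     (\<Sum>k\<in>K. u k *s v k, \<Sum>k\<in>K. u k *s v' k))"
  using assms
  by (induction K rule: finite_induct) (simp_all only: sum.empty sum.insert graph_zero scale_graph_Pair graph_plus not_False_eq_True)

context kind_A_ham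
begin

text \<open>
  What \<open>gen_a\<close> demands of the coordinates; the number \<open>W\<close> stands for the integral
  $\int w_\Delta^*Hg$.
\<close>

definition shifted :: "(nat \<Rightarrow> complex) \<Rightarrow> (nat \<Rightarrow> complex) \<Rightarrow> complex \<Rightarrow> bool" where
  "shifted \<xi> \<eta> W \<longleftrightarrow>
     \<xi> \<in> coord_vecs {..<Delta h} \<and> \<eta> \<in> coord_vecs {..<Delta h} \<and> \<eta> 0 = 0 \<and>
     (\<forall>k. 1 \<le> k \<and> k < Delta h \<longrightarrow> \<eta> k = \<xi> (k - 1)) \<and> \<xi> (Delta h - 1) = W"

text \<open>
  The data of a generator \<open>gen_a\<close>, with the derivative expressed by \<open>rep\<close>.
\<close>

definition typeA where
  "typeA fa ga \<xi> \<eta> vm vp \<longleftrightarrow>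
     fa \<in> L2_ham h \<and> ga \<in> L2_ham h \<and> L.rep fa ga vm \<and> R.rep fa ga vp \<and> vm $ 1 = 0 \<and> vp $ 1 = 0 \<and>
     shifted \<xi> \<eta> (w_Delta_integral h ga)"

lemma typeA_generator:
  assumes t: "typeA fa ga \<xi> \<eta> vm vp"
  shows "(((fa, \<xi>, 0), (ga, \<eta>, 0)), (vm, vp)) \<in> generators h"
proof -
  note t = t[unfolded typeA_def shifted_def]
  define fh where "fh t = (if t < sig h then vm + int_op_left (sm h) (Ham h) ga t else vp + int_op_right (sp h) (Ham h) ga t)" for t
  have l: "ac_rep (sm h) (sig h) (Ham h) fa ga fh" "(fh \<longlongrightarrow> vm) (at_right (sm h))"
    using t by (auto intro!: L.rep_imp_ac_rep[of fa ga vm] simp: fh_def)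
  have r: "ac_rep (sig h) (sp h) (Ham h) fa ga fh" "(fh \<longlongrightarrow> vp) (at_left (sp h))"
    using t by (auto intro!: R.rep_imp_ac_rep[of fa ga vp] simp: fh_def)
  have T: "(fa, ga) \<in> Tmax_ham h"
    unfolding Tmax_ham_def Int_iff L.Tmax_rep_iff R.Tmax_rep_iff using t by (auto simp: L2_ham_def)
  show ?thesis
    by (rule gen_a[OF T l(1) r(1) l(2) r(2)]) (use t in auto)
qed

definition b_plus_gen :: "(model_vec \<times> model_vec) \<times> boundary_val" where
  "b_plus_gen = (((\<lambda>t. if sig h < t \<and> t < sp h then vector [1, 0] else 0,
       \<lambda>i. if i < Delta h then omega_plus h (i + 1) else 0, \<lambda>_. 0),
     (\<lambda>_. 0, \<lambda>i. if i = 0 then - 1 else 0, \<lambda>_. 0)), (0, vector [1, 0]))"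

definition b_minus_gen :: "(model_vec \<times> model_vec) \<times> boundary_val" where
  "b_minus_gen = (((\<lambda>t. if sm h < t \<and> t < sig h then vector [1, 0] else 0,
       \<lambda>i. if i < Delta h then - omega_minus h (i + 1) else 0, \<lambda>_. 0),
     (\<lambda>_. 0, \<lambda>i. if i = 0 then 1 else 0, \<lambda>_. 0)), (vector [1, 0], 0))"

text \<open>
  The generators \<open>gen_c_0\<close>, \<open>gen_c\<close> and \<open>gen_c_Delta\<close> as one family indexed by $0,\dots,\Delta$.
\<close>

definition c_gen :: "nat \<Rightarrow> (model_vec \<times> model_vec) \<times> boundary_val" where
  "c_gen k = (((w h k,
       \<lambda>i. if i < Delta h then (if k < Delta h then of_real (dpar h (k + i)) / 2 else of_real (dpar h (Delta h + i))) else 0,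
       \<lambda>j. if k = Delta h \<and> 1 \<le> j \<and> j \<le> o2 h then of_real (bpar h (o2 h + 1 - j)) else 0),
     (\<lambda>t. if k = 0 then 0 else w h (k - 1) t,
       \<lambda>i. if 1 \<le> k \<and> i < Delta h then of_real (dpar h (k - 1 + i)) / 2 - (if i = 0 then of_real (dpar h (k - 1)) else 0) else 0,
       \<lambda>_. 0)), (vector [0, omega_minus h k], vector [0, omega_plus h k]))"

definition d_gen :: "nat \<Rightarrow> (model_vec \<times> model_vec) \<times> boundary_val" where
  "d_gen k = (((\<lambda>_. 0, \<lambda>i. if k = Delta h \<and> i = Delta h - 1 then - 1 else 0,
       \<lambda>j. if Delta h < k \<and> Delta h + j = k then 1 else 0),
     (\<lambda>_. 0, \<lambda>_. 0, \<lambda>j. if Delta h + j = k + 1 then 1 else 0)), (0, 0))"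

lemma b_plus_gen_eq: "b_plus_gen = ((e_plus h, delta_vec h 0), (0, vector [1, 0]))"
  using Delta_pos by (simp add: b_plus_gen_def e_plus_def delta_vec_def zero_fun_def)

lemma b_minus_gen_eq: "b_minus_gen = ((e_minus h, scale_model (- 1) (delta_vec h 0)), (vector [1, 0], 0))"
  using Delta_pos by (simp add: b_minus_gen_def e_minus_def delta_vec_def scale_model_def zero_fun_def fun_eq_iff)

lemma c_gen_0: "c_gen 0 = ((p_vec h 0, 0), (vector [0, 1], vector [0, 1]))"
  using Delta_pos by (simp add: c_gen_def p_vec_def zero_fun_def zero_prod_def fun_eq_iff omega_0)

lemma c_gen_k:
  assumes "1 \<le> k" "k < Delta h"
  shows "c_gen k = ((p_vec h k, p_vec h (k - 1) + scale_model (of_real (dpar h (k - 1))) (delta_vec h 0)),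
      (vector [0, omega_minus h k], vector [0, omega_plus h k]))"
  using assms Delta_pos by (simp add: c_gen_def p_vec_def scale_model_def delta_vec_def zero_fun_def plus_fun_def fun_eq_iff)

lemma c_gen_Delta:
  "c_gen (Delta h) = ((q_vec h, p_vec h (Delta h - 1) + scale_model (of_real (dpar h (Delta h - 1))) (delta_vec h 0)),
      (vector [0, omega_minus h (Delta h)], vector [0, omega_plus h (Delta h)]))"
  using Delta_pos by (simp add: c_gen_def p_vec_def q_vec_def scale_model_def delta_vec_def zero_fun_def plus_fun_def fun_eq_iff)

lemma d_gen_eq:
  assumes "Delta h \<le> k"
  shows "d_gen k = ((delta_vec h (k - 1), delta_vec h k), (0, 0))"
proof (cases "k = Delta h")
  case True
  then show ?thesis using Delta_pos by (simp add: d_gen_def delta_vec_def zero_fun_def fun_eq_iff)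
next
  case False
  then show ?thesis using assms Delta_pos by (simp add: d_gen_def delta_vec_def zero_fun_def fun_eq_iff)
qed

lemma generators_mem:
  "b_plus_gen \<in> generators h" "b_minus_gen \<in> generators h"
  "k \<le> Delta h \<Longrightarrow> c_gen k \<in> generators h"
  "Delta h \<le> k \<Longrightarrow> k < Delta h + o2 h \<Longrightarrow> d_gen k \<in> generators h"
proof -
  show "b_plus_gen \<in> generators h" unfolding b_plus_gen_eq by (rule gen_b_plus)
  show "b_minus_gen \<in> generators h" unfolding b_minus_gen_eq by (rule gen_b_minus)
  show "c_gen k \<in> generators h" if "k \<le> Delta h"
  proof -
    consider (zero) "k = 0" | (inner) "k \<noteq> 0 \<and> k \<noteq> Delta h" | (last) "k = Delta h" by auto
    then show ?thesis
    proof cases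
      case zero
      then show ?thesis by (simp only: c_gen_0 gen_c_0)
    next
      case inner
      then have k: "1 \<le> k" "k < Delta h" using that by auto
      show ?thesis unfolding c_gen_k[OF k] by (rule gen_c[OF k])
    next
      case last
      then show ?thesis by (simp only: c_gen_Delta gen_c_Delta)
    qed
  qed
  show "d_gen k \<in> generators h" if "Delta h \<le> k" "k < Delta h + o2 h"
    unfolding d_gen_eq[OF that(1)] by (rule gen_d[OF that])
qed

lemma generators_cases:
  assumes "x \<in> generators h"
  shows "(\<exists>fa ga \<xi> \<eta> vm vp. typeA fa ga \<xi> \<eta> vm vp \<and> x = (((fa, \<xi>, 0), (ga, \<eta>, 0)), (vm, vp))) \<or>
    x = b_plus_gen \<or> x = b_minus_gen \<or> (\<exists>k\<le>Delta h. x = c_gen k) \<or>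
    (\<exists>k. Delta h \<le> k \<and> k < Delta h + o2 h \<and> x = d_gen k)"
proof -
  define a1 a2 a3 a4 where "a1 = fst (fst x)" "a2 = snd (fst x)" "a3 = fst (snd x)" "a4 = snd (snd x)"
  then have x: "x = ((a1, a2), (a3, a4))" by simp
  have "((a1, a2), (a3, a4)) \<in> generators h" using assms x by simp
  then show ?thesis
  proof (cases rule: generators.cases)
  case (gen_a f g fh \<xi> \<eta>)
  then have fg: "f \<in> L.LL" "g \<in> L.LL" "f \<in> R.LL" "g \<in> R.LL"
    by (auto simp: Tmax_ham_def L.Tmax_rep_iff R.Tmax_rep_iff)
  have "L.rep f g a3" by (rule L.ac_rep_imp_rep[OF L.L2_adm[OF fg(2)]]) (use gen_a in auto)
  moreover have "R.rep f g a4" by (rule R.ac_rep_imp_rep[OF R.L2_adm[OF fg(4)]]) (use gen_a in auto)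
  ultimately have "typeA f g \<xi> \<eta> a3 a4" using gen_a fg by (auto simp: typeA_def shifted_def L2_ham_def)
  then show ?thesis using gen_a x by (intro disjI1 exI conjI) auto
next
  case gen_b_plus
  then show ?thesis by (simp add: b_plus_gen_eq x)
next
  case gen_b_minus
  then show ?thesis by (simp add: b_minus_gen_eq x)
next
  case gen_c_0
  then have "x = c_gen 0" by (simp add: c_gen_0 x)
  then show ?thesis by blast
next
  case (gen_c k)
  then have "x = c_gen k" "k \<le> Delta h" by (simp_all add: c_gen_k x)
  then show ?thesis by blast
next
  case gen_c_Delta
  then have "x = c_gen (Delta h)" by (simp add: c_gen_Delta x)
  then show ?thesis by blast
next
  case (gen_d k)
  then have "x = d_gen k" by (simp add: d_gen_eq x)
  then show ?thesis using gen_d by blast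
qed
qed

lemma typeA_zero: "typeA (\<lambda>_. 0) (\<lambda>_. 0) (\<lambda>_. 0) (\<lambda>_. 0) 0 0"
proof -
  have "(\<lambda>_. 0) \<in> L2_ham h" by (simp add: L2_ham_def L.L2_zero R.L2_zero)
  from w_Delta_integral_add(2)[OF this this, of 0] have "w_Delta_integral h (\<lambda>_. 0) = 0" by simp
  then show ?thesis
    by (simp add: typeA_def shifted_def L2_ham_def L.L2_zero R.L2_zero L.rep_zero R.rep_zero coord_vecs_def)
qed

text \<open>
  Linearity of $g\mapsto\int w_\Delta^*Hg$ enters here.
\<close>

lemma typeA_add:
  assumes "typeA f g \<xi> \<eta> u v" "typeA f' g' \<xi>' \<eta>' u' v'"
  shows "typeA (\<lambda>t. f t + f' t) (\<lambda>t. g t + g' t) (\<lambda>i. \<xi> i + \<xi>' i) (\<lambda>i. \<eta> i + \<eta>' i) (u + u') (v + v')"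
  using assms w_Delta_integral_add(1)[of g g'] unfolding typeA_def shifted_def L2_ham_def Int_iff
  by (auto intro!: L.L2_add R.L2_add L.rep_add R.rep_add simp: coord_vecs_def)

lemma typeA_scale:
  assumes "typeA f g \<xi> \<eta> u v"
  shows "typeA (\<lambda>t. c *s f t) (\<lambda>t. c *s g t) (\<lambda>i. c * \<xi> i) (\<lambda>i. c * \<eta> i) (c *s u) (c *s v)"
  using assms w_Delta_integral_add(2)[of g g c] unfolding typeA_def shifted_def L2_ham_def Int_iff
  by (auto intro!: L.L2_scale R.L2_scale L.rep_scale R.rep_scale simp: coord_vecs_def)

definition comb where
  "comb x ap am c \<tau> = x + scale_graph ap b_plus_gen + scale_graph am b_minus_gen
     + (\<Sum>k\<le>Delta h. scale_graph (c k) (c_gen k)) + (\<Sum>k\<in>{Delta h..<Delta h + o2 h}. scale_graph (\<tau> k) (d_gen k))"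

definition elemA :: "(model_vec \<times> model_vec) \<times> boundary_val \<Rightarrow> bool" where
  "elemA x \<longleftrightarrow> (\<exists>fa ga \<xi> \<eta> vm vp. typeA fa ga \<xi> \<eta> vm vp \<and> x = (((fa, \<xi>, \<lambda>_. 0), (ga, \<eta>, \<lambda>_. 0)), (vm, vp)))"

lemma elemA_zero: "elemA 0"
  unfolding elemA_def graph_zero using typeA_zero by (intro exI conjI) (assumption, rule refl)

lemma elemA_add:
  assumes "elemA x" "elemA y" shows "elemA (x + y)"
proof -
  obtain f g \<xi> \<eta> u v where x: "typeA f g \<xi> \<eta> u v" "x = (((f, \<xi>, \<lambda>_. 0), (g, \<eta>, \<lambda>_. 0)), (u, v))"
    using assms(1) unfolding elemA_def by (elim exE conjE)
  obtain f' g' \<xi>' \<eta>' u' v' where y: "typeA f' g' \<xi>' \<eta>' u' v'" "y = (((f', \<xi>', \<lambda>_. 0), (g', \<eta>', \<lambda>_. 0)), (u', v'))"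
    using assms(2) unfolding elemA_def by (elim exE conjE)
  have "x + y = (((\<lambda>t. f t + f' t, \<lambda>i. \<xi> i + \<xi>' i, \<lambda>_. 0), (\<lambda>t. g t + g' t, \<lambda>i. \<eta> i + \<eta>' i, \<lambda>_. 0)), (u + u', v + v'))"
    unfolding x(2) y(2) graph_plus by simp
  then show ?thesis unfolding elemA_def using typeA_add[OF x(1) y(1)] by (intro exI conjI)
qed

lemma elemA_scale:
  assumes "elemA x" shows "elemA (scale_graph c x)"
proof -
  obtain f g \<xi> \<eta> u v where x: "typeA f g \<xi> \<eta> u v" "x = (((f, \<xi>, \<lambda>_. 0), (g, \<eta>, \<lambda>_. 0)), (u, v))"
    using assms(1) unfolding elemA_def by (elim exE conjE)
  have "scale_graph c x = (((\<lambda>t. c *s f t, \<lambda>i. c * \<xi> i, \<lambda>_. 0), (\<lambda>t. c *s g t, \<lambda>i. c * \<eta> i, \<lambda>_. 0)), (c *s u, c *s v))"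
    unfolding x(2) scale_graph_Pair by simp
  then show ?thesis unfolding elemA_def using typeA_scale[OF x(1)] by (intro exI conjI)
qed

interpretation G: vector_space scale_graph by (rule vector_space_scale_graph)

lemma span_generators:
  "x \<in> module.span scale_graph (generators h) \<longleftrightarrow> (\<exists>a ap am c \<tau>. elemA a \<and> x = comb a ap am c \<tau>)"
proof
  assume "x \<in> module.span scale_graph (generators h)"
  then show "\<exists>a ap am c \<tau>. elemA a \<and> x = comb a ap am c \<tau>"
  proof (induction rule: G.span_induct_alt)
    case base
    have "0 = comb 0 0 0 (\<lambda>_. 0) (\<lambda>_. 0)" by (simp add: comb_def)
    then show ?case using elemA_zero by blast
  next
    case (step r x y)
    obtain a ap am c \<tau> where y: "elemA a" "y = comb a ap am c \<tau>" using step.IH by (elim exE conjE)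
    have delta: "scale_graph (e k + (if k = j then r else 0)) z = scale_graph (e k) z + (if k = j then scale_graph r z else 0)"
      for e :: "nat \<Rightarrow> complex" and k j z by (simp add: G.scale_left_distrib)
    consider (A) "elemA x" | (P) "x = b_plus_gen" | (M) "x = b_minus_gen"
      | (C) j where "j \<le> Delta h" "x = c_gen j" | (D) j where "j \<in> {Delta h..<Delta h + o2 h}" "x = d_gen j"
      using generators_cases[OF step.hyps] unfolding elemA_def zero_fun_def by fastforce
    then show ?case
    proof cases
      case A
      have "scale_graph r x + y = comb (scale_graph r x + a) ap am c \<tau>" by (simp add: y comb_def add_ac)
      then show ?thesis using elemA_add[OF elemA_scale[OF A] y(1)] by blast
    next
      case P
      have "scale_graph r x + y = comb a (r + ap) am c \<tau>" by (simp add: y comb_def G.scale_left_distrib add_ac P)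
      then show ?thesis using y(1) by blast
    next
      case M
      have "scale_graph r x + y = comb a ap (r + am) c \<tau>" by (simp add: y comb_def G.scale_left_distrib add_ac M)
      then show ?thesis using y(1) by blast
    next
      case (C j)
      have "scale_graph r x + y = comb a ap am (\<lambda>k. c k + (if k = j then r else 0)) \<tau>"
        using C by (simp add: y comb_def delta sum.distrib add_ac)
      then show ?thesis using y(1) by blast
    next
      case (D j)
      have "scale_graph r x + y = comb a ap am c (\<lambda>k. \<tau> k + (if k = j then r else 0))"
        using D by (simp add: y comb_def delta sum.distrib add_ac)
      then show ?thesis using y(1) by blast
    qed
  qed
next
  assume "\<exists>a ap am c \<tau>. elemA a \<and> x = comb a ap am c \<tau>"
  then obtain a ap am c \<tau> where a: "elemA a" and x: "x = comb a ap am c \<tau>" by (elim exE conjE)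
  have "a \<in> generators h" using a typeA_generator unfolding elemA_def by (auto simp: zero_fun_def)
  then show "x \<in> module.span scale_graph (generators h)"
    unfolding x comb_def
    by (intro G.span_add G.span_scale G.span_sum) (auto intro!: G.span_base generators_mem)
qed

end

section \<open>Normal forms of the elements of the model relation\<close>

lemma sum_delta_first:
  fixes \<tau> :: "nat \<Rightarrow> complex"
  shows "(\<Sum>k\<in>{D..<D + n}. \<tau> k * (if k = D \<and> Q then - 1 else 0)) = (if 0 < n \<and> Q then - \<tau> D else 0)"
proof -
  have "(\<Sum>k\<in>{D..<D + n}. \<tau> k * (if k = D \<and> Q then - 1 else 0)) = (\<Sum>k\<in>{D..<D + n}. if k = D then (if Q then - \<tau> D else 0) else 0)"
    by (intro sum.cong refl) simp
  then show ?thesis by (auto simp: sum.delta)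
qed

lemma sum_delta_inner:
  fixes \<tau> :: "nat \<Rightarrow> complex"
  shows "(\<Sum>k\<in>{D..<D + n}. \<tau> k * (if D < k \<and> D + j = k then 1 else 0)) = (if 1 \<le> j \<and> j < n then \<tau> (D + j) else 0)"
proof -
  have "(\<Sum>k\<in>{D..<D + n}. \<tau> k * (if D < k \<and> D + j = k then 1 else 0)) = (\<Sum>k\<in>{D..<D + n}. if k = D + j then (if 1 \<le> j then \<tau> (D + j) else 0) else 0)"
    by (intro sum.cong refl) auto
  then show ?thesis by (auto simp: sum.delta)
qed

lemma sum_delta_shifted:
  fixes \<tau> :: "nat \<Rightarrow> complex"
  shows "(\<Sum>k\<in>{D..<D + n}. \<tau> k * (if D + j = k + 1 then 1 else 0)) = (if 1 \<le> j \<and> j \<le> n then \<tau> (D + j - 1) else 0)"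
proof -
  have "(\<Sum>k\<in>{D..<D + n}. \<tau> k * (if D + j = k + 1 then 1 else 0)) = (\<Sum>k\<in>{D..<D + n}. if k = D + j - 1 then (if 1 \<le> j \<or> 1 \<le> D \<and> False then \<tau> (D + j - 1) else 0) else 0)"
    by (intro sum.cong refl) auto
  then show ?thesis by (auto simp: sum.delta)
qed

lemma sum_atMost_last:
  fixes c :: "nat \<Rightarrow> complex"
  shows "(\<Sum>k\<le>D. c k * (if Q then (if k < D then X k else Y) else 0)) = (if Q then (\<Sum>k<D. c k * X k) + c D * Y else 0)"
  by (auto simp: lessThan_Suc_atMost[symmetric])

lemma sum_atMost_only_last:
  fixes c :: "nat \<Rightarrow> complex"
  shows "(\<Sum>k\<le>D. c k * (if k = D \<and> Q then Y else 0)) = (if Q then c D * Y else 0)"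
  by (auto simp: lessThan_Suc_atMost[symmetric])

lemma sum_atMost_shift:
  fixes c :: "nat \<Rightarrow> complex"
  shows "(\<Sum>k\<le>D. c k * (if 1 \<le> k \<and> Q then X (k - 1) else 0)) = (if Q then (\<Sum>k<D. c (k + 1) * X k) else 0)"
  unfolding lessThan_Suc_atMost[symmetric] sum.lessThan_Suc_shift by simp

lemma sum_atMost_shift_vec:
  fixes c :: "nat \<Rightarrow> complex" and X :: "nat \<Rightarrow> complex^2"
  shows "(\<Sum>k\<le>D. c k *s (if k = 0 then 0 else X (k - 1))) = (\<Sum>k<D. c (k + 1) *s X k)"
  unfolding lessThan_Suc_atMost[symmetric] sum.lessThan_Suc_shift by simp

context kind_A_ham
begin

abbreviation chi_plus :: "real \<Rightarrow> complex^2" where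
  "chi_plus t \<equiv> (if sig h < t \<and> t < sp h then vector [1, 0] else 0)"

abbreviation chi_minus :: "real \<Rightarrow> complex^2" where
  "chi_minus t \<equiv> (if sm h < t \<and> t < sig h then vector [1, 0] else 0)"

abbreviation xi_free where
  "xi_free ap am c i \<equiv> ap * omega_plus h (i + 1) - am * omega_minus h (i + 1)
    + (\<Sum>k<Delta h. c k * (of_real (dpar h (k + i)) / 2)) + c (Delta h) * of_real (dpar h (Delta h + i))"

abbreviation xi_part where
  "xi_part ap am c \<tau> i \<equiv> xi_free ap am c i - (if 0 < o2 h \<and> i = Delta h - 1 then \<tau> (Delta h) else 0)"

abbreviation alpha_part :: "(nat \<Rightarrow> complex) \<Rightarrow> (nat \<Rightarrow> complex) \<Rightarrow> nat \<Rightarrow> complex" where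
  "alpha_part c \<tau> j \<equiv> c (Delta h) * of_real (bpar h (o2 h + 1 - j)) + (if j < o2 h then \<tau> (Delta h + j) else 0)"

abbreviation eta_part :: "complex \<Rightarrow> complex \<Rightarrow> (nat \<Rightarrow> complex) \<Rightarrow> nat \<Rightarrow> complex" where
  "eta_part ap am c i \<equiv> (if i = 0 then am - ap else 0)
    + (\<Sum>k<Delta h. c (k + 1) * (of_real (dpar h (k + i)) / 2 - (if i = 0 then of_real (dpar h k) else 0)))"

abbreviation dsum :: "(nat \<Rightarrow> complex) \<Rightarrow> complex" where
  "dsum c \<equiv> 1/2 * (\<Sum>i<Delta h. of_real (dpar h i) * c (i + 1))"

abbreviation f_part where
  "f_part fa ap am c t \<equiv> fa t + ap *s chi_plus t + am *s chi_minus t + (\<Sum>k\<le>Delta h. c k *s w h k t)"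

abbreviation g_part where
  "g_part ga c t \<equiv> ga t + (\<Sum>k<Delta h. c (k + 1) *s w h k t)"

abbreviation bv_minus :: "complex^2 \<Rightarrow> complex \<Rightarrow> (nat \<Rightarrow> complex) \<Rightarrow> complex^2" where
  "bv_minus v am c \<equiv> v + am *s vector [1, 0] + (\<Sum>k\<le>Delta h. c k *s vector [0, omega_minus h k])"

abbreviation bv_plus :: "complex^2 \<Rightarrow> complex \<Rightarrow> (nat \<Rightarrow> complex) \<Rightarrow> complex^2" where
  "bv_plus v ap c \<equiv> v + ap *s vector [1, 0] + (\<Sum>k\<le>Delta h. c k *s vector [0, omega_plus h k])"

text \<open>
  The components of a general element of the span. The abbreviations above name the contributions
  of the generators other than \<open>gen_a\<close>.
\<close>

lemma comb_eq:
  "comb (((fa, \<xi>, \<lambda>_. 0), (ga, \<eta>, \<lambda>_. 0)), (vm, vp)) ap am c \<tau> =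
    (((\<lambda>t. f_part fa ap am c t,
       \<lambda>i. \<xi> i + (if i < Delta h then xi_part ap am c \<tau> i else 0),
       \<lambda>j. if 1 \<le> j \<and> j \<le> o2 h then alpha_part c \<tau> j else 0),
      (\<lambda>t. g_part ga c t,
       \<lambda>i. \<eta> i + (if i < Delta h then eta_part ap am c i else 0),
       \<lambda>j. if 1 \<le> j \<and> j \<le> o2 h then \<tau> (Delta h + j - 1) else 0)),
     (bv_minus vm am c,
      bv_plus vp ap c))"
proof -
  have 1: "\<xi> i + ap * (if i < Delta h then omega_plus h (i + 1) else 0) + am * (if i < Delta h then - omega_minus h (i + 1) else 0)
      + (\<Sum>k\<le>Delta h. c k * (if i < Delta h then if k < Delta h then of_real (dpar h (k + i)) / 2 else of_real (dpar h (Delta h + i)) else 0))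
      + (\<Sum>k\<in>{Delta h..<Delta h + o2 h}. \<tau> k * (if k = Delta h \<and> i = Delta h - 1 then - 1 else 0))
     = \<xi> i + (if i < Delta h then xi_part ap am c \<tau> i else 0)" for i
    unfolding sum_atMost_last sum_delta_first using Delta_pos by simp
  have 2: "0 + ap * 0 + am * 0
      + (\<Sum>k\<le>Delta h. c k * (if k = Delta h \<and> 1 \<le> j \<and> j \<le> o2 h then of_real (bpar h (o2 h + 1 - j)) else 0))
      + (\<Sum>k\<in>{Delta h..<Delta h + o2 h}. \<tau> k * (if Delta h < k \<and> Delta h + j = k then 1 else 0))
     = (if 1 \<le> j \<and> j \<le> o2 h then alpha_part c \<tau> j else 0)" for j
    unfolding sum_atMost_only_last sum_delta_inner by auto
  have 3: "\<eta> i + ap * (if i = 0 then - 1 else 0) + am * (if i = 0 then 1 else 0)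
      + (\<Sum>k\<le>Delta h. c k * (if 1 \<le> k \<and> i < Delta h then of_real (dpar h (k - 1 + i)) / 2 - (if i = 0 then of_real (dpar h (k - 1)) else 0) else 0))
      + (\<Sum>k\<in>{Delta h..<Delta h + o2 h}. \<tau> k * 0)
     = \<eta> i + (if i < Delta h then eta_part ap am c i else 0)" for i
    unfolding sum_atMost_shift[where X="\<lambda>k. of_real (dpar h (k + i)) / 2 - (if i = 0 then of_real (dpar h k) else 0)"]
    using Delta_pos by auto
  have 4: "0 + ap * 0 + am * 0 + (\<Sum>k\<le>Delta h. c k * 0)
      + (\<Sum>k\<in>{Delta h..<Delta h + o2 h}. \<tau> k * (if Delta h + j = k + 1 then 1 else 0))
     = (if 1 \<le> j \<and> j \<le> o2 h then \<tau> (Delta h + j - 1) else 0)" for j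
    unfolding sum_delta_shifted by simp
  have 5: "ga t + ap *s 0 + am *s 0 + (\<Sum>k\<le>Delta h. c k *s (if k = 0 then 0 else w h (k - 1) t))
      + (\<Sum>k\<in>{Delta h..<Delta h + o2 h}. \<tau> k *s 0) = g_part ga c t" for t
    unfolding sum_atMost_shift_vec[where X="\<lambda>k. w h k t"] by simp
  show ?thesis
    unfolding comb_def b_plus_gen_def b_minus_gen_def c_gen_def d_gen_def
      scale_graph_sum[OF finite_atMost] scale_graph_sum[OF finite_atLeastLessThan]
    unfolding scale_graph_Pair graph_plus
    unfolding 1 2 3 4 5
    by simp
qed

definition coord_eqs where
  "coord_eqs \<xi> \<alpha> \<eta> \<beta> ap am c \<xi>a \<eta>a \<tau> \<longleftrightarrow>
    (\<forall>i<Delta h. \<xi> i = \<xi>a i + xi_part ap am c \<tau> i) \<and>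
    (\<forall>j\<in>{1..o2 h}. \<alpha> j = alpha_part c \<tau> j) \<and>
    (\<forall>i<Delta h. \<eta> i = \<eta>a i + eta_part ap am c i) \<and>
    (\<forall>j\<in>{1..o2 h}. \<beta> j = \<tau> (Delta h + j - 1))"

text \<open>
  How an element of the graph of the boundary mapping is composed of the generators, with the
  functions compared as classes and the coordinates on their index sets.
\<close>

definition normal_form where
  "normal_form f \<xi> \<alpha> g \<eta> \<beta> um up fa ga \<xi>a \<eta>a vm vp ap am c \<tau> \<longleftrightarrow>
    typeA fa ga \<xi>a \<eta>a vm vp \<and>
    ham_equal h f (\<lambda>t. f_part fa ap am c t) \<and>
    ham_equal h g (\<lambda>t. g_part ga c t) \<and>
    coord_eqs \<xi> \<alpha> \<eta> \<beta> ap am c \<xi>a \<eta>a \<tau> \<and>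
    um = bv_minus vm am c \<and>
    up = bv_plus vp ap c"

lemma coord_vecs_eq_iff:
  assumes "x \<in> coord_vecs K" "\<And>i. i \<notin> K \<Longrightarrow> y i = 0"
  shows "x = y \<longleftrightarrow> (\<forall>i\<in>K. x i = y i)"
  using assms by (auto simp: coord_vecs_def fun_eq_iff)

lemma Gamma_graph_iff:
  assumes F: "(f, \<xi>, \<alpha>) \<in> model_space h" and G: "(g, \<eta>, \<beta>) \<in> model_space h"
  shows "(((f, \<xi>, \<alpha>), (g, \<eta>, \<beta>)), (um, up)) \<in> Gamma_graph h \<longleftrightarrow>
    (\<exists>fa ga \<xi>a \<eta>a vm vp ap am c \<tau>. normal_form f \<xi> \<alpha> g \<eta> \<beta> um up fa ga \<xi>a \<eta>a vm vp ap am c \<tau>)"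
proof -
  have co: "\<xi> \<in> coord_vecs {..<Delta h}" "\<alpha> \<in> coord_vecs {1..o2 h}" "\<eta> \<in> coord_vecs {..<Delta h}" "\<beta> \<in> coord_vecs {1..o2 h}"
    using F G by (auto simp: model_space_def)
  have key: "(model_eq h (f, \<xi>, \<alpha>) F' \<and> model_eq h (g, \<eta>, \<beta>) G' \<and>
        ((F', G'), (um, up)) = comb (((fa, \<xi>a, \<lambda>_. 0), (ga, \<eta>a, \<lambda>_. 0)), (vm, vp)) ap am c \<tau>) \<longrightarrow>
      normal_form f \<xi> \<alpha> g \<eta> \<beta> um up fa ga \<xi>a \<eta>a vm vp ap am c \<tau>"
    if A: "typeA fa ga \<xi>a \<eta>a vm vp" for F' G' fa ga \<xi>a \<eta>a vm vp ap am c \<tau>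
    unfolding comb_eq
    by (clarsimp simp: model_eq_def normal_form_def coord_eqs_def A)
  have key2: "(((f, \<xi>, \<alpha>), (g, \<eta>, \<beta>)), (um, up)) \<in> Gamma_graph h"
    if nf: "normal_form f \<xi> \<alpha> g \<eta> \<beta> um up fa ga \<xi>a \<eta>a vm vp ap am c \<tau>" for fa ga \<xi>a \<eta>a vm vp ap am c \<tau>
  proof -
    let ?x = "(((fa, \<xi>a, \<lambda>_. 0), (ga, \<eta>a, \<lambda>_. 0)), (vm, vp)) :: (model_vec \<times> model_vec) \<times> boundary_val"
    have A: "typeA fa ga \<xi>a \<eta>a vm vp" using nf by (simp add: normal_form_def coord_eqs_def)
    then have z: "\<xi>a i = 0" "\<eta>a i = 0" if "\<not> i < Delta h" for i using that by (auto simp: typeA_def shifted_def coord_vecs_def)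
    have "elemA ?x" using A unfolding elemA_def by (intro exI conjI) (assumption, rule refl)
    then have "comb ?x ap am c \<tau> \<in> module.span scale_graph (generators h)"
      unfolding span_generators by blast
    moreover obtain F' G' where FG: "((F', G'), (um, up)) = comb ?x ap am c \<tau>"
      and "model_eq h (f, \<xi>, \<alpha>) F'" "model_eq h (g, \<eta>, \<beta>) G'"
    proof (rule that)
      show "((((\<lambda>t. f_part fa ap am c t), \<xi>, \<alpha>),
          ((\<lambda>t. g_part ga c t), \<eta>, \<beta>)), (um, up)) = comb ?x ap am c \<tau>"
        unfolding comb_eq prod.inject coord_vecs_eq_iff[OF co(1)]
      proof (intro conjI refl)
        show "\<xi> = (\<lambda>i. \<xi>a i + (if i < Delta h then xi_part ap am c \<tau> i else 0))"
          by (subst coord_vecs_eq_iff[OF co(1)]) (use nf z in \<open>auto simp: normal_form_def coord_eqs_def\<close>)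
        show "\<alpha> = (\<lambda>j. if 1 \<le> j \<and> j \<le> o2 h then alpha_part c \<tau> j else 0)"
          by (subst coord_vecs_eq_iff[OF co(2)]) (use nf in \<open>auto simp: normal_form_def coord_eqs_def\<close>)
        show "\<eta> = (\<lambda>i. \<eta>a i + (if i < Delta h then eta_part ap am c i else 0))"
          by (subst coord_vecs_eq_iff[OF co(3)]) (use nf z in \<open>auto simp: normal_form_def coord_eqs_def\<close>)
        show "\<beta> = (\<lambda>j. if 1 \<le> j \<and> j \<le> o2 h then \<tau> (Delta h + j - 1) else 0)"
          by (subst coord_vecs_eq_iff[OF co(4)]) (use nf in \<open>auto simp: normal_form_def coord_eqs_def\<close>)
      qed (use nf in \<open>auto simp: normal_form_def coord_eqs_def\<close>)
    qed (use nf in \<open>auto simp: normal_form_def coord_eqs_def model_eq_def\<close>)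
    ultimately have "((F', G'), (um, up)) \<in> module.span scale_graph (generators h)" by (simp only:)
    then have "\<exists>F' G'. ((F', G'), (um, up)) \<in> module.span scale_graph (generators h) \<and>
        model_eq h (f, \<xi>, \<alpha>) F' \<and> model_eq h (g, \<eta>, \<beta>) G'"
      using \<open>model_eq h (f, \<xi>, \<alpha>) F'\<close> \<open>model_eq h (g, \<eta>, \<beta>) G'\<close> by (intro exI conjI)
    then show ?thesis using F G unfolding Gamma_graph_def by (simp only: mem_Collect_eq case_prod_conv simp_thms)
  qed
  show ?thesis
  proof
    assume "(((f, \<xi>, \<alpha>), (g, \<eta>, \<beta>)), (um, up)) \<in> Gamma_graph h"
    then obtain F' G' where FG: "((F', G'), (um, up)) \<in> module.span scale_graph (generators h)"
        "model_eq h (f, \<xi>, \<alpha>) F'" "model_eq h (g, \<eta>, \<beta>) G'"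
      unfolding Gamma_graph_def by auto
    from FG(1)[unfolded span_generators] obtain a ap am c \<tau> where a: "elemA a" and e: "((F', G'), (um, up)) = comb a ap am c \<tau>"
      by (elim exE conjE)
    from a obtain fa ga \<xi>a \<eta>a vm vp where A: "typeA fa ga \<xi>a \<eta>a vm vp" and a: "a = (((fa, \<xi>a, \<lambda>_. 0), (ga, \<eta>a, \<lambda>_. 0)), (vm, vp))"
      unfolding elemA_def by (elim exE conjE)
    have "normal_form f \<xi> \<alpha> g \<eta> \<beta> um up fa ga \<xi>a \<eta>a vm vp ap am c \<tau>"
      by (rule key[OF A, THEN mp]) (use FG e a in simp)
    then show "\<exists>fa ga \<xi>a \<eta>a vm vp ap am c \<tau>. normal_form f \<xi> \<alpha> g \<eta> \<beta> um up fa ga \<xi>a \<eta>a vm vp ap am c \<tau>"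
      by (intro exI)
  qed (elim exE, rule key2)
qed

text \<open>
  Forgetting the boundary values is a linear map, and it carries the span of the generators of the
  graph onto the span of the generators of the relation.
\<close>

lemma T_ring_iff: "(F, G) \<in> T_ring h \<longleftrightarrow> (\<exists>v. ((F, G), v) \<in> Gamma_graph h)"
proof -
  interpret hom: module_hom scale_graph scale_pair fst
    unfolding module_hom_iff_linear
    by (intro Vector_Spaces.linear_iff[THEN iffD2] conjI vector_space_scale_graph vector_space_scale_pair)
      (auto simp: scale_graph_def case_prod_beta)
  show ?thesis unfolding T_ring_def Gamma_graph_def hom.span_image by force
qed

lemma model_space_measurable:
  assumes "(f, \<xi>, \<alpha>) \<in> model_space h"
  shows "f \<in> borel_measurable L.M" "f \<in> borel_measurable R.M"
proof -
  obtain f0 c where f: "f0 \<in> L2_ham h" "f = (\<lambda>t. f0 t + (\<Sum>i<Delta h. c i *s w h i t))"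
    using assms by (auto simp: model_space_def L2_Delta_def)
  have sc: "(\<lambda>t. k *s x t) \<in> borel_measurable N" if "x \<in> borel_measurable N" for k and x :: "real \<Rightarrow> complex^2" and N
    using that by (auto simp: borel_measurable_vec2_iff)
  have "f0 \<in> L.LL" "f0 \<in> R.LL" using f by (auto simp: L2_ham_def)
  then show "f \<in> borel_measurable L.M" "f \<in> borel_measurable R.M"
    unfolding f(2) by (auto intro!: borel_measurable_add borel_measurable_sum sc w_meas dest: L.L2_meas R.L2_meas)
qed

lemma g_reduced_measurable:
  assumes "g \<in> borel_measurable L.M" "g \<in> borel_measurable R.M"
  shows "g_reduced h g c \<in> borel_measurable L.M" "g_reduced h g c \<in> borel_measurable R.M"
proof -
  have sc: "(\<lambda>t. k *s x t) \<in> borel_measurable N" if "x \<in> borel_measurable N" for k and x :: "real \<Rightarrow> complex^2" and N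
    using that by (auto simp: borel_measurable_vec2_iff)
  have e: "g_reduced h g c = (\<lambda>t. g t - (\<Sum>i<Delta h. c (i + 1) *s w h i t))" by (simp add: fun_eq_iff g_reduced_def)
  show "g_reduced h g c \<in> borel_measurable L.M" "g_reduced h g c \<in> borel_measurable R.M"
    unfolding e using assms by (auto intro!: borel_measurable_diff borel_measurable_sum sc w_meas)
qed

text \<open>
  The functions $w_k$ have derivative $JHw_{k-1}$ and boundary value $(0,\omega_k)^T$. Thus adding
  $\sum c_kw_k$ to $f_0$ adds $\sum c_{k+1}w_k$ to the derivative, which turns the reduced function
  back into \<open>g\<close>.
\<close>

lemma rep_from_reduced:
  assumes f: "ham_equal h f (\<lambda>t. f0 t + (\<Sum>i\<le>Delta h. c i *s w h i t))"
  shows "L.rep f0 (g_reduced h g c) vL \<Longrightarrow> g \<in> borel_measurable L.M \<Longrightarrow>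
      L.rep f g (vL + (\<Sum>k\<le>Delta h. c k *s vector [0, omega_minus h k]))"
    and "R.rep f0 (g_reduced h g c) vR \<Longrightarrow> g \<in> borel_measurable R.M \<Longrightarrow>
      R.rep f g (vR + (\<Sum>k\<le>Delta h. c k *s vector [0, omega_plus h k]))"
proof -
  have g: "g_reduced h g c t + (\<Sum>k\<le>Delta h. c k *s (if k = 0 then 0 else w h (k - 1) t)) = g t" for t
    unfolding g_reduced_def sum_atMost_shift_vec[where X="\<lambda>k. w h k t"] by simp
  {
    assume r: "L.rep f0 (g_reduced h g c) vL" and m: "g \<in> borel_measurable L.M"
    have "L.rep (\<lambda>t. f0 t + (\<Sum>i\<le>Delta h. c i *s w h i t))
      (\<lambda>t. g_reduced h g c t + (\<Sum>k\<le>Delta h. c k *s (if k = 0 then 0 else w h (k - 1) t)))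
      (vL + (\<Sum>k\<le>Delta h. c k *s vector [0, omega_minus h k]))"
      by (intro L.rep_add L.rep_sum L.rep_scale w_rep r) auto
    then show "L.rep f g (vL + (\<Sum>k\<le>Delta h. c k *s vector [0, omega_minus h k]))"
      unfolding g by (rule L.rep_cong) (use f m in \<open>auto simp: ham_equal_def ham_eq_refl intro: ham_eq_sym\<close>)
  next
    assume r: "R.rep f0 (g_reduced h g c) vR" and m: "g \<in> borel_measurable R.M"
    have "R.rep (\<lambda>t. f0 t + (\<Sum>i\<le>Delta h. c i *s w h i t))
      (\<lambda>t. g_reduced h g c t + (\<Sum>k\<le>Delta h. c k *s (if k = 0 then 0 else w h (k - 1) t)))
      (vR + (\<Sum>k\<le>Delta h. c k *s vector [0, omega_plus h k]))"
      by (intro R.rep_add R.rep_sum R.rep_scale w_rep r) auto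
    then show "R.rep f g (vR + (\<Sum>k\<le>Delta h. c k *s vector [0, omega_plus h k]))"
      unfolding g by (rule R.rep_cong) (use f m in \<open>auto simp: ham_equal_def ham_eq_refl intro: ham_eq_sym\<close>)
  }
qed

text \<open>
  The three cases in the definition of \<open>B_term\<close> amount to one formula, since $\omega_k$ vanishes on an
  indivisible half-interval.
\<close>

lemma B_term_rep:
  assumes l: "L.rep f g u" and r: "R.rep f g v" and k: "1 \<le> k"
  shows "B_term h f g k = omega_minus h k * u $ 1 - omega_plus h k * v $ 1"
  using value_minus_rep[OF _ l] value_plus_rep[OF _ r] omega_indivisible k not_both_indivisible
  by (auto simp: B_term_def)

text \<open>
  The difference of the two reduced functions is a combination of $w_0,\dots,w_{\Delta-1}$ in
  $L^2(H)$, so the coefficients with positive index agree. What remains of the difference of the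
  functions $f_0$ is a multiple of $w_0$.
\<close>

lemma decomposition_unique:
  assumes d: "decomposition h f g f0 c" and d': "decomposition h f g f0' c'" and i: "i \<le> Delta h"
  shows "c i = c' i"
proof -
  define \<delta> where "\<delta> i = c i - c' i" for i
  have L: "f0 \<in> L2_ham h" "f0' \<in> L2_ham h" "g_reduced h g c \<in> L2_ham h" "g_reduced h g c' \<in> L2_ham h"
    using d d' by (auto simp: decomposition_def Tmax_ham_def L.Tmax_rep_iff R.Tmax_rep_iff L2_ham_def)
  have "(\<lambda>t. g_reduced h g c' t - g_reduced h g c t) \<in> L2_ham h"
    using L unfolding L2_ham_def by (auto intro: L.L2_diff R.L2_diff)
  also have "(\<lambda>t. g_reduced h g c' t - g_reduced h g c t) = (\<lambda>t. \<Sum>i<Delta h. \<delta> (i + 1) *s w h i t)"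
    by (simp add: fun_eq_iff g_reduced_def \<delta>_def vector_sub_rdistrib sum_subtractf)
  finally have S: "\<delta> (i + 1) = 0" if "i < Delta h" for i
    by (rule w_independent_all[OF _ order_refl that])
  have eq: "(\<Sum>i\<le>Delta h. c i *s w h i t) - (\<Sum>i\<le>Delta h. c' i *s w h i t) = \<delta> 0 *s w h 0 t" for t
  proof -
    have "(\<Sum>i\<le>Delta h. c i *s w h i t) - (\<Sum>i\<le>Delta h. c' i *s w h i t) = (\<Sum>i\<le>Delta h. \<delta> i *s w h i t)"
      by (simp add: \<delta>_def vector_sub_rdistrib sum_subtractf)
    also have "\<dots> = \<delta> 0 *s w h 0 t"
      unfolding lessThan_Suc_atMost[symmetric] sum.lessThan_Suc_shift using S by simp
    finally show ?thesis .
  qed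
  have aux: "ham_eq a b (Ham h) (\<lambda>t. f0' t - f0 t) (\<lambda>t. \<delta> 0 *s w h 0 t)"
    if e: "ham_eq a b (Ham h) f (\<lambda>t. f0 t + (\<Sum>i\<le>Delta h. c i *s w h i t))"
      "ham_eq a b (Ham h) f (\<lambda>t. f0' t + (\<Sum>i\<le>Delta h. c' i *s w h i t))" for a b
  proof -
    have "ham_eq a b (Ham h) (\<lambda>t. f0' t + (\<Sum>i\<le>Delta h. c' i *s w h i t)) (\<lambda>t. f0 t + (\<Sum>i\<le>Delta h. c i *s w h i t))"
      using ham_eq_trans[OF ham_eq_sym[OF e(2)] e(1)] .
    from ham_eq_diff[OF this ham_eq_refl[of _ _ _ "\<lambda>t. f0 t + (\<Sum>i\<le>Delta h. c' i *s w h i t)"]]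
    have "ham_eq a b (Ham h) (\<lambda>t. f0' t - f0 t)
        (\<lambda>t. (\<Sum>i\<le>Delta h. c i *s w h i t) - (\<Sum>i\<le>Delta h. c' i *s w h i t))"
      by (simp only: add_diff_cancel_right add_diff_cancel_left)
    then show ?thesis unfolding eq .
  qed
  have sc: "(\<lambda>t. k *s x t) \<in> borel_measurable N" if "x \<in> borel_measurable N" for k and x :: "real \<Rightarrow> complex^2" and N
    using that by (auto simp: borel_measurable_vec2_iff)
  have "(\<lambda>t. \<delta> 0 *s w h 0 t) \<in> L.LL"
    by (rule L.L2_cong[OF L.L2_diff[of f0' f0] aux sc[OF w_meas(1)]])
      (use L d d' in \<open>auto simp: L2_ham_def decomposition_def ham_equal_def\<close>)
  moreover have "(\<lambda>t. \<delta> 0 *s w h 0 t) \<in> R.LL"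
    by (rule R.L2_cong[OF R.L2_diff[of f0' f0] aux sc[OF w_meas(2)]])
      (use L d d' in \<open>auto simp: L2_ham_def decomposition_def ham_equal_def\<close>)
  ultimately have "(\<lambda>t. \<Sum>i\<le>0. \<delta> i *s w h i t) \<in> L2_ham h" unfolding L2_ham_def atMost_0 by simp
  from w_independent[OF this] have "\<delta> 0 = 0" using Delta_pos by (simp only: less_eq_Suc_le One_nat_def)
  then show ?thesis using S[of "i - 1"] i Delta_pos by (cases "i = 0") (auto simp: \<delta>_def)
qed

end

section \<open>Elimination of the auxiliary coordinates\<close>

lemma half_sum_commute:
  fixes c :: "nat \<Rightarrow> complex"
  shows "1/2 * (\<Sum>i<n. of_real (d (m + i)) * c i) = (\<Sum>k<n. c k * (of_real (d (k + m)) / 2))"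
  unfolding sum_distrib_left by (intro sum.cong refl) (simp add: add.commute)

lemma half_sum_diff:
  fixes c :: "nat \<Rightarrow> complex"
  shows "(\<Sum>k<n. c (k + 1) * (of_real (d k) / 2 - of_real (d k))) = - (1/2 * (\<Sum>i<n. of_real (d i) * c (i + 1)))"
  unfolding sum_distrib_left sum_negf[symmetric] by (intro sum.cong refl) (simp add: field_simps)

lemma half_sum_shift:
  fixes c :: "nat \<Rightarrow> complex"
  assumes "1 \<le> k"
  shows "(\<Sum>j<n. c (j + 1) * (of_real (d (j + k)) / 2)) =
    (\<Sum>j<n. c j * (of_real (d (j + (k - 1))) / 2)) - 1/2 * of_real (d (k - 1)) * c 0 + 1/2 * of_real (d (k + n - 1)) * c n"
proof -
  define X where "X j = c j * (of_real (d (j + (k - 1))) / 2)" for j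
  have "X 0 + (\<Sum>j<n. X (Suc j)) = (\<Sum>j<n. X j) + X n"
    using sum.lessThan_Suc_shift[of X n] by simp
  moreover have "(\<Sum>j<n. c (j + 1) * (of_real (d (j + k)) / 2)) = (\<Sum>j<n. X (Suc j))"
    using assms by (intro sum.cong refl) (simp add: X_def)
  moreover have "X n = 1/2 * of_real (d (k + n - 1)) * c n" "X 0 = 1/2 * of_real (d (k - 1)) * c 0"
    using assms by (simp_all add: X_def add.commute)
  moreover have "(\<Sum>j<n. c j * (of_real (d (j + (k - 1))) / 2)) = (\<Sum>j<n. X j)" by (simp only: X_def)
  ultimately show ?thesis by (simp only:) (simp add: algebra_simps)
qed

context kind_A_ham
begin

text \<open>
  The relations of the theorem between the coordinates, with an arbitrary number \<open>W\<close> in place of the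
  integral and arbitrary numbers \<open>B k\<close>.
\<close>

definition coord_rel where
  "coord_rel W B \<xi> \<alpha> \<eta> \<beta> c \<longleftrightarrow>
    (o2 h = 0 \<longrightarrow> \<xi> (Delta h - 1) = W + 1/2 * (\<Sum>i<Delta h. of_real (dpar h (Delta h - 1 + i)) * c i)
              + of_real (dpar h (2 * Delta h - 1)) * c (Delta h) - B (Delta h)) \<and>
    (o2 h > 0 \<longrightarrow> \<alpha> (o2 h) = of_real (bpar h 1) * c (Delta h)) \<and>
    (\<forall>k\<in>{1..Delta h - 1}. \<eta> k = \<xi> (k - 1) - 1/2 * of_real (dpar h (k - 1)) * c 0
                   - 1/2 * of_real (dpar h (k + Delta h - 1)) * c (Delta h) + B k) \<and>
    (o2 h > 0 \<longrightarrow> \<beta> 1 = W + 1/2 * (\<Sum>i<Delta h. of_real (dpar h (Delta h - 1 + i)) * c i)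
              + of_real (dpar h (2 * Delta h - 1)) * c (Delta h) - \<xi> (Delta h - 1) - B (Delta h) \<and>
            (\<forall>j\<in>{2..o2 h}. \<beta> j = \<alpha> (j - 1) - of_real (bpar h (o2 h + 2 - j)) * c (Delta h)))"

text \<open>
  The auxiliary unknowns enter through $\xi_a$ shifted by one index, so the recursion
  $\eta_{a,k} = \xi_{a,k-1}$ couples the $k$-th component of $\eta$ with the $(k-1)$-st component of
  $\xi$. There the contributions of the $c_j$ telescope (\<open>half_sum_shift\<close>) up to the terms with
  $c_0$ and $c_\Delta$. The last component of $\xi_a$ is \<open>W\<close>; the equation for it determines the last
  component of $\xi$ if there are no $\tau_k$, and otherwise $\tau_\Delta = \beta_1$.
\<close>

lemma coordinates_iff:
  assumes B_eq: "\<And>k. 1 \<le> k \<Longrightarrow> B k = omega_minus h k * am - omega_plus h k * ap"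
  shows "(\<exists>\<xi>a \<eta>a \<tau>. shifted \<xi>a \<eta>a W \<and> coord_eqs \<xi> \<alpha> \<eta> \<beta> ap am c \<xi>a \<eta>a \<tau>) \<longleftrightarrow>
    \<eta> 0 = am - ap - dsum c \<and> coord_rel W B \<xi> \<alpha> \<eta> \<beta> c"
    (is "?lhs \<longleftrightarrow> ?rhs")
proof -
  let ?D = "Delta h"
  define R where "R i = xi_free ap am c i" for i
  define Q where "Q i = (\<Sum>k<?D. c (k + 1) * (of_real (dpar h (k + i)) / 2))" for i
  have D: "1 \<le> ?D" by (rule Delta_pos)
  have R_last: "R (?D - 1) = 1/2 * (\<Sum>i<?D. of_real (dpar h (?D - 1 + i)) * c i)
      + of_real (dpar h (2 * ?D - 1)) * c ?D - B ?D"
  proof -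
    have "?D + (?D - 1) = 2 * ?D - 1" using D by simp
    then show ?thesis unfolding R_def half_sum_commute B_eq[OF D] using D by (simp add: algebra_simps)
  qed
  have R_inner: "Q k = R (k - 1) - 1/2 * of_real (dpar h (k - 1)) * c 0
      - 1/2 * of_real (dpar h (k + ?D - 1)) * c ?D + B k" if k: "1 \<le> k" for k
  proof -
    have "?D + (k - 1) = k + ?D - 1" using k by simp
    then show ?thesis unfolding Q_def R_def half_sum_shift[OF k] B_eq[OF k] using k by (simp add: algebra_simps)
  qed
  have eta0: "(\<Sum>k<?D. c (k + 1) * (of_real (dpar h (k + 0)) / 2 - (if (0::nat) = 0 then of_real (dpar h k) else 0)))
      = - (dsum c)"
    using half_sum_diff[of c "dpar h" ?D] by simp
  show ?thesis
  proof
    assume ?lhs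
    then obtain \<xi>a \<eta>a \<tau> where a: "\<eta>a 0 = 0" "\<forall>k. 1 \<le> k \<and> k < ?D \<longrightarrow> \<eta>a k = \<xi>a (k - 1)" "\<xi>a (?D - 1) = W"
      and x: "\<forall>i<?D. \<xi> i = \<xi>a i + (R i - (if 0 < o2 h \<and> i = ?D - 1 then \<tau> ?D else 0))"
      and al: "\<forall>j\<in>{1..o2 h}. \<alpha> j = c ?D * of_real (bpar h (o2 h + 1 - j)) + (if j < o2 h then \<tau> (?D + j) else 0)"
      and e: "\<forall>i<?D. \<eta> i = \<eta>a i + eta_part ap am c i"
      and b: "\<forall>j\<in>{1..o2 h}. \<beta> j = \<tau> (?D + j - 1)"
      unfolding shifted_def coord_eqs_def R_def[symmetric] by (elim exE conjE)
    have xlast: "\<xi> (?D - 1) = W + R (?D - 1) - (if 0 < o2 h then \<tau> ?D else 0)"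
      using x[rule_format, of "?D - 1"] a(3) D by simp
    show ?rhs
      unfolding coord_rel_def
    proof (intro conjI impI ballI)
      show "\<xi> (?D - 1) = W + 1/2 * (\<Sum>i<?D. of_real (dpar h (?D - 1 + i)) * c i)
              + of_real (dpar h (2 * ?D - 1)) * c ?D - B ?D" if "o2 h = 0"
        using xlast that unfolding R_last by simp
      show "\<alpha> (o2 h) = of_real (bpar h 1) * c ?D" if "o2 h > 0"
        using al[rule_format, of "o2 h"] that by simp
      show "\<eta> 0 = am - ap - dsum c"
        using e[rule_format, of 0] a(1) D eta0 by simp
      show "\<eta> k = \<xi> (k - 1) - 1/2 * of_real (dpar h (k - 1)) * c 0
                   - 1/2 * of_real (dpar h (k + ?D - 1)) * c ?D + B k" if k: "k \<in> {1..?D - 1}" for k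
      proof -
        have k': "1 \<le> k" "k < ?D" "k \<noteq> 0" "k - 1 < ?D" "k - 1 \<noteq> ?D - 1" using k D by auto
        have "\<eta> k = \<xi>a (k - 1) + Q k" using e[rule_format, OF k'(2)] a(2) k' by (simp add: Q_def)
        moreover have "\<xi> (k - 1) = \<xi>a (k - 1) + R (k - 1)" using x[rule_format, OF k'(4)] k' by simp
        ultimately show ?thesis using R_inner[OF k'(1)] by simp
      qed
      show "\<beta> 1 = W + 1/2 * (\<Sum>i<?D. of_real (dpar h (?D - 1 + i)) * c i)
              + of_real (dpar h (2 * ?D - 1)) * c ?D - \<xi> (?D - 1) - B ?D" if "o2 h > 0"
        using xlast b[rule_format, of 1] that unfolding R_last by simp
      show "\<beta> j = \<alpha> (j - 1) - of_real (bpar h (o2 h + 2 - j)) * c ?D" if j: "j \<in> {2..o2 h}" for j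
      proof -
        have "\<beta> j = \<tau> (?D + j - 1)" using b j by simp
        moreover have "j - 1 \<in> {1..o2 h}" and "(j - 1 < o2 h) = True" using j by auto
        then have "\<alpha> (j - 1) = c ?D * of_real (bpar h (o2 h + 1 - (j - 1))) + \<tau> (?D + (j - 1))"
          using al[rule_format, of "j - 1"] by (simp only: if_True)
        moreover have "o2 h + 1 - (j - 1) = o2 h + 2 - j" "?D + (j - 1) = ?D + j - 1" using j by auto
        ultimately show ?thesis by simp
      qed
    qed
  next
    assume ?rhs
    note r = this[unfolded coord_rel_def]
    \<comment> \<open>The equation $\beta_j = \tau_{\Delta+j-1}$, solved for $\tau$.\<close>
    define \<tau> where "\<tau> k = \<beta> (k + 1 - ?D)" for k
    define \<xi>a where "\<xi>a i = (if i < ?D then \<xi> i - (R i - (if 0 < o2 h \<and> i = ?D - 1 then \<tau> ?D else 0)) else 0)" for i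
    define \<eta>a where "\<eta>a i = (if i < ?D then \<eta> i - eta_part ap am c i else 0)" for i
    show ?lhs
      unfolding shifted_def coord_eqs_def R_def[symmetric]
    proof (rule exI[of _ \<xi>a], rule exI[of _ \<eta>a], rule exI[of _ \<tau>], intro conjI allI impI ballI)
      show "\<xi>a \<in> coord_vecs {..<?D}" "\<eta>a \<in> coord_vecs {..<?D}" by (auto simp: coord_vecs_def \<xi>a_def \<eta>a_def)
      show "\<eta>a 0 = 0" using r D eta0 by (simp add: \<eta>a_def)
      show "\<eta>a k = \<xi>a (k - 1)" if k: "1 \<le> k \<and> k < ?D" for k
      proof -
        have k': "1 \<le> k" "k < ?D" "k \<noteq> 0" "k - 1 < ?D" "k - 1 \<noteq> ?D - 1" "k \<in> {1..?D - 1}" using k by auto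
        have "\<eta>a k = \<eta> k - Q k" using k' by (simp add: \<eta>a_def Q_def)
        moreover have "\<xi>a (k - 1) = \<xi> (k - 1) - R (k - 1)" using k' by (simp add: \<xi>a_def)
        moreover have "\<eta> k = \<xi> (k - 1) - 1/2 * of_real (dpar h (k - 1)) * c 0
                   - 1/2 * of_real (dpar h (k + ?D - 1)) * c ?D + B k" using r k'(6) by blast
        ultimately show ?thesis using R_inner[OF k'(1)] by simp
      qed
      show "\<xi>a (?D - 1) = W"
      proof -
        have "\<xi>a (?D - 1) = \<xi> (?D - 1) - R (?D - 1) + (if 0 < o2 h then \<beta> 1 else 0)"
          using D by (simp add: \<xi>a_def \<tau>_def)
        then show ?thesis using r unfolding R_last by (cases "o2 h = 0") (simp_all add: algebra_simps)
      qed
      show "\<xi> i = \<xi>a i + (R i - (if 0 < o2 h \<and> i = ?D - 1 then \<tau> ?D else 0))" if "i < ?D" for i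
        using that by (simp add: \<xi>a_def)
      show "\<eta> i = \<eta>a i + eta_part ap am c i" if "i < ?D" for i
        using that by (simp add: \<eta>a_def)
      show "\<beta> j = \<tau> (?D + j - 1)" if "j \<in> {1..o2 h}" for j
        using that by (simp add: \<tau>_def)
      show "\<alpha> j = c ?D * of_real (bpar h (o2 h + 1 - j)) + (if j < o2 h then \<tau> (?D + j) else 0)" if j: "j \<in> {1..o2 h}" for j
      proof (cases "j < o2 h")
        case True
        then have "j + 1 \<in> {2..o2 h}" "o2 h > 0" using j by auto
        then have "\<beta> (j + 1) = \<alpha> (j + 1 - 1) - of_real (bpar h (o2 h + 2 - (j + 1))) * c ?D" using r by blast
        moreover have "o2 h + 2 - (j + 1) = o2 h + 1 - j" "?D + j + 1 - ?D = j + 1" by auto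
        ultimately show ?thesis using True by (simp add: \<tau>_def)
      next
        case False
        then have "j = o2 h" "o2 h > 0" using j by auto
        then show ?thesis using r by simp
      qed
    qed
  qed
qed

lemma chi_rep:
  "L.rep (\<lambda>t. ap *s chi_plus t + am *s chi_minus t) (\<lambda>_. 0) (am *s vector [1, 0])"
  "R.rep (\<lambda>t. ap *s chi_plus t + am *s chi_minus t) (\<lambda>_. 0) (ap *s vector [1, 0])"
  by (rule L.rep_cong_eq[OF L.rep_const]; simp) (rule R.rep_cong_eq[OF R.rep_const]; simp)

lemma chi_L2:
  "(\<lambda>t. ap *s chi_plus t + am *s chi_minus t) \<in> L.LL"
  "(\<lambda>t. ap *s chi_plus t + am *s chi_minus t) \<in> R.LL"
  by (rule L.L2_cong_eq[OF L.L2_const_1[of am]]; simp add: vec2_eq_iff)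
    (rule R.L2_cong_eq[OF R.L2_const_1[of ap]]; simp add: vec2_eq_iff)

text \<open>
  What can be read off from a normal form: the decomposition of $f$, the boundary values, and the
  coefficients of the indicator functions as their first components.
\<close>

lemma normal_form_facts:
  assumes nf: "normal_form f \<xi> \<alpha> g \<eta> \<beta> um up fa ga \<xi>a \<eta>a vm vp ap am c \<tau>"
    and G: "(g, \<eta>, \<beta>) \<in> model_space h"
  shows "decomposition h f g (\<lambda>t. fa t + (ap *s chi_plus t + am *s chi_minus t)) c"
    and "L.rep f g um" "R.rep f g up" "um $ 1 = am" "up $ 1 = ap"
    and "left_indivisible h \<Longrightarrow> um $ 2 = c 0" "right_indivisible h \<Longrightarrow> up $ 2 = c 0"
    and "w_Delta_integral h (g_reduced h g c) = w_Delta_integral h ga"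
proof -
  let ?f0 = "\<lambda>t. fa t + (ap *s chi_plus t + am *s chi_minus t)"
  note nf = nf[unfolded normal_form_def]
  have A: "typeA fa ga \<xi>a \<eta>a vm vp" using nf by (elim conjE)
  note A = A[unfolded typeA_def]
  have fL: "fa \<in> L.LL" "fa \<in> R.LL" and gL: "ga \<in> L.LL" "ga \<in> R.LL" using A by (auto simp: L2_ham_def)
  note gm = model_space_measurable[OF G]
  note rm = g_reduced_measurable[OF gm, of c]
  have feq: "ham_equal h f (\<lambda>t. ?f0 t + (\<Sum>i\<le>Delta h. c i *s w h i t))"
    using nf by (simp add: add.assoc)
  have geq: "ham_eq a b (Ham h) ga (g_reduced h g c)" if e: "ham_eq a b (Ham h) g (\<lambda>t. g_part ga c t)" for a b
  proof -
    from ham_eq_diff[OF ham_eq_sym[OF e] ham_eq_refl[of _ _ _ "\<lambda>t. \<Sum>k<Delta h. c (k + 1) *s w h k t"]]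
    show ?thesis by (simp only: add_diff_cancel_right' g_reduced_def[abs_def])
  qed
  have gl: "ham_eq (sm h) (sig h) (Ham h) ga (g_reduced h g c)" and gr: "ham_eq (sig h) (sp h) (Ham h) ga (g_reduced h g c)"
    by (rule geq, use nf in \<open>simp add: ham_equal_def\<close>)+
  have rep_fa: "L.rep fa ga vm" "R.rep fa ga vp" using A by simp_all
  have rl: "L.rep ?f0 (g_reduced h g c) (vm + am *s vector [1, 0])"
  proof -
    have "L.rep ?f0 (\<lambda>t. ga t + 0) (vm + am *s vector [1, 0])"
      by (rule L.rep_add[OF rep_fa(1) chi_rep(1)])
    then show ?thesis
      by (rule L.rep_cong[OF _ ham_eq_refl]) (use gl rm L.L2_meas[OF gL(1)] in simp_all)
  qed
  have rr: "R.rep ?f0 (g_reduced h g c) (vp + ap *s vector [1, 0])"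
  proof -
    have "R.rep ?f0 (\<lambda>t. ga t + 0) (vp + ap *s vector [1, 0])"
      by (rule R.rep_add[OF rep_fa(2) chi_rep(2)])
    then show ?thesis
      by (rule R.rep_cong[OF _ ham_eq_refl]) (use gr rm R.L2_meas[OF gL(2)] in simp_all)
  qed
  have T: "(?f0, g_reduced h g c) \<in> Tmax_ham h"
    unfolding Tmax_ham_def Int_iff L.Tmax_rep_iff R.Tmax_rep_iff
    using rl rr L.L2_add[OF fL(1) chi_L2(1)] R.L2_add[OF fL(2) chi_L2(2)]
      L.L2_cong[OF gL(1) gl rm(1)] R.L2_cong[OF gL(2) gr rm(2)] by blast
  show "decomposition h f g ?f0 c"
    unfolding decomposition_def using feq T by (auto intro: DomainI)
  show "L.rep f g um" using rep_from_reduced(1)[OF feq rl gm(1)] nf by simp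
  show "R.rep f g up" using rep_from_reduced(2)[OF feq rr gm(2)] nf by simp
  show "um $ 1 = am" "up $ 1 = ap" using nf A by (simp_all add: sum_component)
  have s: "(\<Sum>k\<le>Delta h. c k * x k) = c 0" if "x 0 = 1" "\<And>k. 1 \<le> k \<Longrightarrow> x k = 0" for x :: "nat \<Rightarrow> complex"
    unfolding lessThan_Suc_atMost[symmetric] sum.lessThan_Suc_shift using that by simp
  show "um $ 2 = c 0" if i: "left_indivisible h"
  proof -
    have "vm $ 2 = 0" by (rule L.indivisible_rep_2[OF i fL(1) rep_fa(1)])
    then show ?thesis using nf s[of "omega_minus h"] omega_0 omega_indivisible(1)[OF i] by (simp add: sum_component)
  qed
  show "up $ 2 = c 0" if i: "right_indivisible h"
  proof -
    have "vp $ 2 = 0" by (rule R.indivisible_rep_2[OF i fL(2) rep_fa(2)])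
    then show ?thesis using nf s[of "omega_plus h"] omega_0 omega_indivisible(2)[OF i] by (simp add: sum_component)
  qed
  show "w_Delta_integral h (g_reduced h g c) = w_Delta_integral h ga"
    by (rule w_Delta_integral_cong[symmetric])
      (use gl gr rm L.L2_meas[OF gL(1)] R.L2_meas[OF gL(2)] in \<open>simp_all add: ham_equal_def\<close>)
qed

definition relations where
  "relations f \<xi> \<alpha> g \<eta> \<beta> c \<longleftrightarrow>
     coord_rel (w_Delta_integral h (g_reduced h g c)) (B_term h f g) \<xi> \<alpha> \<eta> \<beta> c \<and>
     (\<not> left_indivisible h \<and> \<not> right_indivisible h \<longrightarrow>
        \<eta> 0 = value_minus h f g $ 1 - value_plus h f g $ 1
               - dsum c)"

lemma normal_form_relations:
  assumes nf: "normal_form f \<xi> \<alpha> g \<eta> \<beta> um up fa ga \<xi>a \<eta>a vm vp ap am c \<tau>"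
    and G: "(g, \<eta>, \<beta>) \<in> model_space h"
  shows "relations f \<xi> \<alpha> g \<eta> \<beta> c"
    and "\<eta> 0 = am - ap - dsum c"
proof -
  note facts = normal_form_facts[OF nf G]
  have B: "B_term h f g k = omega_minus h k * am - omega_plus h k * ap" if "1 \<le> k" for k
    using B_term_rep[OF facts(2,3) that] facts(4,5) by simp
  have A: "typeA fa ga \<xi>a \<eta>a vm vp" and e: "coord_eqs \<xi> \<alpha> \<eta> \<beta> ap am c \<xi>a \<eta>a \<tau>"
    using nf unfolding normal_form_def by simp_all
  have "shifted \<xi>a \<eta>a (w_Delta_integral h (g_reduced h g c))"
    using A unfolding typeA_def facts(8) by (elim conjE)
  with e have "\<exists>\<xi>a \<eta>a \<tau>. shifted \<xi>a \<eta>a (w_Delta_integral h (g_reduced h g c)) \<and> coord_eqs \<xi> \<alpha> \<eta> \<beta> ap am c \<xi>a \<eta>a \<tau>"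
    by (intro exI conjI)
  then have r: "\<eta> 0 = am - ap - dsum c"
    "coord_rel (w_Delta_integral h (g_reduced h g c)) (B_term h f g) \<xi> \<alpha> \<eta> \<beta> c"
    using coordinates_iff[of "B_term h f g" am ap, OF B] by simp_all
  then show "\<eta> 0 = am - ap - dsum c" by simp
  have "\<not> left_indivisible h \<Longrightarrow> value_minus h f g $ 1 = am" "\<not> right_indivisible h \<Longrightarrow> value_plus h f g $ 1 = ap"
    using value_minus_rep[OF _ facts(2)] value_plus_rep[OF _ facts(3)] facts(4,5) by simp_all
  then show "relations f \<xi> \<alpha> g \<eta> \<beta> c"
    unfolding relations_def using r by simp
qed

text \<open>
  The coefficients \<open>am\<close> and \<open>ap\<close> are forced to be the first components of the boundary values of
  \<open>f0\<close>. On an indivisible half-interval this component is free, and it is chosen so that the equation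
  for $\eta_0$ holds.
\<close>

lemma relations_imp_normal_form:
  assumes F: "(f, \<xi>, \<alpha>) \<in> model_space h" and G: "(g, \<eta>, \<beta>) \<in> model_space h"
    and d: "decomposition h f g f0 c" and r: "relations f \<xi> \<alpha> g \<eta> \<beta> c"
  shows "\<exists>um up fa ga \<xi>a \<eta>a vm vp ap am \<tau>. normal_form f \<xi> \<alpha> g \<eta> \<beta> um up fa ga \<xi>a \<eta>a vm vp ap am c \<tau>"
proof -
  let ?g = "g_reduced h g c"
  note gm = model_space_measurable[OF G]
  have feq: "ham_equal h f (\<lambda>t. f0 t + (\<Sum>i\<le>Delta h. c i *s w h i t))" and T: "(f0, ?g) \<in> Tmax_ham h"
    using d by (simp_all add: decomposition_def)
  have fL: "f0 \<in> L.LL" "f0 \<in> R.LL" and gL: "?g \<in> L.LL" "?g \<in> R.LL"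
    and ex: "\<exists>v. L.rep f0 ?g v" "\<exists>v. R.rep f0 ?g v"
    using T by (simp_all add: Tmax_ham_def L.Tmax_rep_iff R.Tmax_rep_iff)
  obtain vL where vL: "L.rep f0 ?g vL" using ex(1) ..
  obtain vR where vR: "R.rep f0 ?g vR" using ex(2) ..
  note rl = rep_from_reduced(1)[OF feq vL gm(1)] and rr = rep_from_reduced(2)[OF feq vR gm(2)]
  define S where "S = dsum c"
  \<comment> \<open>On an indivisible side, the value that $\eta_0$ prescribes.\<close>
  define am where "am = (if left_indivisible h then vR $ 1 + \<eta> 0 + S else vL $ 1)"
  define ap where "ap = (if right_indivisible h then vL $ 1 - \<eta> 0 - S else vR $ 1)"
  have uL: "\<not> left_indivisible h \<Longrightarrow> value_minus h f g $ 1 = vL $ 1"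
    using value_minus_rep[OF _ rl] by (simp add: sum_component)
  have uR: "\<not> right_indivisible h \<Longrightarrow> value_plus h f g $ 1 = vR $ 1"
    using value_plus_rep[OF _ rr] by (simp add: sum_component)
  have B: "B_term h f g k = omega_minus h k * am - omega_plus h k * ap" if k: "1 \<le> k" for k
    using B_term_rep[OF rl rr k] omega_indivisible k by (auto simp: am_def ap_def sum_component)
  have eta0: "\<eta> 0 = am - ap - dsum c"
    unfolding S_def[symmetric] using r uL uR not_both_indivisible
    by (cases "left_indivisible h"; cases "right_indivisible h") (simp_all add: am_def ap_def relations_def S_def)
  have vL': "L.rep f0 ?g (vector [am, vL $ 2])"
  proof (cases "left_indivisible h")
    case True
    then show ?thesis by (rule L.indivisible_rep_shift[OF _ vL]) simp
  next
    case False
    then have "vector [am, vL $ 2] = vL" by (simp add: am_def vec2_eq_iff)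
    then show ?thesis using vL by simp
  qed
  have vR': "R.rep f0 ?g (vector [ap, vR $ 2])"
  proof (cases "right_indivisible h")
    case True
    then show ?thesis by (rule R.indivisible_rep_shift[OF _ vR]) simp
  next
    case False
    then have "vector [ap, vR $ 2] = vR" by (simp add: ap_def vec2_eq_iff)
    then show ?thesis using vR by simp
  qed
  define fa where "fa t = f0 t + ((- ap) *s chi_plus t + (- am) *s chi_minus t)" for t
  define vm where "vm = (vector [0, vL $ 2] :: complex^2)"
  define vp where "vp = (vector [0, vR $ 2] :: complex^2)"
  have fa: "fa = (\<lambda>t. f0 t + ((- ap) *s chi_plus t + (- am) *s chi_minus t))" by (simp add: fun_eq_iff fa_def)
  have vmp: "vector [am, vL $ 2] + (- am) *s vector [1, 0] = vm" "vector [ap, vR $ 2] + (- ap) *s vector [1, 0] = vp"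
    by (simp_all add: vm_def vp_def vec2_eq_iff)
  have ral: "L.rep fa ?g vm"
    using L.rep_add[OF vL' chi_rep(1)[of "- ap" "- am"]] unfolding fa vmp add_0_right .
  have rar: "R.rep fa ?g vp"
    using R.rep_add[OF vR' chi_rep(2)[of "- ap" "- am"]] unfolding fa vmp add_0_right .
  have faL: "fa \<in> L2_ham h"
    unfolding fa L2_ham_def using L.L2_add[OF fL(1) chi_L2(1)] R.L2_add[OF fL(2) chi_L2(2)] by blast
  have "coord_rel (w_Delta_integral h ?g) (B_term h f g) \<xi> \<alpha> \<eta> \<beta> c" using r by (simp add: relations_def)
  then obtain \<xi>a \<eta>a \<tau> where x: "shifted \<xi>a \<eta>a (w_Delta_integral h ?g)" and y: "coord_eqs \<xi> \<alpha> \<eta> \<beta> ap am c \<xi>a \<eta>a \<tau>"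
    using coordinates_iff[of "B_term h f g" am ap, OF B] eta0 by blast
  have A: "typeA fa ?g \<xi>a \<eta>a vm vp"
    unfolding typeA_def using faL gL ral rar x by (simp add: L2_ham_def vm_def vp_def)
  have f_eq: "ham_equal h f (\<lambda>t. f_part fa ap am c t)"
  proof -
    have "fa t + ap *s chi_plus t + am *s chi_minus t = f0 t" for t
      by (simp add: fa_def vec2_eq_iff)
    then show ?thesis using feq by simp
  qed
  have g_eq: "ham_equal h g (\<lambda>t. ?g t + (\<Sum>k<Delta h. c (k + 1) *s w h k t))"
    by (simp add: g_reduced_def ham_equal_def ham_eq_refl)
  have "normal_form f \<xi> \<alpha> g \<eta> \<beta> (bv_minus vm am c)
      (bv_plus vp ap c) fa ?g \<xi>a \<eta>a vm vp ap am c \<tau>"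
    unfolding normal_form_def by (intro conjI A f_eq g_eq y refl)
  then show ?thesis by (intro exI)
qed

lemma T_ring_characterisation:
  assumes F: "(f, \<xi>, \<alpha>) \<in> model_space h" and G: "(g, \<eta>, \<beta>) \<in> model_space h"
  shows "((f, \<xi>, \<alpha>), (g, \<eta>, \<beta>)) \<in> T_ring h \<longleftrightarrow> (\<exists>f0 c. decomposition h f g f0 c \<and> relations f \<xi> \<alpha> g \<eta> \<beta> c)"
proof
  assume "((f, \<xi>, \<alpha>), (g, \<eta>, \<beta>)) \<in> T_ring h"
  then obtain v where "(((f, \<xi>, \<alpha>), (g, \<eta>, \<beta>)), v) \<in> Gamma_graph h" unfolding T_ring_iff by (elim exE)
  then have "(((f, \<xi>, \<alpha>), (g, \<eta>, \<beta>)), (fst v, snd v)) \<in> Gamma_graph h" by simp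
  then obtain fa ga \<xi>a \<eta>a vm vp ap am c \<tau>
    where nf: "normal_form f \<xi> \<alpha> g \<eta> \<beta> (fst v) (snd v) fa ga \<xi>a \<eta>a vm vp ap am c \<tau>"
    unfolding Gamma_graph_iff[OF F G] by (elim exE)
  show "\<exists>f0 c. decomposition h f g f0 c \<and> relations f \<xi> \<alpha> g \<eta> \<beta> c"
    using normal_form_facts(1)[OF nf G] normal_form_relations(1)[OF nf G] by (intro exI conjI)
next
  assume "\<exists>f0 c. decomposition h f g f0 c \<and> relations f \<xi> \<alpha> g \<eta> \<beta> c"
  then obtain f0 c where "decomposition h f g f0 c" "relations f \<xi> \<alpha> g \<eta> \<beta> c" by (elim exE conjE)
  from relations_imp_normal_form[OF F G this]
  obtain um up fa ga \<xi>a \<eta>a vm vp ap am \<tau> where nf: "normal_form f \<xi> \<alpha> g \<eta> \<beta> um up fa ga \<xi>a \<eta>a vm vp ap am c \<tau>"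
    by (elim exE)
  then have "(((f, \<xi>, \<alpha>), (g, \<eta>, \<beta>)), (um, up)) \<in> Gamma_graph h"
    unfolding Gamma_graph_iff[OF F G] by (intro exI)
  then show "((f, \<xi>, \<alpha>), (g, \<eta>, \<beta>)) \<in> T_ring h" unfolding T_ring_iff by (rule exI)
qed

text \<open>
  Every pair of boundary values in the graph comes from a normal form, whose coefficients $c_k$ are
  those of the given decomposition. On an indivisible half-interval the first component is
  recovered from the equation for $\eta_0$, the second one is $c_0$ because the other contributions
  vanish.
\<close>

lemma Gamma_ring_values:
  assumes F: "(f, \<xi>, \<alpha>) \<in> model_space h" and G: "(g, \<eta>, \<beta>) \<in> model_space h"
    and T: "((f, \<xi>, \<alpha>), (g, \<eta>, \<beta>)) \<in> T_ring h" and d: "decomposition h f g f0 c"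
  shows "Gamma_ring h ((f, \<xi>, \<alpha>), (g, \<eta>, \<beta>)) =
    (if left_indivisible h
     then vector [value_plus h f g $ 1 + \<eta> 0 + dsum c, c 0]
     else value_minus h f g,
     if right_indivisible h
     then vector [value_minus h f g $ 1 - \<eta> 0 - dsum c, c 0]
     else value_plus h f g)"
    (is "_ = ?V")
proof -
  have unique: "v = ?V" if "(((f, \<xi>, \<alpha>), (g, \<eta>, \<beta>)), v) \<in> Gamma_graph h" for v
  proof -
    obtain um up where v: "v = (um, up)" by (cases v)
    have "(((f, \<xi>, \<alpha>), (g, \<eta>, \<beta>)), (um, up)) \<in> Gamma_graph h" using that v by simp
    then obtain fa ga \<xi>a \<eta>a vm vp ap am c' \<tau>
      where nf: "normal_form f \<xi> \<alpha> g \<eta> \<beta> um up fa ga \<xi>a \<eta>a vm vp ap am c' \<tau>"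
      unfolding Gamma_graph_iff[OF F G] by (elim exE)
    note facts = normal_form_facts[OF nf G]
    have c: "c' i = c i" if "i \<le> Delta h" for i by (rule decomposition_unique[OF facts(1) d that])
    have c0: "c' 0 = c 0" by (rule c) simp
    have S: "(\<Sum>i<Delta h. of_real (dpar h i) * c' (i + 1)) = (\<Sum>i<Delta h. of_real (dpar h i) * c (i + 1))"
      by (intro sum.cong refl) (simp add: c)
    have e: "\<eta> 0 = am - ap - dsum c"
      using normal_form_relations(2)[OF nf G] unfolding S .
    have vm: "\<not> left_indivisible h \<Longrightarrow> value_minus h f g = um" by (rule value_minus_rep[OF _ facts(2)])
    have vp: "\<not> right_indivisible h \<Longrightarrow> value_plus h f g = up" by (rule value_plus_rep[OF _ facts(3)])
    show ?thesis
    proof (cases "left_indivisible h")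
      case True
      then have r: "\<not> right_indivisible h" using not_both_indivisible by blast
      have "um = vector [value_plus h f g $ 1 + \<eta> 0 + dsum c, c 0]"
        using facts(4,5) facts(6)[OF True] vp[OF r] c0 by (simp add: vec2_eq_iff e)
      then show ?thesis using True r vp v by simp
    next
      case False
      show ?thesis
      proof (cases "right_indivisible h")
        case True
        have "up = vector [value_minus h f g $ 1 - \<eta> 0 - dsum c, c 0]"
          using facts(4,5) facts(7)[OF True] vm[OF False] c0 by (simp add: vec2_eq_iff e)
        then show ?thesis using True False vm v by simp
      next
        case r: False
        then show ?thesis using False vm vp v by simp
      qed
    qed
  qed
  obtain v where "(((f, \<xi>, \<alpha>), (g, \<eta>, \<beta>)), v) \<in> Gamma_graph h" using T unfolding T_ring_iff by (elim exE)
  then have "(((f, \<xi>, \<alpha>), (g, \<eta>, \<beta>)), ?V) \<in> Gamma_graph h" using unique by simp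
  then show ?thesis unfolding Gamma_ring_def by (rule the_equality) (rule unique)
qed

end

theorem theorem3p7:
  fixes h :: indef_ham
    and f g :: "real \<Rightarrow> complex^2"
    and \<xi> \<eta> \<alpha> \<beta> :: "nat \<Rightarrow> complex"
  assumes "kind_A h"
    and "(f, \<xi>, \<alpha>) \<in> model_space h"
    and "(g, \<eta>, \<beta>) \<in> model_space h"
  shows
    "(((f, \<xi>, \<alpha>), (g, \<eta>, \<beta>)) \<in> T_ring h \<longleftrightarrow>
      (\<exists>f0 c.
         \<comment> \<open>(i)\<close>
         decomposition h f g f0 c \<and>
         \<comment> \<open>(ii)\<close>
         (o2 h = 0 \<longrightarrow>
            \<xi> (Delta h - 1) =
              w_Delta_integral h (g_reduced h g c)
              + 1/2 * (\<Sum>i<Delta h. of_real (dpar h (Delta h - 1 + i)) * c i)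
              + of_real (dpar h (2 * Delta h - 1)) * c (Delta h)
              - B_term h f g (Delta h)) \<and>
         (o2 h > 0 \<longrightarrow> \<alpha> (o2 h) = of_real (bpar h 1) * c (Delta h)) \<and>
         \<comment> \<open>(iii)\<close>
         (\<not> left_indivisible h \<and> \<not> right_indivisible h \<longrightarrow>
            \<eta> 0 = value_minus h f g $ 1 - value_plus h f g $ 1
                   - 1/2 * (\<Sum>i<Delta h. of_real (dpar h i) * c (i + 1))) \<and>
         \<comment> \<open>(iv)\<close>
         (\<forall>k\<in>{1..Delta h - 1}.
            \<eta> k = \<xi> (k - 1) - 1/2 * of_real (dpar h (k - 1)) * c 0
                   - 1/2 * of_real (dpar h (k + Delta h - 1)) * c (Delta h)
                   + B_term h f g k) \<and>
         \<comment> \<open>(v)\<close>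
         (o2 h > 0 \<longrightarrow>
            \<beta> 1 =
              w_Delta_integral h (g_reduced h g c)
              + 1/2 * (\<Sum>i<Delta h. of_real (dpar h (Delta h - 1 + i)) * c i)
              + of_real (dpar h (2 * Delta h - 1)) * c (Delta h)
              - \<xi> (Delta h - 1) - B_term h f g (Delta h) \<and>
            (\<forall>j\<in>{2..o2 h}.
               \<beta> j = \<alpha> (j - 1) - of_real (bpar h (o2 h + 2 - j)) * c (Delta h)))))
     \<and>
     (((f, \<xi>, \<alpha>), (g, \<eta>, \<beta>)) \<in> T_ring h \<longrightarrow>
      (\<forall>f0 c. decomposition h f g f0 c \<longrightarrow>
         fst (Gamma_ring h ((f, \<xi>, \<alpha>), (g, \<eta>, \<beta>))) =
           (if left_indivisible h
            then vector [value_plus h f g $ 1 + \<eta> 0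
                           + 1/2 * (\<Sum>i<Delta h. of_real (dpar h i) * c (i + 1)), c 0]
            else value_minus h f g) \<and>
         snd (Gamma_ring h ((f, \<xi>, \<alpha>), (g, \<eta>, \<beta>))) =
           (if right_indivisible h
            then vector [value_minus h f g $ 1 - \<eta> 0
                           - 1/2 * (\<Sum>i<Delta h. of_real (dpar h i) * c (i + 1)), c 0]
            else value_plus h f g)))"
proof -
  interpret kind_A_ham h by standard (rule assms(1))
  note T = T_ring_characterisation[OF assms(2,3), unfolded relations_def coord_rel_def]
  note V = Gamma_ring_values[OF assms(2,3)]
  show ?thesis
    by (intro conjI impI allI; (simp only: V fst_conv snd_conv)?) (simp only: T conj_ac)
qed

end
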